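(* Let $u\in L^2(-1,1)$ and $\eta\in\mathbb R_+$, and set $u_\ell=\int_{-1}^1u(x)P_\ell(x)\,dx$ for $\ell\in\mathbb N_0$. Then $u\in V^\eta(-1,1)$ if and only if $$\sum_{\ell=0}^\infty u_\ell^2\,\frac{2\ell+1}{2}\,(1+\ell^{2\eta})<+\infty ;$$ that is, $$\|u\|_{V^\eta(-1,1)}^2\simeq\sum_{\ell=0}^\infty u_\ell^2\,\frac{2\ell+1}{2}\,(1+\ell^{2\eta})$$ is an equivalent norm in $V^\eta(-1,1)$ (two-sided bounds with constants independent of $u$). For $k_I\in V^n(-1,1)$, $n\in\mathbb N_0$, where $k_I(\mu)=\sum_{\ell=0}^\infty A_\ell\frac{2\ell+1}{4\pi}P_\ell(\mu)$ is the covariance kernel, as a function of the inner product, of a centered isotropic Gaussian random field on $\mathbb S^2$ with angular power spectrum $(A_\ell,\ell\in\mathbb N_0)$, this translates to the relation that the sequence $(\ell^{n+1/2}A_\ell,\ \ell\ge n)$ is in $\ell^2(\mathbb N_0)$ if and only if the function $(1-\mu^2)^{n/2}\frac{\partial^n}{\partial\mu^n}k_I(\mu)$, $\mu\in(-1,1)$, is in $L^2(-1,1)$; that is, $$\frac1{(4\pi)^2}\sum_{\ell\ge n}A_\ell^2\,\frac{2\ell+1}{2}\,\ell^{2n}<+\infty\quad\text{if and only if}\quad\int_{-1}^1\Bigl|\frac{\partial^n}{\partial\mu^n}k_I(\mu)\Bigr|^2(1-\mu^2)^n\,d\mu<+\infty .$$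
   Context: $P_\ell$ denotes the $\ell$-th Legendre polynomial ($P_\ell(1)=1$), $\ell\in\mathbb N_0$; every $u\in L^2(-1,1)$ has the $L^2(-1,1)$-convergent expansion $u=\sum_{\ell}u_\ell\frac{2\ell+1}{2}P_\ell$. For $n\in\mathbb N_0$, $V^n(-1,1)$ is the closure of the standard Sobolev space $H^n(-1,1)$ with respect to the norm $\|u\|_{V^n(-1,1)}^2=\sum_{j=0}^n|u|_{V^j(-1,1)}^2$, where $|u|_{V^j(-1,1)}^2=\int_{-1}^1\bigl|\frac{\partial^j}{\partial\mu^j}u(\mu)\bigr|^2(1-\mu^2)^j\,d\mu$. For $n<\eta<n+1$, $V^\eta(-1,1)=(V^n(-1,1),V^{n+1}(-1,1))_{\eta-n,2}$ (real interpolation) with norm $\|u\|_{V^\eta(-1,1)}^2=\int_0^\infty t^{-2(\eta-n)}|K(t,u)|^2\frac{dt}{t}$, where $K(t,u)=\inf_{u=v+w}(\|v\|_{V^n(-1,1)}+t\|w\|_{V^{n+1}(-1,1)})$ for $t>0$. A centered isotropic Gaussian random field $T$ on the unit sphere $\mathbb S^2\subset\mathbb R^3$ is a jointly measurable, mean-zero, square-integrable Gaussian field with rotation-invariant covariance; its angular power spectrum is the sequence of nonnegative reals $(A_\ell)$ with $\mathbb E(T(x)T(y))=\sum_{\ell=0}^\infty A_\ell\frac{2\ell+1}{4\pi}P_\ell(\langle x,y\rangle_{\mathbb R^3})=k_I(\langle x,y\rangle_{\mathbb R^3})$ for all $x,y\in\mathbb S^2$. *)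

theory Defs
  imports "HOL-Probability.Probability" "HOL-Computational_Algebra.Polynomial"
begin

text \<open>Elements of $L^2(-1,1)$ are represented by functions on the reals of which only the
  values on $(-1,1)$, up to null sets, matter.\<close>

abbreviation lebesgue_I :: "real measure" where
  "lebesgue_I \<equiv> lebesgue_on {-1<..<1}"

definition L2_I :: "(real \<Rightarrow> real) set" where
  "L2_I = {u \<in> borel_measurable lebesgue_I. integrable lebesgue_I (\<lambda>x. (u x)\<^sup>2)}"

text \<open>Rodrigues' formula.\<close>

definition legendre_poly :: "nat \<Rightarrow> real poly" where
  "legendre_poly l = smult (1 / (2 ^ l * fact l)) ((pderiv ^^ l) ([:-1, 0, 1:] ^ l))"

definition legendre_coeff :: "(real \<Rightarrow> real) \<Rightarrow> nat \<Rightarrow> real" where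
  "legendre_coeff u l = (LINT x|lebesgue_I. u x * poly (legendre_poly l) x)"

definition test_function_I :: "(real \<Rightarrow> real) \<Rightarrow> bool" where
  "test_function_I \<phi> \<longleftrightarrow>
     (\<forall>k x. (deriv ^^ k) \<phi> differentiable (at x)) \<and>
     (\<exists>a b. -1 < a \<and> b < 1 \<and> (\<forall>x. x \<notin> {a..b} \<longrightarrow> \<phi> x = 0))"

definition locally_integrable_I :: "(real \<Rightarrow> real) \<Rightarrow> bool" where
  "locally_integrable_I u \<longleftrightarrow> (\<forall>a b. -1 < a \<longrightarrow> b < 1 \<longrightarrow> u absolutely_integrable_on {a..b})"

definition is_weak_deriv :: "nat \<Rightarrow> (real \<Rightarrow> real) \<Rightarrow> (real \<Rightarrow> real) \<Rightarrow> bool" where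
  "is_weak_deriv j u v \<longleftrightarrow> locally_integrable_I u \<and> locally_integrable_I v \<and>
     (\<forall>\<phi>. test_function_I \<phi> \<longrightarrow>
        (LINT x|lebesgue_I. u x * (deriv ^^ j) \<phi> x) = (-1) ^ j * (LINT x|lebesgue_I. v x * \<phi> x))"

text \<open>A representative of the weak derivative, which is unique up to null sets.
  The value is meaningful only if a weak derivative exists.\<close>

definition weak_deriv :: "nat \<Rightarrow> (real \<Rightarrow> real) \<Rightarrow> real \<Rightarrow> real" where
  "weak_deriv j u = (SOME v. is_weak_deriv j u v)"

definition sobolev_H :: "nat \<Rightarrow> (real \<Rightarrow> real) set" where
  "sobolev_H n = {u \<in> L2_I. \<forall>j\<le>n. \<exists>v. is_weak_deriv j u v \<and> v \<in> L2_I}"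

definition V_seminorm :: "nat \<Rightarrow> (real \<Rightarrow> real) \<Rightarrow> real" where
  "V_seminorm j u = sqrt (LINT x|lebesgue_I. \<bar>weak_deriv j u x\<bar>\<^sup>2 * (1 - x\<^sup>2) ^ j)"

definition V_norm_nat :: "nat \<Rightarrow> (real \<Rightarrow> real) \<Rightarrow> real" where
  "V_norm_nat n u = sqrt (\<Sum>j\<le>n. (V_seminorm j u)\<^sup>2)"

text \<open>The functions for which \<^const>\<open>V_norm_nat\<close> is defined and finite. This is a complete
  space, so the closure of $H^n(-1,1)$ in it is the completion of $H^n(-1,1)$.\<close>

definition V_ambient :: "nat \<Rightarrow> (real \<Rightarrow> real) set" where
  "V_ambient n = {u \<in> L2_I. \<forall>j\<le>n. \<exists>v. is_weak_deriv j u v \<and>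
                    integrable lebesgue_I (\<lambda>x. \<bar>v x\<bar>\<^sup>2 * (1 - x\<^sup>2) ^ j)}"

definition V_space_nat :: "nat \<Rightarrow> (real \<Rightarrow> real) set" where
  "V_space_nat n = {u \<in> V_ambient n. \<exists>f :: nat \<Rightarrow> real \<Rightarrow> real. (\<forall>k. f k \<in> sobolev_H n) \<and>
                      (\<lambda>k. V_norm_nat n (\<lambda>x. f k x - u x)) \<longlonglongrightarrow> 0}"

text \<open>The K-functional of the couple $(V^n, V^{n+1})$. For \<open>u \<in> V_space_nat n\<close> the infimum is
  over a nonempty set of nonnegative reals.\<close>

definition V_K_functional :: "nat \<Rightarrow> real \<Rightarrow> (real \<Rightarrow> real) \<Rightarrow> real" where
  "V_K_functional n t u = Inf {V_norm_nat n v + t * V_norm_nat (Suc n) w | v w.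
     v \<in> V_space_nat n \<and> w \<in> V_space_nat (Suc n) \<and> (AE x in lebesgue_I. u x = v x + w x)}"

definition V_interp_integrand :: "nat \<Rightarrow> real \<Rightarrow> (real \<Rightarrow> real) \<Rightarrow> real \<Rightarrow> real" where
  "V_interp_integrand n \<theta> u t = t powr (- 2 * \<theta>) * \<bar>V_K_functional n t u\<bar>\<^sup>2 / t"

text \<open>For non-integer \<open>\<eta>\<close>, the sum $V^n + V^{n+1}$ underlying the interpolation space is $V^n$,
  where \<open>n = \<lfloor>\<eta>\<rfloor>\<close>.\<close>

definition V_space :: "real \<Rightarrow> (real \<Rightarrow> real) set" where
  "V_space \<eta> =
     (let n = nat \<lfloor>\<eta>\<rfloor> in
      if \<eta> = real n then V_space_nat n
      else {u \<in> V_space_nat n.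
              integrable (lebesgue_on {0<..}) (V_interp_integrand n (\<eta> - real n) u)})"

definition V_norm :: "real \<Rightarrow> (real \<Rightarrow> real) \<Rightarrow> real" where
  "V_norm \<eta> u =
     (let n = nat \<lfloor>\<eta>\<rfloor> in
      if \<eta> = real n then V_norm_nat n u
      else sqrt (LINT t|lebesgue_on {0<..}. V_interp_integrand n (\<eta> - real n) u t))"

text \<open>The factor $1 + \ell^{2\eta}$ with the convention $0^0 = 1$ (whereas \<open>0 powr 0 = 0\<close>).\<close>

definition legendre_weight :: "real \<Rightarrow> nat \<Rightarrow> real" where
  "legendre_weight \<eta> l = 1 + (if \<eta> = 0 then 1 else real l powr (2 * \<eta>))"

text \<open>Degenerate (constant) normal distributions are included.\<close>

definition normal_rv :: "'w measure \<Rightarrow> ('w \<Rightarrow> real) \<Rightarrow> bool" where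
  "normal_rv M X \<longleftrightarrow> X \<in> borel_measurable M \<and>
     ((\<exists>m. AE \<omega> in M. X \<omega> = m) \<or>
      (\<exists>m \<sigma>. 0 < \<sigma> \<and> distributed M lborel X (normal_density m \<sigma>)))"

definition centered_isotropic_gaussian_field :: "'w measure \<Rightarrow> (real^3 \<Rightarrow> 'w \<Rightarrow> real) \<Rightarrow> bool" where
  "centered_isotropic_gaussian_field M T \<longleftrightarrow>
     prob_space M \<and>
     (\<lambda>(\<omega>, x). T x \<omega>) \<in> borel_measurable (M \<Otimes>\<^sub>M restrict_space borel (sphere 0 1)) \<and>
     (\<forall>S c. finite S \<longrightarrow> S \<subseteq> sphere 0 1 \<longrightarrow> normal_rv M (\<lambda>\<omega>. \<Sum>x\<in>S. c x * T x \<omega>)) \<and>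
     (\<forall>x\<in>sphere 0 1. integrable M (\<lambda>\<omega>. (T x \<omega>)\<^sup>2)) \<and>
     (\<forall>x\<in>sphere 0 1. (LINT \<omega>|M. T x \<omega>) = 0) \<and>
     (\<forall>Q x y. rotation_matrix Q \<longrightarrow> x \<in> sphere 0 1 \<longrightarrow> y \<in> sphere 0 1 \<longrightarrow>
        (LINT \<omega>|M. T (Q *v x) \<omega> * T (Q *v y) \<omega>) = (LINT \<omega>|M. T x \<omega> * T y \<omega>))"

definition angular_power_spectrum ::
    "'w measure \<Rightarrow> (real^3 \<Rightarrow> 'w \<Rightarrow> real) \<Rightarrow> (nat \<Rightarrow> real) \<Rightarrow> bool" where
  "angular_power_spectrum M T A \<longleftrightarrow>
     (\<forall>l. 0 \<le> A l) \<and>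
     (\<forall>x\<in>sphere 0 1. \<forall>y\<in>sphere 0 1.
        (\<lambda>l. A l * ((2 * real l + 1) / (4 * pi)) * poly (legendre_poly l) (x \<bullet> y))
          sums (LINT \<omega>|M. T x \<omega> * T y \<omega>))"

definition cov_kernel :: "(nat \<Rightarrow> real) \<Rightarrow> real \<Rightarrow> real" where
  "cov_kernel A \<mu> = (\<Sum>l. A l * ((2 * real l + 1) / (4 * pi)) * poly (legendre_poly l) \<mu>)"

end

theory Submission
  imports Defs "HOL-Real_Asymp.Real_Asymp"
begin

text \<open>
The whole statement rests on one orthogonality relation. Put \<open>w = 1 - x\<^sup>2\<close> and let \<open>u\<^sub>l\<close> be the
Legendre coefficients of \<open>u\<close>. The \<open>j\<close>-th derivative of the Legendre equation is a Sturm--Liouville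
equation with weight \<open>w ^ j\<close>, so that applying \<open>D ^ j\<close> to \<open>w ^ j P\<^sub>l\<^sup>(\<^sup>j\<^sup>)\<close> gives back \<open>P\<^sub>l\<close> up to the sign
\<open>(-1) ^ j\<close> and the factor \<open>\<lambda> j l = (l + j)! / (l - j)!\<close>, read as zero for \<open>l < j\<close>. Hence the
\<open>P\<^sub>l\<^sup>(\<^sup>j\<^sup>)\<close> are orthogonal for the weight \<open>w ^ j\<close>, and if \<open>u\<close> has a weak \<open>j\<close>-th derivative \<open>v\<close> with
\<open>\<integral> v\<^sup>2 w ^ j < \<infinity>\<close>, integration by parts turns the coefficients of \<open>v\<close> into those of \<open>u\<close>. Bessel's
inequality then bounds \<open>\<Sum> u\<^sub>l\<^sup>2 (2 l + 1) / 2 \<lambda> j l\<close>. Conversely, if this sum is finite, the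
differentiated Legendre series converges in the weighted space (Riesz--Fischer), its sum is a weak
derivative of \<open>u\<close>, and the squared seminorm of \<open>u\<close> equals the sum. So for integer order the space
\<open>V\<close> and its norm are described exactly, by \<open>V_space_nat_iff\<close> and \<open>V_norm_nat_power2\<close>, and it only
remains to compare \<open>\<Sum>j\<le>n. \<lambda> j l\<close> with \<open>(1 + l) ^ (2 n)\<close>.

Three facts about weak derivatives carry this argument. They are unique up to null sets
(\<open>fundamental_lemma_of_calculus_of_variations\<close>); the same lemma, combined with Weierstrass
approximation, yields completeness of the Legendre polynomials. Polynomials have their classical
derivatives as weak derivatives. And integration by parts is valid against \<open>w ^ j p\<close> for every
polynomial \<open>p\<close>, although this is not a test function (\<open>weak_deriv_parts_weighted\<close>): it vanishes
to order \<open>j\<close> at both end points, which is exactly what makes the \<open>j\<close>-th derivative of its product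
with a cutoff at scale \<open>1 / n\<close> bounded uniformly in \<open>n\<close>, so that dominated convergence applies.

For non-integer order \<open>n + \<theta>\<close> both spaces of the couple are weighted sequence spaces in the Legendre
coefficients. Splitting a function at the frequency where \<open>t (1 + l) = 1\<close> is optimal up to constants,
so the square of the K-functional is comparable to
\<open>\<Sum> u\<^sub>l\<^sup>2 (2 l + 1) / 2 (1 + l) ^ (2 n) min 1 (t\<^sup>2 (1 + l)\<^sup>2)\<close>. Integrating against
\<open>t powr (- 2 \<theta> - 1)\<close>, term by term, produces the weight \<open>(1 + l) powr (2 (n + \<theta>))\<close>.

For a covariance kernel, evaluating the expansion at two equal points shows that \<open>A\<^sub>l (2 l + 1)\<close> is
summable. So the kernel is square integrable with Legendre coefficients \<open>A\<^sub>l / (2 \<pi>)\<close>, and both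
equivalences are instances of the description of weak derivatives of a single order \<open>n\<close>.
\<close>

section \<open>Square integrable functions and orthogonal series\<close>

definition L2 :: "'a measure \<Rightarrow> ('a \<Rightarrow> real) set" where
  "L2 M = {f \<in> borel_measurable M. integrable M (\<lambda>x. (f x)\<^sup>2)}"

lemma L2_measurable [measurable_dest]:
  "f \<in> L2 M \<Longrightarrow> f \<in> borel_measurable M"
  by (simp add: L2_def)

lemma L2_integrable_power2: "f \<in> L2 M \<Longrightarrow> integrable M (\<lambda>x. (f x)\<^sup>2)"
  by (simp add: L2_def)

lemma L2_mult:
  assumes "f \<in> L2 M" "g \<in> L2 M"
  shows "integrable M (\<lambda>x. f x * g x)"
proof (rule Bochner_Integration.integrable_bound)
  show "integrable M (\<lambda>x. (f x)\<^sup>2 + (g x)\<^sup>2)"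
    using assms by (simp add: L2_def)
  show "AE x in M. norm (f x * g x) \<le> norm ((f x)\<^sup>2 + (g x)\<^sup>2)"
  proof (rule AE_I2)
    fix x
    have "0 \<le> (\<bar>f x\<bar> - \<bar>g x\<bar>)\<^sup>2" "0 \<le> (f x)\<^sup>2 + (g x)\<^sup>2" by simp_all
    moreover have "0 \<le> \<bar>f x\<bar> * \<bar>g x\<bar>" by simp
    ultimately have "\<bar>f x\<bar> * \<bar>g x\<bar> \<le> (f x)\<^sup>2 + (g x)\<^sup>2"
      unfolding power2_diff power2_abs by linarith
    then show "norm (f x * g x) \<le> norm ((f x)\<^sup>2 + (g x)\<^sup>2)"
      by (simp add: abs_mult)
  qed
qed (use assms in \<open>auto simp: L2_def\<close>)

lemma L2_scale:
  assumes "f \<in> L2 M" shows "(\<lambda>x. c * f x) \<in> L2 M"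
  using assms by (auto simp: L2_def power_mult_distrib)

lemma L2_add:
  assumes "f \<in> L2 M" "g \<in> L2 M"
  shows "(\<lambda>x. f x + g x) \<in> L2 M"
  using assms L2_mult[OF assms]
  by (auto simp: L2_def power2_sum mult.assoc)

lemma L2_diff:
  assumes "f \<in> L2 M" "g \<in> L2 M"
  shows "(\<lambda>x. f x - g x) \<in> L2 M"
  using L2_add[OF assms(1) L2_scale[OF assms(2), of "-1"]] by simp

lemma L2_sum:
  assumes "\<And>i. i \<in> F \<Longrightarrow> f i \<in> L2 M"
  shows "(\<lambda>x. \<Sum>i\<in>F. f i x) \<in> L2 M"
  using assms
proof (induction F rule: infinite_finite_induct)
  case (insert x F)
  then show ?case by (simp add: L2_add)
qed (simp_all add: L2_def)

lemma L2_bounded: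
  assumes "finite_measure M" "f \<in> borel_measurable M" "\<And>x. x \<in> space M \<Longrightarrow> \<bar>f x\<bar> \<le> B"
  shows "f \<in> L2 M"
proof -
  interpret finite_measure M by fact
  have "integrable M (\<lambda>x. (f x)\<^sup>2)"
  proof (rule integrable_const_bound)
    show "AE x in M. norm ((f x)\<^sup>2) \<le> B\<^sup>2"
      using assms(3) by (intro AE_I2) (simp add: abs_le_square_iff[symmetric] order_trans[OF _ abs_ge_self])
  qed (use assms(2) in measurable)
  with assms(2) show ?thesis by (simp add: L2_def)
qed

lemma L2_imp_L1:
  assumes "finite_measure M" "f \<in> L2 M"
  shows "integrable M f"
  using L2_mult[OF assms(2) L2_bounded[OF assms(1), of "\<lambda>_. 1" 1]] by simp

lemma integral_power2_diff:
  assumes "f \<in> L2 M" "g \<in> L2 M"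
  shows "(LINT x|M. (f x - c * g x)\<^sup>2) = (LINT x|M. (f x)\<^sup>2) - 2 * c * (LINT x|M. f x * g x) + c\<^sup>2 * (LINT x|M. (g x)\<^sup>2)"
proof -
  have "(LINT x|M. (f x - c * g x)\<^sup>2) = (LINT x|M. (f x)\<^sup>2 - 2 * c * (f x * g x) + c\<^sup>2 * (g x)\<^sup>2)"
    by (intro Bochner_Integration.integral_cong) (auto simp: power2_eq_square algebra_simps)
  also have "\<dots> = (LINT x|M. (f x)\<^sup>2) - 2 * c * (LINT x|M. f x * g x) + c\<^sup>2 * (LINT x|M. (g x)\<^sup>2)"
    using assms L2_mult[OF assms] by (simp add: L2_integrable_power2)
  finally show ?thesis .
qed

lemma Cauchy_Schwarz_integral:
  assumes "f \<in> L2 M" "g \<in> L2 M"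
  shows "(LINT x|M. f x * g x)\<^sup>2 \<le> (LINT x|M. (f x)\<^sup>2) * (LINT x|M. (g x)\<^sup>2)"
proof -
  define A B C where "A = (LINT x|M. (f x)\<^sup>2)" and "B = (LINT x|M. f x * g x)" and "C = (LINT x|M. (g x)\<^sup>2)"
  have quad: "0 \<le> A - 2 * t * B + t\<^sup>2 * C" for t
    unfolding A_def B_def C_def integral_power2_diff[OF assms, symmetric]
    by simp
  have "C \<ge> 0" unfolding C_def by simp
  have "B\<^sup>2 \<le> A * C"
  proof (cases "C = 0")
    case True
    show ?thesis
    proof (cases "B = 0")
      case False
      with quad[of "(A + 1) / (2 * B)"] True show ?thesis by simp
    qed (simp add: True)
  next
    case False
    with \<open>C \<ge> 0\<close> have "C > 0" by simp
    with quad[of "B / C"] show ?thesis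
      by (simp add: power2_eq_square field_simps)
  qed
  then show ?thesis unfolding A_def B_def C_def .
qed

text \<open>Strong convergence implies weak convergence, by the Cauchy--Schwarz inequality.\<close>
lemma tendsto_integral_mult_of_L2:
  assumes "\<And>n. f n \<in> L2 M" "g \<in> L2 M" "h \<in> L2 M"
    and lim: "(\<lambda>n. LINT x|M. (f n x - g x)\<^sup>2) \<longlonglongrightarrow> 0"
  shows "(\<lambda>n. LINT x|M. f n x * h x) \<longlonglongrightarrow> (LINT x|M. g x * h x)"
proof -
  have le: "((LINT x|M. f n x * h x) - (LINT x|M. g x * h x))\<^sup>2 \<le> (LINT x|M. (f n x - g x)\<^sup>2) * (LINT x|M. (h x)\<^sup>2)" for n
    using Cauchy_Schwarz_integral[OF L2_diff[OF assms(1)[of n] assms(2)] assms(3)]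
      L2_mult[OF assms(1)[of n] assms(3)] L2_mult[OF assms(2) assms(3)]
    by (simp add: left_diff_distrib)
  have "(\<lambda>n. ((LINT x|M. f n x * h x) - (LINT x|M. g x * h x))\<^sup>2) \<longlonglongrightarrow> 0"
  proof (rule real_tendsto_sandwich[OF _ _ tendsto_const])
    show "(\<lambda>n. (LINT x|M. (f n x - g x)\<^sup>2) * (LINT x|M. (h x)\<^sup>2)) \<longlonglongrightarrow> 0"
      using tendsto_mult[OF lim tendsto_const] by simp
  qed (use le in auto)
  then have "(\<lambda>n. sqrt (((LINT x|M. f n x * h x) - (LINT x|M. g x * h x))\<^sup>2)) \<longlonglongrightarrow> sqrt 0"
    by (rule tendsto_real_sqrt)
  then show ?thesis
    by (simp add: tendsto_rabs_zero_iff LIM_zero_iff)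
qed

lemma tendsto_integral_power2_of_L2:
  assumes "\<And>n. f n \<in> L2 M" "g \<in> L2 M"
    and lim: "(\<lambda>n. LINT x|M. (f n x - g x)\<^sup>2) \<longlonglongrightarrow> 0"
  shows "(\<lambda>n. LINT x|M. (f n x)\<^sup>2) \<longlonglongrightarrow> (LINT x|M. (g x)\<^sup>2)"
proof -
  have eq: "(LINT x|M. (f n x)\<^sup>2) = (LINT x|M. (f n x - g x)\<^sup>2) + 2 * (LINT x|M. f n x * g x) - (LINT x|M. (g x)\<^sup>2)" for n
    using integral_power2_diff[OF assms(1)[of n] assms(2), of 1] by simp
  have "(\<lambda>n. (LINT x|M. (f n x - g x)\<^sup>2) + 2 * (LINT x|M. f n x * g x) - (LINT x|M. (g x)\<^sup>2))
      \<longlonglongrightarrow> 0 + 2 * (LINT x|M. g x * g x) - (LINT x|M. (g x)\<^sup>2)"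
    by (intro tendsto_intros lim tendsto_integral_mult_of_L2 assms)
  then show ?thesis unfolding eq by (simp add: power2_eq_square)
qed

text \<open>A subsequence of an \<open>L\<^sup>2\<close>-convergent sequence converges almost everywhere.\<close>
lemma L2_limit_AE_eq_pointwise_limit:
  assumes "\<And>n. f n \<in> L2 M" "g \<in> L2 M"
    and lim: "(\<lambda>n. LINT x|M. (f n x - g x)\<^sup>2) \<longlonglongrightarrow> 0"
    and pw: "AE x in M. (\<lambda>n. f n x) \<longlonglongrightarrow> h x"
  shows "AE x in M. g x = h x"
proof -
  obtain r :: "nat \<Rightarrow> nat" where r: "strict_mono r" "AE x in M. (\<lambda>n. (f (r n) x - g x)\<^sup>2) \<longlonglongrightarrow> 0"
    using tendsto_L1_AE_subseq[of M "\<lambda>n x. (f n x - g x)\<^sup>2"] lim assms(1,2)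
    by (auto simp: L2_integrable_power2 L2_diff)
  from r(2) pw show ?thesis
  proof eventually_elim
    case (elim x)
    have "(\<lambda>n. sqrt ((f (r n) x - g x)\<^sup>2)) \<longlonglongrightarrow> sqrt 0"
      by (rule tendsto_real_sqrt[OF elim(1)])
    then have "(\<lambda>n. f (r n) x) \<longlonglongrightarrow> g x"
      by (simp add: tendsto_rabs_zero_iff LIM_zero_iff)
    moreover have "(\<lambda>n. f (r n) x) \<longlonglongrightarrow> h x"
      using LIMSEQ_subseq_LIMSEQ[OF elim(2) r(1)] by (simp add: o_def)
    ultimately show "g x = h x" by (rule LIMSEQ_unique)
  qed
qed

text \<open>On a finite measure space the \<open>L\<^sup>1\<close> norms of the increments are bounded by their \<open>L\<^sup>2\<close> norms,
  so the increments are absolutely summable almost everywhere.\<close>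
lemma L2_fast_Cauchy_AE_convergent:
  assumes M: "finite_measure M" and f: "\<And>n. f n \<in> L2 M"
    and fast: "\<And>n. (LINT x|M. (f (Suc n) x - f n x)\<^sup>2) \<le> (1/4) ^ n"
  shows "AE x in M. convergent (\<lambda>n. f n x)"
proof -
  interpret finite_measure M by fact
  define d where "d n x = \<bar>f (Suc n) x - f n x\<bar>" for n x
  have dsq: "d n \<in> L2 M" for n
    using L2_diff[OF f f, of "Suc n" n]
    unfolding L2_def d_def[abs_def] by auto
  have dint: "integrable M (d n)" for n
    by (rule L2_imp_L1[OF M dsq])
  define K where "K = sqrt (measure M (space M))"
  have L1: "(LINT x|M. d n x) \<le> K * (1/2) ^ n" for n
  proof (rule power2_le_imp_le)
    have "(LINT x|M. d n x * 1)\<^sup>2 \<le> (LINT x|M. (d n x)\<^sup>2) * (LINT x|M. 1\<^sup>2)"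
      by (rule Cauchy_Schwarz_integral[OF dsq L2_bounded[OF M, of "\<lambda>_. 1" 1]]) auto
    also have "\<dots> \<le> (1/4) ^ n * measure M (space M)"
      using fast[of n] by (simp add: d_def mult_right_mono)
    also have "(1/4 :: real) ^ n = ((1/2) ^ n)\<^sup>2"
      by (simp add: power2_eq_square power_mult_distrib[symmetric])
    finally show "(LINT x|M. d n x)\<^sup>2 \<le> (K * (1/2) ^ n)\<^sup>2"
      by (simp add: K_def power_mult_distrib mult.commute)
  qed (simp add: K_def)
  have meas [measurable]: "d n \<in> borel_measurable M" for n
    using dint by simp
  have "(\<integral>\<^sup>+x. (\<Sum>n. ennreal (d n x)) \<partial>M) = (\<Sum>n. \<integral>\<^sup>+x. ennreal (d n x) \<partial>M)"
    by (rule nn_integral_suminf) measurable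
  also have "\<dots> = (\<Sum>n. ennreal (LINT x|M. d n x))"
    by (intro suminf_cong nn_integral_eq_integral dint) (simp add: d_def)
  also have "\<dots> \<le> (\<Sum>n. ennreal (K * (1/2) ^ n))"
    by (intro suminf_le ennreal_leI L1) auto
  also have "\<dots> = ennreal (\<Sum>n. K * (1/2) ^ n)"
    by (intro suminf_ennreal2) (auto simp: K_def intro!: summable_mult)
  finally have "(\<integral>\<^sup>+x. (\<Sum>n. ennreal (d n x)) \<partial>M) \<noteq> \<infinity>"
    by (auto simp: top_unique)
  then have "AE x in M. (\<Sum>n. ennreal (d n x)) \<noteq> \<infinity>"
    by (intro nn_integral_PInf_AE) auto
  then show ?thesis
  proof eventually_elim
    case (elim x)
    then have "summable (\<lambda>n. d n x)"
      by (intro summable_suminf_not_top) (auto simp: d_def)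
    then have "summable (\<lambda>n. f (Suc n) x - f n x)"
      unfolding d_def by (rule summable_rabs_cancel)
    then have "convergent (\<lambda>N. \<Sum>n<N. f (Suc n) x - f n x)"
      by (simp add: summable_iff_convergent)
    then have "convergent (\<lambda>N. f N x - f 0 x)"
      by (subst (asm) sum_lessThan_telescope)
    then show "convergent (\<lambda>n. f n x)"
      using convergent_add[OF _ convergent_const, of "\<lambda>N. f N x - f 0 x" "f 0 x"] by simp
  qed
qed

text \<open>The limit is the pointwise limit of a rapidly converging subsequence, and Fatou's lemma transfers
  the Cauchy estimate to it.\<close>
lemma L2_complete:
  assumes M: "finite_measure M" and f: "\<And>n. f n \<in> L2 M"
    and Cauchy: "\<And>e::real. e > 0 \<Longrightarrow> \<exists>N. \<forall>m\<ge>N. \<forall>n\<ge>N. (LINT x|M. (f m x - f n x)\<^sup>2) < e"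
  shows "\<exists>g\<in>L2 M. (\<lambda>n. LINT x|M. (f n x - g x)\<^sup>2) \<longlonglongrightarrow> 0"
proof -
  have "\<forall>k. \<exists>N. \<forall>m\<ge>N. \<forall>n\<ge>N. (LINT x|M. (f m x - f n x)\<^sup>2) < (1/4) ^ k"
    using Cauchy by simp
  then obtain N where N: "\<And>k m n. m \<ge> N k \<Longrightarrow> n \<ge> N k \<Longrightarrow> (LINT x|M. (f m x - f n x)\<^sup>2) < (1/4) ^ k"
    by metis
  \<comment> \<open>Adding up the indices makes the subsequence monotone, and adding \<open>k\<close> makes it unbounded.\<close>
  define r where "r k = (\<Sum>i\<le>k. N i) + k" for k
  have r: "N k \<le> r k" "r k \<le> r (Suc k)" "k \<le> r k" for k
    unfolding r_def by (auto intro: trans_le_add1 member_le_sum)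
  have "AE x in M. convergent (\<lambda>k. f (r k) x)"
  proof (rule L2_fast_Cauchy_AE_convergent[OF M f])
    show "(LINT x|M. (f (r (Suc n)) x - f (r n) x)\<^sup>2) \<le> (1/4) ^ n" for n
      using N[of n "r (Suc n)" "r n"] r(1,2)[of n] by simp
  qed
  define g where "g x = lim (\<lambda>k. f (r k) x)" for x
  have fm [measurable]: "f n \<in> borel_measurable M" for n
    using f by (simp add: L2_def)
  have gm [measurable]: "g \<in> borel_measurable M"
    unfolding g_def by measurable
  have conv: "AE x in M. (\<lambda>k. f (r k) x) \<longlonglongrightarrow> g x"
    using \<open>AE x in M. convergent (\<lambda>k. f (r k) x)\<close>
    by eventually_elim (simp add: g_def convergent_LIMSEQ_iff)
  have bound: "(\<integral>\<^sup>+x. ennreal ((f n x - g x)\<^sup>2) \<partial>M) \<le> ennreal e"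
    if N': "\<forall>m\<ge>N'. \<forall>n\<ge>N'. (LINT x|M. (f m x - f n x)\<^sup>2) < e" and "n \<ge> N'" for n N' e
  proof -
    have "(\<integral>\<^sup>+x. ennreal ((f n x - g x)\<^sup>2) \<partial>M) = (\<integral>\<^sup>+x. liminf (\<lambda>k. ennreal ((f n x - f (r k) x)\<^sup>2)) \<partial>M)"
      using conv
    proof (intro nn_integral_cong_AE, eventually_elim)
      case (elim x)
      have "(\<lambda>k. ennreal ((f n x - f (r k) x)\<^sup>2)) \<longlonglongrightarrow> ennreal ((f n x - g x)\<^sup>2)"
        by (intro tendsto_intros elim)
      then show ?case by (rule lim_imp_Liminf[symmetric, rotated]) simp
    qed
    also have "\<dots> \<le> liminf (\<lambda>k. \<integral>\<^sup>+x. ennreal ((f n x - f (r k) x)\<^sup>2) \<partial>M)"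
      by (intro nn_integral_liminf) measurable
    also have "\<dots> \<le> liminf (\<lambda>k::nat. ennreal e)"
    proof (rule Liminf_mono)
      show "\<forall>\<^sub>F k in sequentially. (\<integral>\<^sup>+x. ennreal ((f n x - f (r k) x)\<^sup>2) \<partial>M) \<le> ennreal e"
        using eventually_ge_at_top[of N']
      proof eventually_elim
        case (elim k)
        have "(LINT x|M. (f n x - f (r k) x)\<^sup>2) < e"
          using N' \<open>n \<ge> N'\<close> elim r(3)[of k] by (meson order_trans)
        moreover have "(\<integral>\<^sup>+x. ennreal ((f n x - f (r k) x)\<^sup>2) \<partial>M) = ennreal (LINT x|M. (f n x - f (r k) x)\<^sup>2)"
          by (intro nn_integral_eq_integral L2_integrable_power2 L2_diff f) auto
        ultimately show ?case by (simp add: ennreal_leI)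
      qed
    qed
    finally show ?thesis by (simp add: Liminf_const)
  qed
  obtain N1 where N1: "\<forall>m\<ge>N1. \<forall>n\<ge>N1. (LINT x|M. (f m x - f n x)\<^sup>2) < 1"
    using Cauchy[of 1] by auto
  have "(\<integral>\<^sup>+x. ennreal ((f N1 x - g x)\<^sup>2) \<partial>M) < \<infinity>"
    using le_less_trans[OF bound[OF N1, of N1] ennreal_less_top] by simp
  then have "integrable M (\<lambda>x. (f N1 x - g x)\<^sup>2)"
    by (intro integrableI_nonneg) auto
  then have "(\<lambda>x. f N1 x - g x) \<in> L2 M"
    by (simp add: L2_def)
  from L2_diff[OF f[of N1] this] have g: "g \<in> L2 M"
    by simp
  have "(\<lambda>n. LINT x|M. (f n x - g x)\<^sup>2) \<longlonglongrightarrow> 0"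
  proof (rule LIMSEQ_I)
    fix e :: real assume "e > 0"
    then obtain N' where N': "\<forall>m\<ge>N'. \<forall>n\<ge>N'. (LINT x|M. (f m x - f n x)\<^sup>2) < e / 2"
      using Cauchy[of "e / 2"] by auto
    have "norm ((LINT x|M. (f n x - g x)\<^sup>2) - 0) < e" if "n \<ge> N'" for n
    proof -
      have "ennreal (LINT x|M. (f n x - g x)\<^sup>2) = (\<integral>\<^sup>+x. ennreal ((f n x - g x)\<^sup>2) \<partial>M)"
        by (intro nn_integral_eq_integral[symmetric] L2_integrable_power2 L2_diff f g) auto
      with bound[OF N' that] \<open>e > 0\<close> have "(LINT x|M. (f n x - g x)\<^sup>2) \<le> e / 2"
        by (metis ennreal_le_iff half_gt_zero less_imp_le)
      with \<open>e > 0\<close> show ?thesis by simp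
    qed
    then show "\<exists>N'. \<forall>n\<ge>N'. norm ((LINT x|M. (f n x - g x)\<^sup>2) - 0) < e" by blast
  qed
  with g show ?thesis by blast
qed

lemma integral_power2_orthogonal_sum:
  assumes e: "\<And>l. e l \<in> L2 M"
    and orth: "\<And>i k. i \<noteq> k \<Longrightarrow> (LINT x|M. e i x * e k x) = 0"
    and norm: "\<And>l. (LINT x|M. (e l x)\<^sup>2) = h l"
    and "finite F"
  shows "(LINT x|M. (\<Sum>l\<in>F. b l * e l x)\<^sup>2) = (\<Sum>l\<in>F. (b l)\<^sup>2 * h l)"
  using \<open>finite F\<close>
proof (induction F)
  case (insert k F)
  have S: "(\<lambda>x. \<Sum>l\<in>F. b l * e l x) \<in> L2 M"
    by (intro L2_sum L2_scale e)
  have "(LINT x|M. (\<Sum>l\<in>F. b l * e l x) * e k x) = (\<Sum>l\<in>F. b l * (LINT x|M. e l x * e k x))"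
    by (simp add: sum_distrib_right mult.assoc L2_mult[OF e e])
  also have "\<dots> = 0"
    using insert.hyps by (intro sum.neutral ballI) (metis mult_zero_right orth)
  finally have "(LINT x|M. ((\<Sum>l\<in>F. b l * e l x) - (- b k) * e k x)\<^sup>2) = (\<Sum>l\<in>F. (b l)\<^sup>2 * h l) + (b k)\<^sup>2 * h k"
    by (subst integral_power2_diff[OF S e]) (simp add: insert.IH norm)
  then show ?case
    using insert.hyps by (simp add: add.commute)
qed simp

text \<open>The coefficients \<open>b l\<close> are normalized by \<open>h l\<close>, the squared norm of \<open>e l\<close>, without dividing by it.
  This allows \<open>e l = 0\<close>, which occurs for derivatives of Legendre polynomials of low degree.\<close>
lemma bessel_inequality:
  assumes e: "\<And>l. e l \<in> L2 M"
    and orth: "\<And>i k. i \<noteq> k \<Longrightarrow> (LINT x|M. e i x * e k x) = 0"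
    and norm: "\<And>l. (LINT x|M. (e l x)\<^sup>2) = h l"
    and f: "f \<in> L2 M" and coeff: "\<And>l. (LINT x|M. f x * e l x) = b l * h l"
  shows "summable (\<lambda>l. (b l)\<^sup>2 * h l)"
proof -
  have h: "h l \<ge> 0" for l unfolding norm[symmetric] by simp
  have "(\<Sum>l\<in>F. (b l)\<^sup>2 * h l) \<le> (LINT x|M. (f x)\<^sup>2)" if "finite F" for F
  proof -
    have S: "(\<lambda>x. \<Sum>l\<in>F. b l * e l x) \<in> L2 M"
      by (intro L2_sum L2_scale e)
    have "(LINT x|M. f x * (\<Sum>l\<in>F. b l * e l x)) = (\<Sum>l\<in>F. b l * (LINT x|M. f x * e l x))"
      by (simp add: sum_distrib_left mult.left_commute L2_mult[OF f e])
    then have "(LINT x|M. f x * (\<Sum>l\<in>F. b l * e l x)) = (\<Sum>l\<in>F. (b l)\<^sup>2 * h l)"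
      by (simp add: coeff power2_eq_square mult.assoc)
    moreover have "0 \<le> (LINT x|M. (f x - 1 * (\<Sum>l\<in>F. b l * e l x))\<^sup>2)" by (rule Bochner_Integration.integral_nonneg) simp
    moreover have "(LINT x|M. (\<Sum>l\<in>F. b l * e l x)\<^sup>2) = (\<Sum>l\<in>F. (b l)\<^sup>2 * h l)"
      by (intro integral_power2_orthogonal_sum e orth norm that)
    ultimately show ?thesis
      using integral_power2_diff[OF f S, of 1] by (simp only: power_one mult_1 mult_1_right)
  qed
  then show ?thesis
    using h by (intro bounded_imp_summable[where B = "LINT x|M. (f x)\<^sup>2"]) auto
qed

text \<open>The partial sums form a Cauchy sequence because, by orthogonality, the squared norm of a block of
  the series is a block of the convergent series of the \<open>(b l)\<^sup>2 * h l\<close>.\<close>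
lemma riesz_fischer:
  assumes M: "finite_measure M" and e: "\<And>l. e l \<in> L2 M"
    and orth: "\<And>i k. i \<noteq> k \<Longrightarrow> (LINT x|M. e i x * e k x) = 0"
    and norm: "\<And>l. (LINT x|M. (e l x)\<^sup>2) = h l"
    and summ: "summable (\<lambda>l. (b l)\<^sup>2 * h l)"
  shows "\<exists>g\<in>L2 M.
    (\<lambda>N. LINT x|M. ((\<Sum>l<N. b l * e l x) - g x)\<^sup>2) \<longlonglongrightarrow> 0 \<and>
    (LINT x|M. (g x)\<^sup>2) = (\<Sum>l. (b l)\<^sup>2 * h l) \<and>
    (\<forall>k. (LINT x|M. g x * e k x) = b k * h k)"
proof -
  define S where "S N x = (\<Sum>l<N. b l * e l x)" for N x
  have S: "S N \<in> L2 M" for N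
    unfolding S_def by (intro L2_sum L2_scale e)
  have h: "h l \<ge> 0" for l unfolding norm[symmetric] by simp
  have diff: "(LINT x|M. (S n x - S m x)\<^sup>2) = (\<Sum>l\<in>{m..<n}. (b l)\<^sup>2 * h l)" if "m \<le> n" for m n
  proof -
    have "S n x - S m x = (\<Sum>l\<in>{m..<n}. b l * e l x)" for x
      unfolding S_def using that by (simp add: sum_diff_nat_ivl lessThan_atLeast0)
    then show ?thesis
      by (simp add: integral_power2_orthogonal_sum[OF e orth norm])
  qed
  have "\<exists>N. \<forall>m\<ge>N. \<forall>n\<ge>N. (LINT x|M. (S m x - S n x)\<^sup>2) < \<epsilon>" if "\<epsilon> > 0" for \<epsilon> :: real
  proof -
    have "\<exists>N. \<forall>m\<ge>N. \<forall>n. norm (\<Sum>l\<in>{m..<n}. (b l)\<^sup>2 * h l) < \<epsilon>"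
      using summ that unfolding summable_Cauchy by simp
    then obtain N where N: "\<forall>m\<ge>N. \<forall>n. norm (\<Sum>l\<in>{m..<n}. (b l)\<^sup>2 * h l) < \<epsilon>" ..
    have "(LINT x|M. (S m x - S n x)\<^sup>2) < \<epsilon>" if "m \<ge> N" "n \<ge> N" for m n
    proof (cases "m \<le> n")
      case True
      with N[rule_format, OF \<open>m \<ge> N\<close>, of n] diff[OF True] show ?thesis
        by (simp add: power2_commute[of "S m _"])
    next
      case False
      with N[rule_format, OF \<open>n \<ge> N\<close>, of m] diff[of n m] show ?thesis by simp
    qed
    then show ?thesis by blast
  qed
  from L2_complete[OF M S this] obtain g where g: "g \<in> L2 M"
    "(\<lambda>N. LINT x|M. (S N x - g x)\<^sup>2) \<longlonglongrightarrow> 0" by blast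
  have "(LINT x|M. (g x)\<^sup>2) = (\<Sum>l. (b l)\<^sup>2 * h l)"
  proof (rule LIMSEQ_unique)
    show "(\<lambda>N. LINT x|M. (S N x)\<^sup>2) \<longlonglongrightarrow> (LINT x|M. (g x)\<^sup>2)"
      by (rule tendsto_integral_power2_of_L2[OF S g])
    show "(\<lambda>N. LINT x|M. (S N x)\<^sup>2) \<longlonglongrightarrow> (\<Sum>l. (b l)\<^sup>2 * h l)"
      unfolding S_def using summable_LIMSEQ[OF summ]
      by (simp add: integral_power2_orthogonal_sum[OF e orth norm])
  qed
  moreover have "(LINT x|M. g x * e k x) = b k * h k" for k
  proof (rule LIMSEQ_unique)
    show "(\<lambda>N. LINT x|M. S N x * e k x) \<longlonglongrightarrow> (LINT x|M. g x * e k x)"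
      by (rule tendsto_integral_mult_of_L2[OF S g(1) e g(2)])
    have "(LINT x|M. S N x * e k x) = b k * h k" if "N > k" for N
    proof -
      have "(LINT x|M. S N x * e k x) = (\<Sum>l<N. b l * (LINT x|M. e l x * e k x))"
        unfolding S_def by (simp add: sum_distrib_right mult.assoc L2_mult[OF e e])
      also have "\<dots> = (\<Sum>l<N. if l = k then b k * h k else 0)"
        by (intro sum.cong) (auto simp: orth norm[symmetric] power2_eq_square)
      finally show ?thesis using that by simp
    qed
    then show "(\<lambda>N. LINT x|M. S N x * e k x) \<longlonglongrightarrow> b k * h k"
      by (intro tendsto_eventually) (auto simp: eventually_sequentially intro!: exI[of _ "Suc k"])
  qed
  ultimately show ?thesis
    using g unfolding S_def by (intro bexI[of _ g] conjI allI)
qed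

section \<open>Differential equations for Legendre polynomials\<close>

text \<open>This is \<open>(l + j)! / (l - j)!\<close> for \<open>j \<le> l\<close>; for \<open>l < j\<close> the factor with \<open>i = l\<close> vanishes.\<close>
definition eigenvalue :: "nat \<Rightarrow> nat \<Rightarrow> real" where
  "eigenvalue j l = (\<Prod>i<j. real l * (real l + 1) - real i * (real i + 1))"

lemma eigenvalue_nonneg: "eigenvalue j l \<ge> 0"
proof (cases "l < j")
  case True
  then show ?thesis
    unfolding eigenvalue_def by (subst prod_zero) auto
next
  case False
  have "real i * (real i + 1) \<le> real l * (real l + 1)" if "i < j" for i
    using that False by (intro mult_mono) auto
  then show ?thesis
    unfolding eigenvalue_def by (intro prod_nonneg) auto
qed

text \<open>The function \<open>y = (x\<^sup>2 - 1) ^ l\<close> satisfies \<open>(x\<^sup>2 - 1) y' = 2 l x y\<close>; the claim is the \<open>(i + 1)\<close>-st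
  derivative of this equation.\<close>
lemma rodrigues_recursion:
  fixes l :: nat
  defines "D \<equiv> \<lambda>i. (pderiv ^^ i) ([:-1, 0, 1:] ^ l :: real poly)"
  shows "[:-1, 0, 1:] * D (i + 2) + smult (2 * (real i + 1 - real l)) ([:0, 1:] * D (i + 1))
           + smult ((real i + 1) * (real i - 2 * real l)) (D i) = 0"
proof -
  obtain q X :: "real poly" where qX: "q = [:-1, 0, 1:]" "X = [:0, 1:]" by blast
  have dq: "pderiv q = smult 2 X" and dX: "pderiv X = 1"
    by (simp_all add: qX pderiv_pCons)
  have DS: "pderiv (D i) = D (Suc i)" for i
    by (simp add: D_def)
  have D0: "D 0 = q ^ l"
    by (simp add: D_def qX)
  have D1: "q * D 1 = smult (2 * real l) (X * D 0)"
  proof (cases l)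
    case 0
    then show ?thesis by (simp add: D_def)
  next
    case (Suc m)
    have "D 1 = smult (real l) (q ^ m) * smult 2 X"
      unfolding One_nat_def DS[symmetric] D0 Suc pderiv_power_Suc dq by simp
    then show ?thesis
      by (simp add: D0 Suc mult_ac)
  qed
  have "q * D (i + 2) + smult (2 * (real i + 1 - real l)) (X * D (i + 1))
           + smult ((real i + 1) * (real i - 2 * real l)) (D i) = 0"
  proof (induction i)
    case 0
    have "poly (q * D 2 + smult (2 * (1 - real l)) (X * D 1) + smult (- 2 * real l) (D 0)) x =
        poly (pderiv (q * D 1) - pderiv (smult (2 * real l) (X * D 0))) x" for x
      by (simp add: pderiv_mult pderiv_smult dq dX DS numeral_2_eq_2 algebra_simps)
    also have "\<dots> x = 0" for x
      by (simp only: D1 diff_self poly_0)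
    finally have "poly (q * D 2 + smult (2 * (1 - real l)) (X * D 1) + smult (- 2 * real l) (D 0)) = poly 0"
      by auto
    then show ?case
      unfolding poly_eq_poly_eq_iff by (simp add: numeral_2_eq_2)
  next
    case (Suc i)
    have "poly (q * D (Suc i + 2) + smult (2 * (real (Suc i) + 1 - real l)) (X * D (Suc i + 1))
           + smult ((real (Suc i) + 1) * (real (Suc i) - 2 * real l)) (D (Suc i))) x =
       poly (pderiv (q * D (i + 2) + smult (2 * (real i + 1 - real l)) (X * D (i + 1))
           + smult ((real i + 1) * (real i - 2 * real l)) (D i))) x" for x
      by (simp add: pderiv_mult pderiv_add pderiv_smult dq dX DS algebra_simps)
    then have "poly (q * D (Suc i + 2) + smult (2 * (real (Suc i) + 1 - real l)) (X * D (Suc i + 1))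
           + smult ((real (Suc i) + 1) * (real (Suc i) - 2 * real l)) (D (Suc i))) = poly 0"
      by (auto simp only: Suc.IH pderiv_0)
    then show ?case
      unfolding poly_eq_poly_eq_iff .
  qed
  then show ?thesis
    unfolding qX .
qed

abbreviation (input) weight_poly :: "real poly" where
  "weight_poly \<equiv> [:1, 0, -1:]"

text \<open>By Rodrigues' formula this is the case \<open>i = l + k\<close> of the previous recursion.\<close>
lemma legendre_higher_ode:
  fixes l k :: nat
  defines "P \<equiv> \<lambda>i. (pderiv ^^ i) (legendre_poly l)"
  shows "weight_poly * P (k + 2) - smult (2 * (real k + 1)) ([:0, 1:] * P (k + 1))
           + smult (real l * (real l + 1) - real k * (real k + 1)) (P k) = 0"
proof -
  define D where "D = (\<lambda>i. (pderiv ^^ i) ([:-1, 0, 1:] ^ l :: real poly))"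
  define c :: real where "c = 1 / (2 ^ l * fact l)"
  have P: "P i = smult c (D (l + i))" for i
    unfolding P_def legendre_poly_def D_def c_def
    by (simp add: higher_pderiv_smult funpow_add add.commute)
  have E: "(x\<^sup>2 - 1) * poly (D (l + k + 2)) x + 2 * (real k + 1) * (x * poly (D (l + k + 1)) x)
      + (real l + real k + 1) * (real k - real l) * poly (D (l + k)) x = 0" for x
    using arg_cong[OF rodrigues_recursion[where l = l and i = "l + k"], of "\<lambda>p. poly p x"]
    by (simp add: D_def power2_eq_square algebra_simps)
  have "poly (weight_poly * P (k + 2) - smult (2 * (real k + 1)) ([:0, 1:] * P (k + 1))
           + smult (real l * (real l + 1) - real k * (real k + 1)) (P k)) x =
     - c * ((x\<^sup>2 - 1) * poly (D (l + k + 2)) x + 2 * (real k + 1) * (x * poly (D (l + k + 1)) x)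
      + (real l + real k + 1) * (real k - real l) * poly (D (l + k)) x)" for x
    unfolding P by (simp add: power2_eq_square algebra_simps)
  then have "poly (weight_poly * P (k + 2) - smult (2 * (real k + 1)) ([:0, 1:] * P (k + 1))
           + smult (real l * (real l + 1) - real k * (real k + 1)) (P k)) x = 0" for x
    by (simp only: E mult_zero_right)
  then show ?thesis
    by (intro poly_all_0_iff_0[THEN iffD1] allI)
qed

text \<open>The equation of order \<open>k\<close> in divergence form: the integrating factor is \<open>(1 - x\<^sup>2) ^ k\<close>.\<close>
lemma pderiv_wlegendre:
  "pderiv (weight_poly ^ Suc k * (pderiv ^^ Suc k) (legendre_poly l)) =
     smult (- (real l * (real l + 1) - real k * (real k + 1)))
       (weight_poly ^ k * (pderiv ^^ k) (legendre_poly l))"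
proof -
  define P where "P = (\<lambda>i. (pderiv ^^ i) (legendre_poly l))"
  have w: "pderiv weight_poly = [:0, -2:]" by (simp add: pderiv_pCons)
  have E: "poly (weight_poly * P (k + 2) - smult (2 * (real k + 1)) ([:0, 1:] * P (k + 1))
           + smult (real l * (real l + 1) - real k * (real k + 1)) (P k)) x = 0" for x
    unfolding P_def legendre_higher_ode by (rule poly_0)
  have "poly (pderiv (weight_poly ^ Suc k * P (Suc k))) x =
     poly (smult (- (real l * (real l + 1) - real k * (real k + 1))) (weight_poly ^ k * P k)) x" for x
  proof -
    define W where "W = 1 - x * x"
    have "poly (pderiv (weight_poly ^ Suc k * P (Suc k))) x =
        W ^ Suc k * poly (P (k + 2)) x + poly (P (Suc k)) x * ((1 + real k) * W ^ k * (- 2 * x))"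
      by (simp only: pderiv_mult pderiv_power_Suc w) (simp add: P_def W_def algebra_simps)
    also have "\<dots> = W ^ k * (W * poly (P (k + 2)) x - 2 * (real k + 1) * (x * poly (P (k + 1)) x))"
      by (simp add: algebra_simps)
    also have "W * poly (P (k + 2)) x - 2 * (real k + 1) * (x * poly (P (k + 1)) x) =
        - (real l * (real l + 1) - real k * (real k + 1)) * poly (P k) x"
      using E[of x] by (simp add: W_def algebra_simps)
    finally show ?thesis
      by (simp add: W_def algebra_simps)
  qed
  then have "pderiv (weight_poly ^ Suc k * P (Suc k)) =
     smult (- (real l * (real l + 1) - real k * (real k + 1))) (weight_poly ^ k * P k)"
    by (intro poly_eq_poly_eq_iff[THEN iffD1] ext)
  then show ?thesis
    unfolding P_def .
qed

text \<open>Each step trades one outer derivative for one factor of the eigenvalue product.\<close>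
lemma higher_pderiv_wlegendre:
  "(pderiv ^^ j) (weight_poly ^ j * (pderiv ^^ j) (legendre_poly l)) =
     smult ((-1) ^ j * eigenvalue j l) (legendre_poly l)"
proof (induction j)
  case 0
  then show ?case by (simp add: eigenvalue_def)
next
  case (Suc j)
  have "(pderiv ^^ Suc j) (weight_poly ^ Suc j * (pderiv ^^ Suc j) (legendre_poly l)) =
    (pderiv ^^ j) (pderiv (weight_poly ^ Suc j * (pderiv ^^ Suc j) (legendre_poly l)))"
    by (simp only: funpow_Suc_right o_def)
  then show ?case
    unfolding pderiv_wlegendre higher_pderiv_smult Suc.IH
    by (simp add: eigenvalue_def algebra_simps flip: smult_minus_left)
qed

text \<open>Only the term in which all derivatives fall on the vanishing factor survives.\<close>
lemma higher_pderiv_at_multiple_root: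
  "poly ((pderiv ^^ l) ([:- a, 1:] ^ l * q)) a = fact l * poly q (a :: real)"
proof (induction l arbitrary: q)
  case (Suc l)
  have "pderiv ([:- a, 1:] ^ Suc l * q) = [:- a, 1:] ^ l * (smult (real (Suc l)) q + [:- a, 1:] * pderiv q)"
    by (simp add: pderiv_mult pderiv_power_Suc pderiv_pCons algebra_simps del: power_Suc)
       (simp add: algebra_simps)
  then show ?case
    by (simp only: funpow_Suc_right o_def Suc.IH) simp
qed simp

lemma legendre_poly_1: "poly (legendre_poly l) 1 = 1"
proof -
  have "[:-1, 0, 1 :: real:] = [:-1, 1:] * [:1, 1:]" by simp
  then have "[:-1, 0, 1 :: real:] ^ l = [:-1, 1:] ^ l * [:1, 1:] ^ l"
    by (simp only: power_mult_distrib)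
  then have "poly ((pderiv ^^ l) ([:-1, 0, 1:] ^ l)) (1 :: real) = fact l * 2 ^ l"
    using higher_pderiv_at_multiple_root[of l 1 "[:1, 1:] ^ l"] by simp
  then show ?thesis
    by (simp add: legendre_poly_def)
qed

lemma legendre_poly_minus_1: "poly (legendre_poly l) (- 1) = (- 1) ^ l"
proof -
  have "[:-1, 0, 1 :: real:] = [:1, 1:] * [:-1, 1:]" by simp
  then have "[:-1, 0, 1 :: real:] ^ l = [:1, 1:] ^ l * [:-1, 1:] ^ l"
    by (simp only: power_mult_distrib)
  then have "poly ((pderiv ^^ l) ([:-1, 0, 1:] ^ l)) (- 1 :: real) = fact l * (- 2) ^ l"
    using higher_pderiv_at_multiple_root[of l "-1" "[:-1, 1:] ^ l"] by simp
  moreover have "(- 2 :: real) ^ l = (- 1) ^ l * 2 ^ l"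
    by (simp flip: power_mult_distrib)
  ultimately show ?thesis
    by (simp add: legendre_poly_def)
qed

lemma degree_legendre_poly: "degree (legendre_poly l) = l"
proof -
  have "degree ([:-1, 0, 1 :: real:] ^ l) = 2 * l"
    by (subst degree_power_eq) auto
  then have "degree ((pderiv ^^ l) ([:-1, 0, 1 :: real:] ^ l)) = l"
    by (simp add: degree_higher_pderiv)
  then show ?thesis by (simp add: legendre_poly_def)
qed

section \<open>Smooth cutoff functions\<close>

text \<open>Each monomial is dominated by the exponential series. The induction over the coefficients needs
  an additional factor \<open>z ^ k\<close>.\<close>
lemma poly_times_exp_bounded:
  fixes p :: "real poly"
  shows "\<exists>B. \<forall>z\<ge>0. \<bar>poly p z\<bar> * exp (- z) \<le> B"
proof -
  have "\<exists>B. \<forall>z\<ge>0. z ^ k * \<bar>poly p z\<bar> * exp (- z) \<le> B" for k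
  proof (induction p arbitrary: k)
    case 0
    show ?case by (intro exI[of _ 0]) simp
  next
    case (pCons a p)
    obtain B where B: "\<And>z. z \<ge> 0 \<Longrightarrow> z ^ Suc k * \<bar>poly p z\<bar> * exp (- z) \<le> B"
      using pCons.IH by blast
    have "z ^ k * \<bar>poly (pCons a p) z\<bar> * exp (- z) \<le> \<bar>a\<bar> * fact k + B" if "z \<ge> 0" for z
    proof -
      have "z ^ k / fact k \<le> exp z"
        using that sum_le_suminf[OF summable_exp_generic[of z], of "{k}"]
        by (simp add: exp_def divide_inverse mult.commute scaleR_conv_of_real)
      then have *: "z ^ k * exp (- z) \<le> fact k"
        by (simp add: exp_minus field_simps)
      have "z ^ k * \<bar>poly (pCons a p) z\<bar> * exp (- z) \<le> z ^ k * (\<bar>a\<bar> + z * \<bar>poly p z\<bar>) * exp (- z)"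
        using that abs_triangle_ineq[of a "z * poly p z"]
        by (intro mult_right_mono mult_left_mono) (auto simp: abs_mult)
      also have "\<dots> = \<bar>a\<bar> * (z ^ k * exp (- z)) + z ^ Suc k * \<bar>poly p z\<bar> * exp (- z)"
        by (simp add: algebra_simps)
      also have "\<dots> \<le> \<bar>a\<bar> * fact k + B"
        by (intro add_mono mult_left_mono * B that) auto
      finally show ?thesis .
    qed
    then show ?case by blast
  qed
  from this[of 0] show ?thesis by simp
qed

text \<open>With \<open>z = 1 / y\<close>, the derivative of \<open>p z * exp (- z)\<close> with respect to \<open>y\<close> is
  \<open>z\<^sup>2 (p z - p' z) * exp (- z)\<close>. So these are the polynomial factors in the derivatives of
  \<open>exp (- 1 / y)\<close>.\<close>
primrec smooth_step_poly :: "nat \<Rightarrow> real poly" where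
  "smooth_step_poly 0 = 1"
| "smooth_step_poly (Suc m) = [:0, 0, 1:] * (smooth_step_poly m - pderiv (smooth_step_poly m))"

text \<open>The \<open>m\<close>-th derivative of the smooth function that is \<open>exp (- 1 / y)\<close> for positive \<open>y\<close> and zero
  otherwise. It tends to one at infinity without reaching it, which suffices because the cutoffs
  below let the argument tend to infinity.\<close>
definition smooth_step :: "nat \<Rightarrow> real \<Rightarrow> real" where
  "smooth_step m y = (if y > 0 then poly (smooth_step_poly m) (1 / y) * exp (- (1 / y)) else 0)"

lemma smooth_step_has_derivative:
  "(smooth_step m has_real_derivative smooth_step (Suc m) y) (at y)"
proof -
  consider "y > 0" | "y < 0" | "y = 0" by linarith
  then show ?thesis
  proof cases
    case 1
    have "((\<lambda>y. poly (smooth_step_poly m) (1 / y) * exp (- (1 / y))) has_real_derivative smooth_step (Suc m) y) (at y)"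
      using 1 by (auto intro!: derivative_eq_intros DERIV_chain'[OF _ poly_DERIV] simp: smooth_step_def power2_eq_square field_simps)
    then show ?thesis
      by (rule has_field_derivative_transform_within_open[of _ _ _ "{0<..}"])
         (use 1 in \<open>auto simp: smooth_step_def\<close>)
  next
    case 2
    have "((\<lambda>y. 0) has_real_derivative smooth_step (Suc m) y) (at y)"
      using 2 by (simp add: smooth_step_def)
    then show ?thesis
      by (rule has_field_derivative_transform_within_open[of _ _ _ "{..<0}"])
         (use 2 in \<open>auto simp: smooth_step_def\<close>)
  next
    case 3
    obtain B where B: "\<And>z. z \<ge> 0 \<Longrightarrow> \<bar>poly ([:0, 0, 1:] * smooth_step_poly m) z\<bar> * exp (- z) \<le> B"
      using poly_times_exp_bounded by blast
    have "B \<ge> 0"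
      using B[of 0] by simp
    \<comment> \<open>The factor \<open>z\<^sup>2\<close> in the choice of \<open>B\<close> pays for the difference quotient and for one further power of \<open>h\<close>.\<close>
    have bound: "norm (smooth_step m h / h) \<le> B * \<bar>h\<bar>" for h :: real
    proof (cases "h > 0")
      case True
      have "norm (smooth_step m h / h) = (\<bar>poly ([:0, 0, 1:] * smooth_step_poly m) (1 / h)\<bar> * exp (- (1 / h))) * h"
        using True by (simp add: smooth_step_def abs_mult power2_eq_square field_simps)
      also have "\<dots> \<le> B * h"
        using True by (intro mult_right_mono B) auto
      finally show ?thesis using True by simp
    next
      case False
      have "0 \<le> B * \<bar>h\<bar>" using \<open>B \<ge> 0\<close> by simp
      with False show ?thesis by (simp add: smooth_step_def)
    qed
    have lim: "((\<lambda>h. B * \<bar>h\<bar>) \<longlongrightarrow> 0) (at 0)"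
      by (auto intro!: tendsto_eq_intros)
    have "((\<lambda>h. smooth_step m h / h) \<longlongrightarrow> 0) (at 0)"
      by (rule Lim_null_comparison[OF _ lim]) (intro always_eventually allI bound)
    then show ?thesis
      using 3 by (simp add: DERIV_def smooth_step_def)
  qed
qed

lemma smooth_step_0_bounds: "0 \<le> smooth_step 0 y" "smooth_step 0 y \<le> 1"
  by (auto simp: smooth_step_def)

text \<open>The \<open>m\<close>-th derivative decays like \<open>y ^ (- m - 1)\<close> at infinity, one power faster than needed for
  the scaled functions of the next lemma to be bounded.\<close>
lemma power_dvd_smooth_step_poly: "m > 0 \<Longrightarrow> [:0, 1:] ^ Suc m dvd smooth_step_poly m"
proof (induction m)
  case (Suc m)
  show ?case
  proof (cases "m = 0")
    case True
    then show ?thesis by (simp add: power2_eq_square)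
  next
    case False
    then obtain g where g: "smooth_step_poly m = [:0, 1:] ^ Suc m * g"
      using Suc.IH by (auto elim: dvdE)
    have "smooth_step_poly (Suc m) = [:0, 1:] ^ 2 * (smooth_step_poly m - pderiv (smooth_step_poly m))"
      by (simp add: power2_eq_square)
    also have "pderiv (smooth_step_poly m) = [:0, 1:] ^ m * (smult (real (Suc m)) g + [:0, 1:] * pderiv g)"
      unfolding g pderiv_mult pderiv_power_Suc by (simp add: pderiv_pCons algebra_simps)
    also have "[:0, 1:] ^ 2 * (smooth_step_poly m - \<dots>) = [:0, 1:] ^ Suc (Suc m) *
        ([:0, 1:] * g - (smult (real (Suc m)) g + [:0, 1:] * pderiv g))"
      unfolding g by (simp only: power_Suc power2_eq_square right_diff_distrib mult_ac)
    finally show ?thesis by (metis dvd_triv_left)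
  qed
qed simp

text \<open>When \<open>smooth_step 0 (c * q x - 1)\<close> is differentiated \<open>m\<close> times, the factor \<open>c ^ m\<close> comes out. If
  \<open>q x ^ m\<close> is also present, then with \<open>y = c * q x - 1\<close> the product of the two is \<open>(y + 1) ^ m\<close>.\<close>
lemma scaled_smooth_step_limit:
  shows "\<exists>B. \<forall>y. \<bar>(y + 1) ^ m * smooth_step m y\<bar> \<le> B"
    and "((\<lambda>y. (y + 1) ^ m * smooth_step m y) \<longlongrightarrow> (if m = 0 then 1 else 0)) at_top"
proof -
  obtain g where g: "smooth_step_poly m = [:0, 1:] ^ m * g" "poly g 0 = (if m = 0 then 1 else 0)"
  proof (cases "m = 0")
    case True
    then show ?thesis by (intro that[of 1]) auto
  next
    case False
    then obtain f where "smooth_step_poly m = [:0, 1:] ^ Suc m * f"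
      using power_dvd_smooth_step_poly[of m] by (auto elim: dvdE)
    with False show ?thesis by (intro that[of "[:0, 1:] * f"]) (simp_all add: mult_ac)
  qed
  define r where "r = [:1, 1:] ^ m * g"
  have eq: "(y + 1) ^ m * smooth_step m y = poly r (1 / y) * exp (- (1 / y))" if "y > 0" for y
  proof -
    have "(y + 1) ^ m * (1 / y) ^ m = (1 + 1 / y) ^ m"
      using that by (simp add: power_mult_distrib[symmetric] field_simps)
    then show ?thesis
      using that by (simp add: smooth_step_def r_def g)
  qed
  obtain B where B: "\<And>z. z \<ge> 0 \<Longrightarrow> \<bar>poly r z\<bar> * exp (- z) \<le> B"
    using poly_times_exp_bounded by blast
  have "\<bar>(y + 1) ^ m * smooth_step m y\<bar> \<le> B" for y
  proof (cases "y > 0")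
    case True
    then show ?thesis using B[of "1 / y"] by (simp add: eq abs_mult)
  next
    case False
    have "0 \<le> \<bar>poly r 0\<bar> * exp (- 0)" by simp
    also have "\<dots> \<le> B" by (rule B) simp
    finally show ?thesis using False by (simp add: smooth_step_def)
  qed
  then show "\<exists>B. \<forall>y. \<bar>(y + 1) ^ m * smooth_step m y\<bar> \<le> B" by blast
  have inv: "((\<lambda>y::real. 1 / y) \<longlongrightarrow> 0) at_top"
    by (simp add: tendsto_inverse_0_at_top filterlim_ident divide_inverse)
  have "((\<lambda>y. poly r (1 / y) * exp (- (1 / y))) \<longlongrightarrow> poly r 0 * exp (- 0)) at_top"
    by (intro tendsto_intros inv)
  then have lim: "((\<lambda>y. poly r (1 / y) * exp (- (1 / y))) \<longlongrightarrow> (if m = 0 then 1 else 0)) at_top"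
    by (simp add: r_def g)
  have "\<forall>\<^sub>F y in at_top. poly r (1 / y) * exp (- (1 / y)) = (y + 1) ^ m * smooth_step m y"
    using eventually_gt_at_top[of 0] by eventually_elim (simp add: eq)
  from Lim_transform_eventually[OF lim this]
  show "((\<lambda>y. (y + 1) ^ m * smooth_step m y) \<longlongrightarrow> (if m = 0 then 1 else 0)) at_top" .
qed

text \<open>For large \<open>c\<close> this approximates \<open>p\<close> where \<open>q\<close> is positive, and it vanishes where \<open>c * q \<le> 1\<close>.\<close>
definition cutoff :: "real poly \<Rightarrow> real poly \<Rightarrow> real \<Rightarrow> real \<Rightarrow> real" where
  "cutoff q p c x = smooth_step 0 (c * poly q x - 1) * poly p x"

text \<open>In the \<open>k\<close>-th derivative of the cutoff, the coefficient of \<open>c ^ m * smooth_step m (c * q x - 1)\<close>.\<close>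
primrec cutoff_coeff :: "real poly \<Rightarrow> real poly \<Rightarrow> nat \<Rightarrow> nat \<Rightarrow> real poly" where
  "cutoff_coeff q p 0 m = (if m = 0 then p else 0)"
| "cutoff_coeff q p (Suc k) m =
     pderiv (cutoff_coeff q p k m) + (if m = 0 then 0 else pderiv q * cutoff_coeff q p k (m - 1))"

lemma cutoff_coeff_0: "cutoff_coeff q p k 0 = (pderiv ^^ k) p"
  by (induction k) auto

lemma cutoff_coeff_eq_0: "m > k \<Longrightarrow> cutoff_coeff q p k m = 0"
  by (induction k arbitrary: m) auto

lemma cutoff_deriv_sum_has_derivative:
  "((\<lambda>x. \<Sum>m\<le>k. c ^ m * smooth_step m (c * poly q x - 1) * poly (cutoff_coeff q p k m) x) has_real_derivative
     (\<Sum>m\<le>Suc k. c ^ m * smooth_step m (c * poly q x - 1) * poly (cutoff_coeff q p (Suc k) m) x)) (at x)"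
proof -
  define S where "S m = smooth_step m (c * poly q x - 1)" for m
  define C where "C m = poly (cutoff_coeff q p k m) x" for m
  define C' where "C' m = poly (pderiv (cutoff_coeff q p k m)) x" for m
  define q' where "q' = poly (pderiv q) x"
  have step: "((\<lambda>x. smooth_step m (c * poly q x - 1)) has_real_derivative S (Suc m) * (c * q')) (at x)" for m
    unfolding S_def q'_def
    by (rule DERIV_chain'[OF _ smooth_step_has_derivative]) (auto intro!: derivative_eq_intros poly_DERIV)
  have "((\<lambda>x. \<Sum>m\<le>k. c ^ m * smooth_step m (c * poly q x - 1) * poly (cutoff_coeff q p k m) x) has_real_derivative
      (\<Sum>m\<le>k. c ^ m * (S (Suc m) * (c * q')) * C m + c ^ m * S m * C' m)) (at x)"
    unfolding C_def C'_def
    by (auto intro!: derivative_eq_intros step poly_DERIV sum.cong simp: S_def algebra_simps)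
  moreover have "(\<Sum>m\<le>Suc k. c ^ m * S m * poly (cutoff_coeff q p (Suc k) m) x) =
      (\<Sum>m\<le>Suc k. c ^ m * S m * C' m) + (\<Sum>m\<le>Suc k. if m = 0 then 0 else c ^ m * S m * (q' * C (m - 1)))"
    unfolding sum.distrib[symmetric] by (intro sum.cong) (auto simp: C'_def C_def q'_def algebra_simps)
  moreover have "(\<Sum>m\<le>Suc k. c ^ m * S m * C' m) = (\<Sum>m\<le>k. c ^ m * S m * C' m)"
    by (simp add: C'_def cutoff_coeff_eq_0)
  moreover have "(\<Sum>m\<le>Suc k. if m = 0 then 0 else c ^ m * S m * (q' * C (m - 1))) =
      (\<Sum>m\<le>k. c ^ m * (S (Suc m) * (c * q')) * C m)"
    by (subst sum.atMost_Suc_shift) (auto intro!: sum.cong)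
  ultimately show ?thesis
    by (simp only: S_def[symmetric] sum.distrib add.commute)
qed

lemma higher_deriv_cutoff:
  "(deriv ^^ k) (cutoff q p c) =
     (\<lambda>x. \<Sum>m\<le>k. c ^ m * smooth_step m (c * poly q x - 1) * poly (cutoff_coeff q p k m) x)"
proof (induction k)
  case (Suc k)
  show ?case
    by (simp only: funpow.simps o_def Suc.IH) (intro ext DERIV_imp_deriv cutoff_deriv_sum_has_derivative)
qed (simp add: cutoff_def fun_eq_iff)

lemma test_function_cutoff:
  assumes "-1 < a" "b < 1" "\<And>x. x \<notin> {a..b} \<Longrightarrow> c * poly q x \<le> 1"
  shows "test_function_I (cutoff q p c)"
  unfolding test_function_I_def
proof (intro conjI allI exI)
  show "(deriv ^^ k) (cutoff q p c) differentiable (at x)" for k x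
    unfolding higher_deriv_cutoff
    using cutoff_deriv_sum_has_derivative real_differentiable_def by blast
  show "-1 < a" "b < 1" by fact+
  show "x \<notin> {a..b} \<longrightarrow> cutoff q p c x = 0" for x
    using assms(3)[of x] by (auto simp: cutoff_def smooth_step_def)
qed

lemma power_dvd_pderiv:
  assumes "w ^ Suc a dvd (f :: real poly)" shows "w ^ a dvd pderiv f"
proof -
  obtain g where "f = w ^ Suc a * g" using assms by (auto elim: dvdE)
  note f = this
  have "pderiv f = w ^ a * (w * pderiv g + smult (real (Suc a)) (g * pderiv w))"
    unfolding f pderiv_mult pderiv_power_Suc by (simp add: algebra_simps)
  then show ?thesis by simp
qed

text \<open>A derivative falling on the coefficient lowers the power of \<open>w\<close> by one, a derivative falling on
  the step costs one factor \<open>c\<close> instead.\<close>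
lemma power_dvd_cutoff_coeff:
  "k \<le> j \<Longrightarrow> w ^ (j - k + m) dvd cutoff_coeff w (w ^ j * p) k m"
proof (induction k arbitrary: m)
  case (Suc k)
  have "w ^ Suc (j - Suc k + m) dvd cutoff_coeff w (w ^ j * p) k m"
    using Suc by (metis Suc_diff_le Suc_leD add_Suc diff_Suc_Suc)
  then have 1: "w ^ (j - Suc k + m) dvd pderiv (cutoff_coeff w (w ^ j * p) k m)"
    by (rule power_dvd_pderiv)
  have 2: "w ^ (j - Suc k + m) dvd pderiv w * cutoff_coeff w (w ^ j * p) k (m - 1)" if "m \<noteq> 0"
  proof -
    have "j - Suc k + m = j - k + (m - 1)" using Suc.prems that by simp
    then show ?thesis using Suc by (metis Suc_leD dvd_mult)
  qed
  from 1 2 show ?case by (auto intro: dvd_add)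
qed auto

text \<open>After \<open>j\<close> derivatives of the cutoff of \<open>w ^ j * p\<close> each factor \<open>c ^ m\<close> is compensated by a factor
  \<open>w ^ m\<close>; in the limit only the term with \<open>m = 0\<close>, in which the step is not differentiated, remains.\<close>
lemma higher_deriv_cutoff_bounded_and_limit:
  assumes pos: "\<And>x. x \<in> {-1<..<1} \<Longrightarrow> poly w x > 0"
  shows "\<exists>B. \<forall>n. \<forall>x\<in>{-1<..<1}. \<bar>(deriv ^^ j) (cutoff w (w ^ j * p) (real n)) x\<bar> \<le> B"
    and "x \<in> {-1<..<1} \<Longrightarrow> (\<lambda>n. (deriv ^^ j) (cutoff w (w ^ j * p) (real n)) x)
            \<longlonglongrightarrow> poly ((pderiv ^^ j) (w ^ j * p)) x"
proof -
  have "\<exists>r. cutoff_coeff w (w ^ j * p) j m = w ^ m * r" for m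
    using power_dvd_cutoff_coeff[of j j w m p] by (auto elim: dvdE)
  then obtain r where r: "\<And>m. cutoff_coeff w (w ^ j * p) j m = w ^ m * r m" by metis
  have eq: "(deriv ^^ j) (cutoff w (w ^ j * p) c) x =
      (\<Sum>m\<le>j. ((c * poly w x - 1 + 1) ^ m * smooth_step m (c * poly w x - 1)) * poly (r m) x)" for c x
    unfolding higher_deriv_cutoff r by (intro sum.cong) (auto simp: power_mult_distrib)
  obtain B where B: "\<And>m y. \<bar>(y + 1) ^ m * smooth_step m y\<bar> \<le> B m"
    using scaled_smooth_step_limit(1) by metis
  have "\<exists>K. \<forall>x\<in>{-1..1}. \<bar>poly (r m) x\<bar> \<le> K" for m
  proof -
    have "bounded (poly (r m) ` {-1..1})"
      by (intro compact_imp_bounded compact_continuous_image) (auto intro: continuous_intros)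
    then show ?thesis by (auto simp: bounded_iff)
  qed
  then obtain K where K: "\<And>m x. x \<in> {-1..1} \<Longrightarrow> \<bar>poly (r m) x\<bar> \<le> K m" by metis
  have "\<bar>(deriv ^^ j) (cutoff w (w ^ j * p) (real n)) x\<bar> \<le> (\<Sum>m\<le>j. B m * K m)" if "x \<in> {-1<..<1}" for n x
    unfolding eq using that
    by (intro order_trans[OF sum_abs] sum_mono)
       (auto simp only: abs_mult[of _ "poly _ _"] intro!: mult_mono B K order_trans[OF abs_ge_zero B] abs_ge_zero, auto)
  then show "\<exists>B. \<forall>n. \<forall>x\<in>{-1<..<1}. \<bar>(deriv ^^ j) (cutoff w (w ^ j * p) (real n)) x\<bar> \<le> B"
    by blast
  assume x: "x \<in> {-1<..<1}"
  have "filterlim (\<lambda>n. real n * poly w x - 1) at_top sequentially"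
    using pos[OF x] by real_asymp
  then have lim: "(\<lambda>n. (real n * poly w x - 1 + 1) ^ m * smooth_step m (real n * poly w x - 1))
      \<longlonglongrightarrow> (if m = 0 then 1 else 0)" for m
    by (rule filterlim_compose[OF scaled_smooth_step_limit(2)])
  have "(\<lambda>n. (deriv ^^ j) (cutoff w (w ^ j * p) (real n)) x) \<longlonglongrightarrow> (\<Sum>m\<le>j. (if m = 0 then 1 else 0) * poly (r m) x)"
    unfolding eq by (intro tendsto_intros lim)
  moreover have "(\<Sum>m\<le>j. (if m = 0 then 1 else 0) * poly (r m) x) = poly (r 0) x"
    by (subst sum.remove[of _ 0]) auto
  moreover have "r 0 = (pderiv ^^ j) (w ^ j * p)"
    using r[of 0] by (simp add: cutoff_coeff_0)
  ultimately show "(\<lambda>n. (deriv ^^ j) (cutoff w (w ^ j * p) (real n)) x) \<longlonglongrightarrow> poly ((pderiv ^^ j) (w ^ j * p)) x"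
    by simp
qed

section \<open>Weak derivatives on the interval\<close>

lemma finite_measure_lebesgue_I: "finite_measure lebesgue_I"
  by (rule finite_measure_lebesgue_on) simp

lemma borel_measurable_lebesgue_I: "f \<in> borel_measurable borel \<Longrightarrow> f \<in> borel_measurable lebesgue_I"
  by (intro measurable_restrict_space1 measurable_completion) simp

lemma continuous_imp_borel_measurable_lebesgue_I:
  "continuous_on UNIV f \<Longrightarrow> (f :: real \<Rightarrow> real) \<in> borel_measurable lebesgue_I"
  by (intro borel_measurable_lebesgue_I borel_measurable_continuous_onI)

lemma poly_L2: "poly p \<in> L2 lebesgue_I"
proof -
  have "bounded (poly p ` {-1..1})"
    by (intro compact_imp_bounded compact_continuous_image) (auto intro: continuous_intros)
  then obtain B where "\<forall>x\<in>{-1..1}. \<bar>poly p x\<bar> \<le> B"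
    by (auto simp: bounded_iff)
  then show ?thesis
    by (intro L2_bounded[of _ _ B] finite_measure_lebesgue_I
        continuous_imp_borel_measurable_lebesgue_I) (auto intro: continuous_intros)
qed

lemma integrable_lebesgue_I_iff:
  "integrable lebesgue_I f \<longleftrightarrow> integrable lebesgue (\<lambda>x. indicator {-1<..<1} x * f x)" for f :: "real \<Rightarrow> real"
  by (simp add: integrable_restrict_space)

lemma locally_integrable_I_iff:
  "locally_integrable_I v \<longleftrightarrow> (\<forall>a b. -1 < a \<longrightarrow> b < 1 \<longrightarrow> integrable lebesgue_I (\<lambda>x. indicator {a..b} x * v x))"
proof -
  have "v absolutely_integrable_on {a..b} \<longleftrightarrow> integrable lebesgue_I (\<lambda>x. indicator {a..b} x * v x)"
    if "-1 < a" "b < 1" for a b :: real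
  proof -
    have "indicator {-1<..<1} x * (indicator {a..b} x * v x) = indicator {a..b} x *\<^sub>R v x" for x
      using that by (auto simp: indicator_def)
    then show ?thesis
      unfolding integrable_lebesgue_I_iff set_integrable_def by presburger
  qed
  then show ?thesis unfolding locally_integrable_I_def by blast
qed

lemma integrable_imp_locally_integrable_I:
  "integrable lebesgue_I v \<Longrightarrow> locally_integrable_I v"
  unfolding locally_integrable_I_iff
  by (auto intro!: integrable_real_mult_indicator simp: mult.commute[of "indicator _ _"] sets_restrict_space_iff)

lemma locally_integrable_I_mult:
  assumes v: "locally_integrable_I v" and h: "h \<in> borel_measurable lebesgue_I"
    and ab: "-1 < a" "b < 1" and B: "\<And>x. \<bar>h x\<bar> \<le> B" and supp: "\<And>x. x \<notin> {a..b} \<Longrightarrow> h x = 0"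
  shows "integrable lebesgue_I (\<lambda>x. v x * h x)"
proof -
  have int: "integrable lebesgue_I (\<lambda>x. indicator {a..b} x * v x)"
    using v ab unfolding locally_integrable_I_iff by blast
  have eq: "v x * h x = (indicator {a..b} x * v x) * h x" for x
    using supp[of x] by (auto simp: indicator_def)
  show ?thesis
  proof (rule Bochner_Integration.integrable_bound)
    show "integrable lebesgue_I (\<lambda>x. B * (indicator {a..b} x * v x))"
      using int by simp
    show "(\<lambda>x. v x * h x) \<in> borel_measurable lebesgue_I"
      unfolding eq by (intro borel_measurable_times[OF borel_measurable_integrable[OF int] h])
    have "\<bar>v x * h x\<bar> \<le> \<bar>B * (indicator {a..b} x * v x)\<bar>" for x
    proof -
      have "\<bar>v x * h x\<bar> = \<bar>indicator {a..b} x * v x\<bar> * \<bar>h x\<bar>"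
        unfolding eq by (simp only: abs_mult)
      also have "\<dots> \<le> \<bar>indicator {a..b} x * v x\<bar> * \<bar>B\<bar>"
        using B[of x] by (intro mult_left_mono) auto
      finally show ?thesis by (simp add: abs_mult mult_ac)
    qed
    then show "AE x in lebesgue_I. norm (v x * h x) \<le> norm (B * (indicator {a..b} x * v x))"
      by simp
  qed
qed

text \<open>The offset makes the intervals compactly contained in \<open>(-1, 1)\<close> for every \<open>n\<close>.\<close>
lemma interval_exhaustion_I:
  assumes "x \<in> {-1<..<1::real}"
  shows "\<forall>\<^sub>F n in sequentially. x \<in> {-1 + 1 / real (n + 2) <..< 1 - 1 / real (n + 2)}"
proof -
  have "(\<lambda>n. -1 + 1 / real (n + 2)) \<longlonglongrightarrow> -1" "(\<lambda>n. 1 - 1 / real (n + 2)) \<longlonglongrightarrow> 1"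
    by real_asymp+
  then have "\<forall>\<^sub>F n in sequentially. -1 + 1 / real (n + 2) < x" "\<forall>\<^sub>F n in sequentially. x < 1 - 1 / real (n + 2)"
    using assms by (auto intro: order_tendstoD)
  then show ?thesis by eventually_elim auto
qed

lemma locally_integrable_I_measurable:
  assumes "locally_integrable_I v" shows "v \<in> borel_measurable lebesgue_I"
proof (rule borel_measurable_LIMSEQ_real)
  let ?J = "\<lambda>n. {-1 + 1 / real (n + 2) .. 1 - 1 / real (n + 2)}"
  show "(\<lambda>x. indicator (?J n) x * v x) \<in> borel_measurable lebesgue_I" for n
    using assms unfolding locally_integrable_I_iff by (intro borel_measurable_integrable) simp
  fix x assume "x \<in> space lebesgue_I"
  then have "\<forall>\<^sub>F n in sequentially. indicator (?J n) x * v x = v x"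
    by (intro eventually_mono[OF interval_exhaustion_I[of x]]) (auto simp: indicator_def)
  then show "(\<lambda>n. indicator (?J n) x * v x) \<longlonglongrightarrow> v x"
    by (rule tendsto_eventually)
qed

lemma test_function_deriv:
  assumes "test_function_I \<phi>"
  shows "((deriv ^^ k) \<phi> has_real_derivative (deriv ^^ Suc k) \<phi> x) (at x)"
    and "continuous_on S ((deriv ^^ k) \<phi>)"
proof -
  have d: "(deriv ^^ k) \<phi> differentiable (at x)" for x
    using assms unfolding test_function_I_def by blast
  show "((deriv ^^ k) \<phi> has_real_derivative (deriv ^^ Suc k) \<phi> x) (at x)"
    using d[of x] DERIV_deriv_iff_real_differentiable by simp
  show "continuous_on S ((deriv ^^ k) \<phi>)"
    by (intro differentiable_imp_continuous_on differentiable_at_imp_differentiable_on d)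
qed

lemma test_function_support:
  assumes "test_function_I \<phi>"
  obtains a b where "-1 < a" "b < 1" "\<And>k x. x \<notin> {a..b} \<Longrightarrow> (deriv ^^ k) \<phi> x = 0"
proof -
  obtain a b where ab: "-1 < a" "b < 1" "\<And>x. x \<notin> {a..b} \<Longrightarrow> \<phi> x = 0"
    using assms unfolding test_function_I_def by blast
  have "(deriv ^^ k) \<phi> x = 0" if "x \<notin> {a..b}" for k x
    using that
  proof (induction k arbitrary: x)
    case (Suc k)
    have "((deriv ^^ k) \<phi> has_real_derivative 0) (at x)"
      by (rule has_field_derivative_transform_within_open[of "\<lambda>_. 0" _ _ "- {a..b}"])
         (use Suc in \<open>auto intro: open_Compl\<close>)
    then show ?case by (simp add: DERIV_imp_deriv)
  qed (simp add: ab)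
  with ab(1,2) show ?thesis using that by blast
qed

lemma test_function_bounded:
  assumes "test_function_I \<phi>"
  obtains B where "\<And>x. \<bar>(deriv ^^ k) \<phi> x\<bar> \<le> B"
proof -
  obtain a b where ab: "-1 < a" "b < 1" "\<And>k x. x \<notin> {a..b} \<Longrightarrow> (deriv ^^ k) \<phi> x = 0"
    using test_function_support[OF assms] by blast
  have "bounded ((deriv ^^ k) \<phi> ` {a..b})"
    by (intro compact_imp_bounded compact_continuous_image test_function_deriv(2) assms) simp
  then obtain B where "\<forall>x\<in>{a..b}. \<bar>(deriv ^^ k) \<phi> x\<bar> \<le> B"
    by (auto simp: bounded_iff)
  then have "\<bar>(deriv ^^ k) \<phi> x\<bar> \<le> max B 0" for x
    using ab(3)[of x k] by (cases "x \<in> {a..b}") (auto simp: le_max_iff_disj)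
  then show ?thesis by (rule that)
qed

lemma test_function_measurable:
  assumes "test_function_I \<phi>" shows "(deriv ^^ k) \<phi> \<in> borel_measurable lebesgue_I"
  by (intro continuous_imp_borel_measurable_lebesgue_I test_function_deriv assms)

lemma integrable_test_function_mult:
  assumes "locally_integrable_I v" "test_function_I \<phi>"
  shows "integrable lebesgue_I (\<lambda>x. v x * (deriv ^^ k) \<phi> x)"
proof -
  obtain a b where ab: "-1 < a" "b < 1" "\<And>k x. x \<notin> {a..b} \<Longrightarrow> (deriv ^^ k) \<phi> x = 0"
    using test_function_support[OF assms(2)] by blast
  obtain B where B: "\<And>x. \<bar>(deriv ^^ k) \<phi> x\<bar> \<le> B"
    using test_function_bounded[OF assms(2), of k] by blast
  show ?thesis
    by (rule locally_integrable_I_mult[OF assms(1) test_function_measurable[OF assms(2)] ab(1,2) B ab(3)])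
qed

text \<open>The indicator of \<open>(a, b)\<close> is a bounded pointwise limit of test functions supported in \<open>[a, b]\<close>:
  cut off with \<open>q = (x - a) (b - x)\<close>, which is positive exactly there.\<close>
lemma integral_interval_eq_0:
  assumes v: "locally_integrable_I v"
    and orth: "\<And>\<phi>. test_function_I \<phi> \<Longrightarrow> (LINT x|lebesgue_I. v x * \<phi> x) = 0"
    and ab: "-1 < a" "a < b" "b < 1"
  shows "integral {a..b} v = 0"
proof -
  define q where "q = [:- a, 1:] * [:b, -1:]"
  have q: "poly q x = (x - a) * (b - x)" for x
    by (simp add: q_def algebra_simps)
  have q_pos: "poly q x > 0 \<longleftrightarrow> x \<in> {a<..<b}" for x
    using ab unfolding q by (auto simp: zero_less_mult_iff)
  define \<phi> where "\<phi> n = cutoff q 1 (real n)" for n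
  have \<phi>: "\<phi> n x = smooth_step 0 (real n * poly q x - 1)" for n x
    by (simp add: \<phi>_def cutoff_def)
  have supp: "real n * poly q x \<le> 0" if "x \<notin> {a<..<b}" for n x
  proof (rule mult_nonneg_nonpos)
    show "poly q x \<le> 0" using that q_pos[of x] by linarith
  qed simp
  have test: "test_function_I (\<phi> n)" for n
    unfolding \<phi>_def
  proof (rule test_function_cutoff[OF ab(1,3)])
    show "real n * poly q x \<le> 1" if "x \<notin> {a..b}" for x
      using supp[of x n] that by auto
  qed
  have "(\<lambda>n. LINT x|lebesgue_I. v x * \<phi> n x) \<longlonglongrightarrow> (LINT x|lebesgue_I. v x * indicator {a<..<b} x)"
  proof (rule integral_dominated_convergence)
    show "integrable lebesgue_I (\<lambda>x. \<bar>indicator {a..b} x * v x\<bar>)"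
      using v ab unfolding locally_integrable_I_iff by (intro integrable_abs) auto
    show "(\<lambda>x. v x * indicator {a<..<b} x) \<in> borel_measurable lebesgue_I"
      by (intro borel_measurable_times locally_integrable_I_measurable[OF v] borel_measurable_indicator)
         (use ab in \<open>auto simp: sets_restrict_space_iff\<close>)
    show "(\<lambda>x. v x * \<phi> n x) \<in> borel_measurable lebesgue_I" for n
      using integrable_test_function_mult[OF v test, of 0 n] by simp
    show "AE x in lebesgue_I. (\<lambda>n. v x * \<phi> n x) \<longlonglongrightarrow> v x * indicator {a<..<b} x"
    proof (intro AE_I2 tendsto_intros)
      fix x
      show "(\<lambda>n. \<phi> n x) \<longlonglongrightarrow> indicator {a<..<b} x"
      proof (cases "x \<in> {a<..<b}")
        case True
        then have "poly q x > 0" using q_pos by simp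
        then have "filterlim (\<lambda>n. real n * poly q x - 1) at_top sequentially"
          by real_asymp
        from filterlim_compose[OF scaled_smooth_step_limit(2)[of 0] this] True show ?thesis
          by (simp add: \<phi>)
      next
        case False
        then have "\<phi> n x = 0" for n
          using supp[of x n] by (simp add: \<phi> smooth_step_def)
        with False show ?thesis by simp
      qed
    qed
    show "AE x in lebesgue_I. norm (v x * \<phi> n x) \<le> \<bar>indicator {a..b} x * v x\<bar>" for n
    proof (intro AE_I2)
      fix x
      show "norm (v x * \<phi> n x) \<le> \<bar>indicator {a..b} x * v x\<bar>"
      proof (cases "x \<in> {a<..<b}")
        case True
        then show ?thesis
          using smooth_step_0_bounds[of "real n * poly q x - 1"]
          by (simp add: \<phi> abs_mult mult_left_le)
      next
        case False
        then show ?thesis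
          using supp[of x n] by (simp add: \<phi> smooth_step_def)
      qed
    qed
  qed
  then have "(LINT x|lebesgue_I. v x * indicator {a<..<b} x) = 0"
    by (simp only: orth[OF test] LIMSEQ_const_iff)
  moreover have "(LINT x|lebesgue_I. v x * indicator {a<..<b} x) = (LINT x:{a<..<b}|lebesgue. v x)"
    unfolding set_lebesgue_integral_def
    by (subst integral_restrict_space) (use ab in \<open>auto intro!: Bochner_Integration.integral_cong simp: indicator_def\<close>)
  moreover have "v absolutely_integrable_on {a<..<b}"
  proof (rule set_integrable_subset)
    show "v absolutely_integrable_on {a..b}"
      using v ab unfolding locally_integrable_I_def by blast
  qed auto
  ultimately show ?thesis
    by (simp add: set_lebesgue_integral_eq_integral(2) integral_open_interval_real)
qed

text \<open>By Lebesgue differentiation, the function is almost everywhere the limit of its averages.\<close>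
lemma AE_zero_if_intervals_zero:
  fixes f :: "real \<Rightarrow> real"
  assumes f: "f absolutely_integrable_on {a..b}"
    and zero: "\<And>c d. a < c \<Longrightarrow> c < d \<Longrightarrow> d < b \<Longrightarrow> integral {c..d} f = 0"
  shows "AE x in lebesgue. x \<in> {a<..<b} \<longrightarrow> f x = 0"
proof -
  define g where "g x = (if x \<in> {a..b} then f x else 0)" for x
  have "g absolutely_integrable_on UNIV"
    unfolding g_def using f absolutely_integrable_restrict_UNIV by blast
  then have "g integrable_on UNIV"
    by (rule set_lebesgue_integral_eq_integral(1))
  then have "g integrable_on cbox c d" for c d
    by (rule integrable_on_subcbox) simp
  from integrable_ccontinuous_explicit[OF this] obtain N where N: "negligible N"
    "\<And>x e. \<lbrakk>x \<notin> N; 0 < e\<rbrakk> \<Longrightarrow> \<exists>d>0. \<forall>h. 0 < h \<and> h < d \<longrightarrow>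
          norm (integral (cbox x (x + h *\<^sub>R One)) g /\<^sub>R h ^ DIM(real) - g x) < e"
    by metis
  have "f x = 0" if "x \<in> {a<..<b}" "x \<notin> N" for x
  proof (rule ccontr)
    assume "f x \<noteq> 0"
    then have "norm (g x) > 0" using that by (simp add: g_def)
    from N(2)[OF that(2) this] obtain d where d: "d > 0" "\<And>h. 0 < h \<Longrightarrow> h < d \<Longrightarrow>
          norm (integral (cbox x (x + h *\<^sub>R One)) g /\<^sub>R h ^ DIM(real) - g x) < norm (g x)"
      by blast
    \<comment> \<open>Small enough for the average to be close to its limit and for the interval to stay below \<open>b\<close>.\<close>
    define h where "h = min (d / 2) ((b - x) / 2)"
    have h: "h > 0" "h < d" "x + h < b"
      using d(1) that(1) by (auto simp: h_def min_def field_simps)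
    have "integral {x..x + h} g = integral {x..x + h} f"
      using h that(1) by (intro integral_cong) (auto simp: g_def)
    also have "\<dots> = 0"
      using h that(1) by (intro zero) auto
    finally show False
      using d(2)[OF h(1,2)] by simp
  qed
  then show ?thesis
    using N(1) by (intro AE_I'[of N]) (auto simp: negligible_iff_null_sets)
qed

lemma fundamental_lemma_of_calculus_of_variations:
  assumes v: "locally_integrable_I v"
    and orth: "\<And>\<phi>. test_function_I \<phi> \<Longrightarrow> (LINT x|lebesgue_I. v x * \<phi> x) = 0"
  shows "AE x in lebesgue_I. v x = 0"
proof -
  let ?a = "\<lambda>n. -1 + 1 / real (n + 2)" and ?b = "\<lambda>n. 1 - 1 / real (n + 2)"
  have "AE x in lebesgue. x \<in> {?a n<..<?b n} \<longrightarrow> v x = 0" for n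
  proof (rule AE_zero_if_intervals_zero)
    have ab: "-1 < ?a n" "?b n < 1" by simp_all
    show "v absolutely_integrable_on {?a n..?b n}"
      using v ab unfolding locally_integrable_I_def by blast
    show "integral {c..d} v = 0" if "?a n < c" "c < d" "d < ?b n" for c d
      using that ab by (intro integral_interval_eq_0[OF v orth]) linarith+
  qed
  then have "AE x in lebesgue. \<forall>n. x \<in> {?a n<..<?b n} \<longrightarrow> v x = 0"
    unfolding AE_all_countable by (rule allI)
  then have "AE x in lebesgue. x \<in> {-1<..<1} \<longrightarrow> v x = 0"
  proof eventually_elim
    case (elim x)
    show ?case
    proof
      assume "x \<in> {-1<..<1}"
      from eventually_happens[OF interval_exhaustion_I[OF this]] elim show "v x = 0"
        by auto
    qed
  qed
  then show ?thesis
    by (subst AE_restrict_space_iff) auto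
qed

lemma weak_deriv_unique:
  assumes "is_weak_deriv j u v" "is_weak_deriv j u v'"
  shows "AE x in lebesgue_I. v x = v' x"
proof -
  have v: "locally_integrable_I v" "locally_integrable_I v'"
    using assms by (simp_all add: is_weak_deriv_def)
  have "AE x in lebesgue_I. v x - v' x = 0"
  proof (rule fundamental_lemma_of_calculus_of_variations)
    show "locally_integrable_I (\<lambda>x. v x - v' x)"
      unfolding locally_integrable_I_iff right_diff_distrib
      using v[unfolded locally_integrable_I_iff] by (intro allI impI Bochner_Integration.integrable_diff) blast+
    fix \<phi> assume \<phi>: "test_function_I \<phi>"
    have 1: "(LINT x|lebesgue_I. u x * (deriv ^^ j) \<phi> x) = (-1) ^ j * (LINT x|lebesgue_I. v x * \<phi> x)"
      using assms(1) \<phi> unfolding is_weak_deriv_def by blast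
    have 2: "(LINT x|lebesgue_I. u x * (deriv ^^ j) \<phi> x) = (-1) ^ j * (LINT x|lebesgue_I. v' x * \<phi> x)"
      using assms(2) \<phi> unfolding is_weak_deriv_def by blast
    have eq: "(LINT x|lebesgue_I. v x * \<phi> x) = (LINT x|lebesgue_I. v' x * \<phi> x)"
      using trans[OF 1[symmetric] 2] by simp
    have "(LINT x|lebesgue_I. (v x - v' x) * \<phi> x) =
        (LINT x|lebesgue_I. v x * \<phi> x) - (LINT x|lebesgue_I. v' x * \<phi> x)"
      unfolding left_diff_distrib
      by (intro Bochner_Integration.integral_diff
            integrable_test_function_mult[OF v(1) \<phi>, of 0, unfolded funpow_0]
            integrable_test_function_mult[OF v(2) \<phi>, of 0, unfolded funpow_0])
    then show "(LINT x|lebesgue_I. (v x - v' x) * \<phi> x) = 0"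
      by (simp only: eq diff_self)
  qed
  then show ?thesis by simp
qed

lemma is_weak_deriv_weak_deriv: "is_weak_deriv j u v \<Longrightarrow> is_weak_deriv j u (weak_deriv j u)"
  unfolding weak_deriv_def by (rule someI[of "is_weak_deriv j u"])

lemma locally_integrable_poly: "locally_integrable_I (poly p)"
  by (intro integrable_imp_locally_integrable_I L2_imp_L1 finite_measure_lebesgue_I poly_L2)

lemma is_weak_deriv_poly: "is_weak_deriv j (poly p) (poly ((pderiv ^^ j) p))"
proof -
  have parts: "(LINT x|lebesgue_I. poly q x * (deriv ^^ Suc k) \<phi> x) = - (LINT x|lebesgue_I. poly (pderiv q) x * (deriv ^^ k) \<phi> x)"
    if \<phi>: "test_function_I \<phi>" for q k \<phi>
  proof -
    obtain a b where ab: "-1 < a" "b < 1" "\<And>k x. x \<notin> {a..b} \<Longrightarrow> (deriv ^^ k) \<phi> x = 0"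
      using test_function_support[OF \<phi>] by blast
    let ?f = "\<lambda>x. poly q x * (deriv ^^ Suc k) \<phi> x + poly (pderiv q) x * (deriv ^^ k) \<phi> x"
    have "(?f has_integral poly q 1 * (deriv ^^ k) \<phi> 1 - poly q (-1) * (deriv ^^ k) \<phi> (-1)) {-1..1}"
    proof (rule fundamental_theorem_of_calculus)
      fix x
      have "((\<lambda>x. poly q x * (deriv ^^ k) \<phi> x) has_real_derivative ?f x) (at x)"
        by (rule DERIV_cong[OF DERIV_mult[OF poly_DERIV test_function_deriv(1)[OF \<phi>]]]) (simp only: mult.commute add.commute)
      then show "((\<lambda>x. poly q x * (deriv ^^ k) \<phi> x) has_vector_derivative ?f x) (at x within {-1..1})"
        using has_field_derivative_at_within has_real_derivative_iff_has_vector_derivative by blast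
    qed simp
    then have "(?f has_integral 0) {-1<..<1}"
      using ab by (simp add: has_integral_Icc_iff_Ioo)
    moreover have int: "integrable lebesgue_I (\<lambda>x. poly q x * (deriv ^^ Suc k) \<phi> x)"
       "integrable lebesgue_I (\<lambda>x. poly (pderiv q) x * (deriv ^^ k) \<phi> x)"
      by (intro integrable_test_function_mult locally_integrable_poly \<phi>)+
    moreover have "(LINT x|lebesgue_I. ?f x) = integral {-1<..<1} ?f"
      by (intro lebesgue_integral_eq_integral Bochner_Integration.integrable_add int) simp
    ultimately show ?thesis
      by (simp add: integral_unique)
  qed
  have "(LINT x|lebesgue_I. poly p x * (deriv ^^ j) \<phi> x) = (-1) ^ j * (LINT x|lebesgue_I. poly ((pderiv ^^ j) p) x * \<phi> x)"
    if \<phi>: "test_function_I \<phi>" for \<phi>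
  proof (induction j arbitrary: p)
    case (Suc j)
    have "(LINT x|lebesgue_I. poly p x * (deriv ^^ Suc j) \<phi> x) = - (LINT x|lebesgue_I. poly (pderiv p) x * (deriv ^^ j) \<phi> x)"
      by (rule parts[OF \<phi>])
    also have "\<dots> = (-1) ^ Suc j * (LINT x|lebesgue_I. poly ((pderiv ^^ j) (pderiv p)) x * \<phi> x)"
      unfolding Suc.IH by simp
    finally show ?case by (simp only: funpow_Suc_right o_def)
  qed simp
  then show ?thesis
    unfolding is_weak_deriv_def by (blast intro: locally_integrable_poly)
qed

text \<open>The functions \<open>cutoff w (w ^ j * p) n\<close> are test functions, and their \<open>j\<close>-th derivatives converge
  boundedly to that of \<open>w ^ j * p\<close>. So the defining identity of the weak derivative passes to the limit
  by dominated convergence, with multiples of \<open>u\<close> and of \<open>v * w ^ j\<close> as majorants.\<close>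
lemma weak_deriv_parts_weighted:
  defines "w \<equiv> [:1, 0, -1:] :: real poly"
  assumes uv: "is_weak_deriv j u v" and u: "integrable lebesgue_I u"
    and v: "integrable lebesgue_I (\<lambda>x. v x * poly (w ^ j) x)"
  shows "(LINT x|lebesgue_I. u x * poly ((pderiv ^^ j) (w ^ j * p)) x) =
           (-1) ^ j * (LINT x|lebesgue_I. v x * poly (w ^ j * p) x)"
proof -
  define \<phi> where "\<phi> n = cutoff w (w ^ j * p) (real n)" for n
  have pos: "poly w x > 0" if "x \<in> {-1<..<1}" for x
    using that abs_square_less_1[of x] by (auto simp: w_def power2_eq_square)
  have test: "test_function_I (\<phi> n)" for n
  proof (cases "n = 0")
    case True
    then have "real n * poly w x \<le> 1" for x by simp
    then show ?thesis
      unfolding \<phi>_def by (intro test_function_cutoff[of 0 0]) auto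
  next
    case False
    show ?thesis
      unfolding \<phi>_def
    proof (rule test_function_cutoff)
      \<comment> \<open>Outside \<open>[- b, b]\<close> one has \<open>1 - x\<^sup>2 = (1 - \<bar>x\<bar>) (1 + \<bar>x\<bar>) \<le> 1 / n\<close>.\<close>
      define b where "b = 1 - 1 / (2 * real n)"
      have b: "b < 1" "0 \<le> b" using False by (auto simp: b_def field_simps)
      show "- 1 < - b" "b < 1" using b by auto
      fix x assume "x \<notin> {- b..b}"
      then have x: "\<bar>x\<bar> > b" by auto
      have "poly w x = (1 - \<bar>x\<bar>) * (1 + \<bar>x\<bar>)"
        by (simp add: w_def algebra_simps)
      also have "\<dots> \<le> 1 / real n"
      proof (cases "\<bar>x\<bar> \<le> 1")
        case True
        have "(1 - \<bar>x\<bar>) * (1 + \<bar>x\<bar>) \<le> (1 / (2 * real n)) * 2"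
          using x True b by (intro mult_mono) (auto simp: b_def)
        then show ?thesis by simp
      next
        case False
        then have "(1 - \<bar>x\<bar>) * (1 + \<bar>x\<bar>) \<le> 0" by (intro mult_nonpos_nonneg) auto
        also have "0 \<le> 1 / real n" by simp
        finally show ?thesis .
      qed
      finally show "real n * poly w x \<le> 1" using False by (simp add: field_simps)
    qed
  qed
  have mult: "(\<lambda>x. u x * (deriv ^^ j) (\<phi> n) x) \<in> borel_measurable lebesgue_I"
     "(\<lambda>x. v x * \<phi> n x) \<in> borel_measurable lebesgue_I" for n
    using integrable_test_function_mult[OF _ test, of u j n] integrable_test_function_mult[OF _ test, of v 0 n] uv
    unfolding is_weak_deriv_def by (auto intro: borel_measurable_integrable)
  have vm: "v \<in> borel_measurable lebesgue_I"
    using uv locally_integrable_I_measurable unfolding is_weak_deriv_def by blast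
  obtain B where B: "\<And>n x. x \<in> {-1<..<1} \<Longrightarrow> \<bar>(deriv ^^ j) (\<phi> n) x\<bar> \<le> B"
    using higher_deriv_cutoff_bounded_and_limit(1)[of w j p, OF pos] unfolding \<phi>_def by blast
  obtain K where K: "\<And>n x. x \<in> {-1<..<1} \<Longrightarrow> \<bar>cutoff w p (real n) x\<bar> \<le> K"
    using higher_deriv_cutoff_bounded_and_limit(1)[of w 0 p, OF pos]
    unfolding funpow_0 power_0 mult_1 by blast
  have split: "\<phi> n x = poly (w ^ j) x * cutoff w p (real n) x" for n x
    by (simp add: \<phi>_def cutoff_def)
  have lim_u: "(\<lambda>n. LINT x|lebesgue_I. u x * (deriv ^^ j) (\<phi> n) x)
      \<longlonglongrightarrow> (LINT x|lebesgue_I. u x * poly ((pderiv ^^ j) (w ^ j * p)) x)"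
  proof (rule integral_dominated_convergence[where w = "\<lambda>x. \<bar>B * u x\<bar>"])
    show "AE x in lebesgue_I. (\<lambda>n. u x * (deriv ^^ j) (\<phi> n) x) \<longlonglongrightarrow> u x * poly ((pderiv ^^ j) (w ^ j * p)) x"
      unfolding \<phi>_def by (intro AE_I2 tendsto_intros higher_deriv_cutoff_bounded_and_limit(2) pos) auto
    show "AE x in lebesgue_I. norm (u x * (deriv ^^ j) (\<phi> n) x) \<le> \<bar>B * u x\<bar>" for n
    proof (intro AE_I2)
      fix x assume "x \<in> space lebesgue_I"
      then have "\<bar>(deriv ^^ j) (\<phi> n) x\<bar> \<le> \<bar>B\<bar>" using B[of x n] by auto
      then show "norm (u x * (deriv ^^ j) (\<phi> n) x) \<le> \<bar>B * u x\<bar>"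
        by (simp add: abs_mult mult.commute[of "\<bar>u x\<bar>"] mult_right_mono)
    qed
    show "(\<lambda>x. u x * poly ((pderiv ^^ j) (w ^ j * p)) x) \<in> borel_measurable lebesgue_I"
      by (rule borel_measurable_times[OF borel_measurable_integrable[OF u]
            L2_measurable[OF poly_L2]])
    show "integrable lebesgue_I (\<lambda>x. \<bar>B * u x\<bar>)" using u by simp
  qed (rule mult)
  have lim_v: "(\<lambda>n. LINT x|lebesgue_I. v x * \<phi> n x)
      \<longlonglongrightarrow> (LINT x|lebesgue_I. v x * poly (w ^ j * p) x)"
  proof (rule integral_dominated_convergence[where w = "\<lambda>x. \<bar>K * (v x * poly (w ^ j) x)\<bar>"])
    show "AE x in lebesgue_I. (\<lambda>n. v x * \<phi> n x) \<longlonglongrightarrow> v x * poly (w ^ j * p) x"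
      unfolding split poly_mult
      by (intro AE_I2 tendsto_intros)
         (use higher_deriv_cutoff_bounded_and_limit(2)[of w _ 0 p, OF pos] in auto)
    show "AE x in lebesgue_I. norm (v x * \<phi> n x) \<le> \<bar>K * (v x * poly (w ^ j) x)\<bar>" for n
    proof (intro AE_I2)
      fix x assume "x \<in> space lebesgue_I"
      then have "\<bar>cutoff w p (real n) x\<bar> \<le> \<bar>K\<bar>" using K[of x n] by auto
      then have "\<bar>v x * poly (w ^ j) x\<bar> * \<bar>cutoff w p (real n) x\<bar> \<le> \<bar>v x * poly (w ^ j) x\<bar> * \<bar>K\<bar>"
        by (rule mult_left_mono) simp
      then show "norm (v x * \<phi> n x) \<le> \<bar>K * (v x * poly (w ^ j) x)\<bar>"
        by (simp add: split abs_mult mult_ac)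
    qed
    show "(\<lambda>x. v x * poly (w ^ j * p) x) \<in> borel_measurable lebesgue_I"
      by (rule borel_measurable_times[OF vm L2_measurable[OF poly_L2]])
    show "integrable lebesgue_I (\<lambda>x. \<bar>K * (v x * poly (w ^ j) x)\<bar>)"
      by (intro integrable_abs integrable_mult_right v)
  qed (rule mult)
  have eq: "(LINT x|lebesgue_I. u x * (deriv ^^ j) (\<phi> n) x) = (-1) ^ j * (LINT x|lebesgue_I. v x * \<phi> n x)" for n
    using uv test[of n] unfolding is_weak_deriv_def by blast
  show ?thesis
    by (rule LIMSEQ_unique[OF lim_u[unfolded eq] tendsto_mult_left[OF lim_v]])
qed

section \<open>Orthogonality and completeness\<close>

lemma L2_I_eq: "L2_I = L2 lebesgue_I"
  by (simp add: L2_I_def L2_def)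

lemma integral_lebesgue_I_cong:
  "(\<And>x. x \<in> {-1<..<1} \<Longrightarrow> f x = g x) \<Longrightarrow> (LINT x|lebesgue_I. f x) = (LINT x|lebesgue_I. g x)"
  by (rule Bochner_Integration.integral_cong) auto

lemma integrable_poly: "integrable lebesgue_I (poly p)"
  by (rule L2_imp_L1[OF finite_measure_lebesgue_I poly_L2])

lemma integrable_poly_mult: "integrable lebesgue_I (\<lambda>x. poly p x * poly q x)"
  using integrable_poly[of "p * q"] unfolding poly_mult .

lemma integral_pderiv: "(LINT x|lebesgue_I. poly (pderiv p) x) = poly p 1 - poly p (-1)"
proof -
  have "(poly (pderiv p) has_integral poly p 1 - poly p (-1)) {-1..1}"
  proof (rule fundamental_theorem_of_calculus)
    fix x show "(poly p has_vector_derivative poly (pderiv p) x) (at x within {-1..1})"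
      using has_field_derivative_at_within[OF poly_DERIV] has_real_derivative_iff_has_vector_derivative by blast
  qed simp
  then have "(poly (pderiv p) has_integral poly p 1 - poly p (-1)) {-1<..<1}"
    by (simp add: has_integral_Icc_iff_Ioo)
  moreover have "(LINT x|lebesgue_I. poly (pderiv p) x) = integral {-1<..<1} (poly (pderiv p))"
    by (rule lebesgue_integral_eq_integral[OF integrable_poly]) simp
  ultimately show ?thesis by (simp add: integral_unique)
qed

text \<open>Rodrigues' formula and \<open>l\<close> integrations by parts leave the \<open>l\<close>-th derivative of \<open>q\<close>.\<close>
lemma legendre_orthogonal_lower_degree:
  assumes "degree q < l"
  shows "(LINT x|lebesgue_I. poly q x * poly (legendre_poly l) x) = 0"
proof -
  have zero: "(pderiv ^^ l) q = 0"
    by (rule poly_eqI) (use assms in \<open>simp add: coeff_higher_pderiv coeff_eq_0\<close>)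
  define c :: real where "c = (-1) ^ l / (2 ^ l * fact l)"
  have "[:-1, 0, 1 :: real:] = - weight_poly" by simp
  then have "[:-1, 0, 1 :: real:] ^ l = smult ((-1) ^ l) (weight_poly ^ l)"
    by (metis smult_power smult_1_left smult_minus_left)
  then have P: "legendre_poly l = smult c ((pderiv ^^ l) (weight_poly ^ l * 1))"
    by (simp add: legendre_poly_def higher_pderiv_smult c_def)
  have "(LINT x|lebesgue_I. poly q x * poly ((pderiv ^^ l) (weight_poly ^ l * 1)) x) = 
      (-1) ^ l * (LINT x|lebesgue_I. poly ((pderiv ^^ l) q) x * poly (weight_poly ^ l * 1) x)"
    by (rule weak_deriv_parts_weighted[OF is_weak_deriv_poly integrable_poly integrable_poly_mult])
  also have "\<dots> = 0"
    unfolding zero by simp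
  finally have "(LINT x|lebesgue_I. c * (poly q x * poly ((pderiv ^^ l) (weight_poly ^ l * 1)) x)) = 0"
    by (simp only: integral_mult_right_zero mult_zero_right)
  then show ?thesis
    unfolding P poly_smult by (simp only: mult.left_commute)
qed

lemma legendre_orthogonal:
  assumes "i \<noteq> k"
  shows "(LINT x|lebesgue_I. poly (legendre_poly i) x * poly (legendre_poly k) x) = 0"
proof (cases "i < k")
  case True
  then show ?thesis by (intro legendre_orthogonal_lower_degree) (simp add: degree_legendre_poly)
next
  case False
  with assms have "(LINT x|lebesgue_I. poly (legendre_poly k) x * poly (legendre_poly i) x) = 0"
    by (intro legendre_orthogonal_lower_degree) (simp add: degree_legendre_poly)
  then show ?thesis by (simp only: mult.commute)
qed

text \<open>Integrate the derivative of \<open>x P\<^sup>2\<close>, whose boundary values are known, and use that \<open>x P'\<close> equals \<open>l P\<close>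
  up to a polynomial of lower degree, which is orthogonal to \<open>P\<close>.\<close>
lemma integral_legendre_poly_power2:
  "(LINT x|lebesgue_I. (poly (legendre_poly l) x)\<^sup>2) = 2 / (2 * real l + 1)"
proof -
  define P where "P = legendre_poly l"
  \<comment> \<open>The leading terms of \<open>x P'\<close> and \<open>l P\<close> cancel.\<close>
  define s where "s = [:0, 1:] * pderiv P - smult (real l) P"
  have "coeff s l = 0"
    by (cases l) (simp_all add: s_def coeff_pderiv)
  moreover have "degree s \<le> l"
    unfolding s_def
  proof (rule degree_diff_le)
    show "degree ([:0, 1:] * pderiv P) \<le> l"
    proof (cases "pderiv P = 0")
      case False
      then have "degree P \<noteq> 0" by (simp add: pderiv_eq_0_iff)
      with False show ?thesis
        by (simp add: degree_mult_eq degree_pderiv P_def degree_legendre_poly)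
    qed simp
    show "degree (smult (real l) P) \<le> l"
      by (rule order_trans[OF degree_smult_le]) (simp add: P_def degree_legendre_poly)
  qed
  ultimately have "s = 0 \<or> degree s < l"
    by (metis le_neq_implies_less leading_coeff_0_iff)
  then have sP: "(LINT x|lebesgue_I. poly s x * poly P x) = 0"
    unfolding P_def using legendre_orthogonal_lower_degree by fastforce
  have eq: "poly (pderiv ([:0, 1:] * P * P)) x = 2 * (poly s x * poly P x) + (2 * real l + 1) * (poly P x)\<^sup>2" for x
    by (simp add: s_def pderiv_mult pderiv_pCons power2_eq_square algebra_simps)
  have "(LINT x|lebesgue_I. poly (pderiv ([:0, 1:] * P * P)) x) = 2"
    unfolding integral_pderiv by (simp add: P_def legendre_poly_1 legendre_poly_minus_1 power_mult_distrib[symmetric])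
  moreover have "(LINT x|lebesgue_I. poly (pderiv ([:0, 1:] * P * P)) x) =
      2 * (LINT x|lebesgue_I. poly s x * poly P x) + (2 * real l + 1) * (LINT x|lebesgue_I. (poly P x)\<^sup>2)"
    unfolding eq
    using integrable_poly_mult[of s P] L2_integrable_power2[OF poly_L2[of P]] by simp
  ultimately have "(2 * real l + 1) * (LINT x|lebesgue_I. (poly P x)\<^sup>2) = 2"
    using sP by linarith
  then show ?thesis
    by (simp add: P_def field_simps)
qed

lemma integral_legendre_mult:
  "(LINT x|lebesgue_I. poly (legendre_poly i) x * poly (legendre_poly k) x) = (if i = k then 2 / (2 * real k + 1) else 0)"
  using legendre_orthogonal[of i k] integral_legendre_poly_power2[of k] by (simp add: power2_eq_square)

lemma real_polynomial_function_imp_poly: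
  fixes f :: "real \<Rightarrow> real"
  assumes "real_polynomial_function f" shows "\<exists>p. f = poly p"
  using assms
proof induction
  case (linear f)
  then interpret bounded_linear f .
  have "f x = poly [:0, f 1:] x" for x
    using scaleR[of x 1] by simp
  then show ?case by blast
next
  case (const c)
  have "(\<lambda>x. c) = poly [:c:]" by auto
  then show ?case by blast
next
  case (add f g)
  then obtain p q where "f = poly p" "g = poly q" by blast
  then have "(\<lambda>x. f x + g x) = poly (p + q)" by auto
  then show ?case by blast
next
  case (mult f g)
  then obtain p q where "f = poly p" "g = poly q" by blast
  then have "(\<lambda>x. f x * g x) = poly (p * q)" by auto
  then show ?case by blast
qed

lemma L2_mult_poly:
  "u \<in> L2 lebesgue_I \<Longrightarrow> integrable lebesgue_I (\<lambda>x. u x * poly p x)"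
  by (rule L2_mult[OF _ poly_L2])

text \<open>Orthogonality to all Legendre polynomials means orthogonality to all polynomials, hence by
  Weierstrass approximation to all continuous functions and in particular to all test functions.\<close>
lemma legendre_complete:
  assumes f: "f \<in> L2 lebesgue_I" and zero: "\<And>l. legendre_coeff f l = 0"
  shows "AE x in lebesgue_I. f x = 0"
proof (rule fundamental_lemma_of_calculus_of_variations)
  have L1: "integrable lebesgue_I f"
    by (rule L2_imp_L1[OF finite_measure_lebesgue_I f])
  then show loc: "locally_integrable_I f" by (rule integrable_imp_locally_integrable_I)
  have poly_zero: "(LINT x|lebesgue_I. f x * poly q x) = 0" for q
  proof (induction "degree q" arbitrary: q rule: less_induct)
    case less
    define l where "l = degree q"
    define c where "c = lead_coeff q / lead_coeff (legendre_poly l)"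
    \<comment> \<open>Subtracting the right multiple of a Legendre polynomial lowers the degree.\<close>
    define r where "r = q - smult c (legendre_poly l)"
    have P0: "legendre_poly l \<noteq> 0"
      using legendre_poly_1[of l] by auto
    have "coeff r l = 0"
      using P0 by (simp add: r_def c_def l_def degree_legendre_poly) (metis degree_legendre_poly leading_coeff_0_iff nonzero_eq_divide_eq)
    moreover have "degree r \<le> l"
      unfolding r_def
      by (intro degree_diff_le order_trans[OF degree_smult_le]) (simp_all add: l_def degree_legendre_poly)
    ultimately have "r = 0 \<or> degree r < degree q"
      unfolding l_def by (metis le_neq_implies_less leading_coeff_0_iff)
    then have r0: "(LINT x|lebesgue_I. f x * poly r x) = 0"
      using less by fastforce
    have "poly q x = c * poly (legendre_poly l) x + poly r x" for x
      by (simp add: r_def)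
    then have "(LINT x|lebesgue_I. f x * poly q x) =
        (LINT x|lebesgue_I. c * (f x * poly (legendre_poly l) x) + f x * poly r x)"
      by (intro integral_lebesgue_I_cong) (simp add: algebra_simps)
    also have "\<dots> = c * legendre_coeff f l + (LINT x|lebesgue_I. f x * poly r x)"
      unfolding legendre_coeff_def
      using L2_mult_poly[OF f, of "legendre_poly l"] L2_mult_poly[OF f, of r] by simp
    finally show ?case by (simp add: r0 zero)
  qed
  fix \<phi> assume \<phi>: "test_function_I \<phi>"
  have int: "integrable lebesgue_I (\<lambda>x. f x * \<phi> x)"
    using integrable_test_function_mult[OF loc \<phi>, of 0] by (simp only: funpow_0)
  define K where "K = (LINT x|lebesgue_I. \<bar>f x\<bar>)"
  have "K \<ge> 0" unfolding K_def by simp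
  have "\<bar>LINT x|lebesgue_I. f x * \<phi> x\<bar> \<le> e" if "e > 0" for e
  proof -
    have "continuous_on {-1..1} \<phi>"
      using test_function_deriv(2)[OF \<phi>, of _ 0] by (simp only: funpow_0)
    moreover have "e / (K + 1) > 0" using that \<open>K \<ge> 0\<close> by simp
    ultimately obtain g where g: "real_polynomial_function g" "\<And>x. x \<in> {-1..1} \<Longrightarrow> \<bar>\<phi> x - g x\<bar> < e / (K + 1)"
      by (rule Stone_Weierstrass_real_polynomial_function[OF compact_Icc]) blast
    obtain q where q: "g = poly q"
      using real_polynomial_function_imp_poly[OF g(1)] by blast
    have "(LINT x|lebesgue_I. f x * \<phi> x) = (LINT x|lebesgue_I. f x * \<phi> x) - (LINT x|lebesgue_I. f x * poly q x)"
      by (simp add: poly_zero)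
    also have "\<dots> = (LINT x|lebesgue_I. f x * \<phi> x - f x * poly q x)"
      by (rule Bochner_Integration.integral_diff[symmetric, OF int L2_mult_poly[OF f]])
    finally have "\<bar>LINT x|lebesgue_I. f x * \<phi> x\<bar> = \<bar>LINT x|lebesgue_I. f x * \<phi> x - f x * poly q x\<bar>"
      by simp
    also have "\<dots> \<le> (LINT x|lebesgue_I. \<bar>f x * \<phi> x - f x * poly q x\<bar>)"
      by (rule integral_abs_bound)
    also have "\<dots> \<le> (LINT x|lebesgue_I. e / (K + 1) * \<bar>f x\<bar>)"
    proof (rule integral_mono)
      show "integrable lebesgue_I (\<lambda>x. \<bar>f x * \<phi> x - f x * poly q x\<bar>)"
        by (intro integrable_abs Bochner_Integration.integrable_diff int L2_mult_poly[OF f])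
      show "integrable lebesgue_I (\<lambda>x. e / (K + 1) * \<bar>f x\<bar>)"
        by (intro integrable_mult_right integrable_abs L1)
      fix x assume "x \<in> space lebesgue_I"
      then have "\<bar>\<phi> x - poly q x\<bar> \<le> e / (K + 1)" using g(2)[of x] q by (simp add: less_imp_le)
      then have "\<bar>f x\<bar> * \<bar>\<phi> x - poly q x\<bar> \<le> \<bar>f x\<bar> * (e / (K + 1))"
        by (rule mult_left_mono) simp
      then show "\<bar>f x * \<phi> x - f x * poly q x\<bar> \<le> e / (K + 1) * \<bar>f x\<bar>"
        by (simp only: right_diff_distrib[symmetric] abs_mult mult.commute[of "e / (K + 1)"])
    qed
    also have "\<dots> = e / (K + 1) * K"
      by (simp add: K_def)
    also have "\<dots> \<le> e"
      using that \<open>K \<ge> 0\<close> by (simp add: field_simps)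
    finally show ?thesis .
  qed
  then have "\<bar>LINT x|lebesgue_I. f x * \<phi> x\<bar> \<le> 0"
    by (rule field_le_epsilon[of _ 0, simplified])
  then show "(LINT x|lebesgue_I. f x * \<phi> x) = 0" by simp
qed

definition sqrt_weight :: "nat \<Rightarrow> real \<Rightarrow> real" where
  "sqrt_weight j x = sqrt ((1 - x\<^sup>2) ^ j)"

lemma weight_pos: "x \<in> {-1<..<1} \<Longrightarrow> 0 < 1 - (x::real)\<^sup>2"
  using abs_square_less_1[of x] by auto

lemma sqrt_weight_pos: "x \<in> {-1<..<1} \<Longrightarrow> 0 < sqrt_weight j x"
  using weight_pos by (simp add: sqrt_weight_def)

lemma sqrt_weight_power2: "x \<in> {-1<..<1} \<Longrightarrow> (sqrt_weight j x)\<^sup>2 = (1 - x\<^sup>2) ^ j"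
  using weight_pos[of x] by (simp add: sqrt_weight_def)

lemma continuous_sqrt_weight: "continuous_on S (sqrt_weight j)"
  unfolding sqrt_weight_def[abs_def] by (intro continuous_intros)

lemma sqrt_weight_measurable: "sqrt_weight j \<in> borel_measurable lebesgue_I"
  by (intro continuous_imp_borel_measurable_lebesgue_I continuous_sqrt_weight)

text \<open>Multiplication by the square root of the weight embeds the weighted spaces isometrically into
  the unweighted one, so one theory of orthogonal series serves all orders \<open>j\<close>.\<close>
definition wlegendre :: "nat \<Rightarrow> nat \<Rightarrow> real \<Rightarrow> real" where
  "wlegendre j l x = sqrt_weight j x * poly ((pderiv ^^ j) (legendre_poly l)) x"

lemma poly_weight_power: "poly (weight_poly ^ j) x = (1 - x\<^sup>2) ^ j"
  by (simp add: power2_eq_square)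

lemma sqrt_weight_L2: "sqrt_weight j \<in> L2 lebesgue_I"
proof -
  have "integrable lebesgue_I (\<lambda>x. (sqrt_weight j x)\<^sup>2) \<longleftrightarrow> integrable lebesgue_I (poly (weight_poly ^ j))"
    by (intro Bochner_Integration.integrable_cong) (auto simp only: poly_weight_power sqrt_weight_power2 space_lebesgue_on)
  then show ?thesis
    using integrable_poly sqrt_weight_measurable by (simp add: L2_def)
qed

lemma wlegendre_L2: "wlegendre j l \<in> L2 lebesgue_I"
proof -
  define p where "p = weight_poly ^ j * ((pderiv ^^ j) (legendre_poly l)) ^ 2"
  have "integrable lebesgue_I (\<lambda>x. (wlegendre j l x)\<^sup>2) \<longleftrightarrow> integrable lebesgue_I (poly p)"
  proof (intro Bochner_Integration.integrable_cong)
    fix x assume "x \<in> space lebesgue_I"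
    then show "(wlegendre j l x)\<^sup>2 = poly p x"
      by (simp only: p_def wlegendre_def power_mult_distrib sqrt_weight_power2 space_lebesgue_on
        poly_mult poly_weight_power) (simp only: poly_power)
  qed simp
  moreover have "wlegendre j l \<in> borel_measurable lebesgue_I"
    unfolding wlegendre_def[abs_def]
    by (intro borel_measurable_times sqrt_weight_measurable L2_measurable[OF poly_L2])
  ultimately show ?thesis
    using integrable_poly by (simp add: L2_def)
qed

text \<open>Integration by parts against \<open>w ^ j\<close> times the differentiated Legendre polynomial, followed by the
  eigenvalue equation.\<close>
lemma integral_weak_deriv_mult_legendre:
  assumes uv: "is_weak_deriv j u v" and u: "integrable lebesgue_I u"
    and v: "integrable lebesgue_I (\<lambda>x. v x * (1 - x\<^sup>2) ^ j)"
  shows "(LINT x|lebesgue_I. v x * (1 - x\<^sup>2) ^ j * poly ((pderiv ^^ j) (legendre_poly l)) x) =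
           eigenvalue j l * legendre_coeff u l"
proof -
  let ?P = "(pderiv ^^ j) (legendre_poly l)"
  have v': "integrable lebesgue_I (\<lambda>x. v x * poly (weight_poly ^ j) x)"
    using v unfolding poly_weight_power .
  have sq: "(-1) ^ j * (-1) ^ j = (1 :: real)"
    by (simp flip: power_mult_distrib)
  have "(-1) ^ j * (LINT x|lebesgue_I. u x * poly ((pderiv ^^ j) (weight_poly ^ j * ?P)) x) =
      (-1) ^ j * ((-1) ^ j * (LINT x|lebesgue_I. v x * poly (weight_poly ^ j * ?P) x))"
    by (simp only: weak_deriv_parts_weighted[OF uv u v'])
  also have "\<dots> = (LINT x|lebesgue_I. v x * poly (weight_poly ^ j * ?P) x)"
    by (simp only: mult.assoc[symmetric] sq mult_1)
  also have "\<dots> = (LINT x|lebesgue_I. v x * (1 - x\<^sup>2) ^ j * poly ?P x)"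
    by (simp only: poly_mult poly_weight_power mult.assoc)
  also have "(LINT x|lebesgue_I. u x * poly ((pderiv ^^ j) (weight_poly ^ j * ?P)) x) =
      (LINT x|lebesgue_I. ((-1) ^ j * eigenvalue j l) * (u x * poly (legendre_poly l) x))"
    unfolding higher_pderiv_wlegendre poly_smult by (simp only: mult_ac)
  also have "\<dots> = (-1) ^ j * eigenvalue j l * legendre_coeff u l"
    unfolding legendre_coeff_def by (rule integral_mult_right_zero)
  finally show ?thesis
    by (simp only: mult.assoc[symmetric] sq mult_1)
qed

text \<open>Apply the previous lemma to a Legendre polynomial, whose classical derivative is a weak one:
  orthogonality of the derivatives follows from that of the polynomials.\<close>
lemma integral_wlegendre_mult:
  "(LINT x|lebesgue_I. wlegendre j i x * wlegendre j k x) =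
     (if i = k then eigenvalue j k * (2 / (2 * real k + 1)) else 0)"
proof -
  let ?Q = "\<lambda>l. (pderiv ^^ j) (legendre_poly l)"
  have "(LINT x|lebesgue_I. wlegendre j i x * wlegendre j k x) =
      (LINT x|lebesgue_I. poly (?Q i) x * (1 - x\<^sup>2) ^ j * poly (?Q k) x)"
  proof (rule integral_lebesgue_I_cong)
    fix x :: real assume "x \<in> {-1<..<1}"
    from sqrt_weight_power2[OF this, of j, symmetric]
    show "wlegendre j i x * wlegendre j k x = poly (?Q i) x * (1 - x\<^sup>2) ^ j * poly (?Q k) x"
      by (simp add: wlegendre_def power2_eq_square)
  qed
  also have "\<dots> = eigenvalue j k * legendre_coeff (poly (legendre_poly i)) k"
  proof (rule integral_weak_deriv_mult_legendre[OF is_weak_deriv_poly integrable_poly])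
    show "integrable lebesgue_I (\<lambda>x. poly (?Q i) x * (1 - x\<^sup>2) ^ j)"
      unfolding poly_weight_power[symmetric] by (rule integrable_poly_mult)
  qed
  finally show ?thesis
    by (simp add: legendre_coeff_def integral_legendre_mult)
qed

section \<open>Weighted weak derivatives and Legendre coefficients\<close>

text \<open>The contribution of degree \<open>l\<close> to the squared \<open>L\<^sup>2\<close> norm of \<open>u\<close>.\<close>
definition energy :: "(real \<Rightarrow> real) \<Rightarrow> nat \<Rightarrow> real" where
  "energy u l = (legendre_coeff u l)\<^sup>2 * ((2 * real l + 1) / 2)"

lemma energy_normalized:
  "(legendre_coeff u l * ((2 * real l + 1) / 2))\<^sup>2 * (e * (2 / (2 * real l + 1))) = energy u l * e"
proof -
  have "(c * (a / 2))\<^sup>2 * (e * (2 / a)) = c\<^sup>2 * (a / 2) * e" if "a > 0" for a c :: real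
    using that by (simp add: power2_eq_square field_simps)
  then show ?thesis by (simp add: energy_def)
qed

lemma energy_nonneg: "0 \<le> energy u l"
  by (simp add: energy_def)

text \<open>All spaces below are compared through sums of the energies with weights.\<close>
abbreviation (input) finite_energy :: "(real \<Rightarrow> real) \<Rightarrow> (nat \<Rightarrow> real) \<Rightarrow> bool" where
  "finite_energy u a \<equiv> summable (\<lambda>l. energy u l * a l)"

abbreviation (input) energy_sum :: "(real \<Rightarrow> real) \<Rightarrow> (nat \<Rightarrow> real) \<Rightarrow> real" where
  "energy_sum u a \<equiv> (\<Sum>l. energy u l * a l)"

abbreviation (input) bracket_power :: "nat \<Rightarrow> nat \<Rightarrow> real" where
  "bracket_power n l \<equiv> (1 + real l) ^ (2 * n)"

abbreviation (input) bracket :: "real \<Rightarrow> nat \<Rightarrow> real" where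
  "bracket \<eta> l \<equiv> (1 + real l) powr (2 * \<eta>)"

definition partial_sum :: "(real \<Rightarrow> real) \<Rightarrow> nat set \<Rightarrow> real poly" where
  "partial_sum u F = (\<Sum>l\<in>F. smult (legendre_coeff u l * ((2 * real l + 1) / 2)) (legendre_poly l))"

lemma legendre_coeff_cong_AE:
  assumes "AE x in lebesgue_I. u x = v x" "u \<in> borel_measurable lebesgue_I" "v \<in> borel_measurable lebesgue_I"
  shows "legendre_coeff u l = legendre_coeff v l"
  unfolding legendre_coeff_def
proof (rule integral_cong_AE)
  show "AE x in lebesgue_I. u x * poly (legendre_poly l) x = v x * poly (legendre_poly l) x"
    using assms(1) by eventually_elim simp
qed (intro borel_measurable_times assms L2_measurable[OF poly_L2])+

lemma legendre_coeff_add: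
  assumes "u \<in> L2_I" "v \<in> L2_I"
  shows "legendre_coeff (\<lambda>x. u x + v x) l = legendre_coeff u l + legendre_coeff v l"
  using assms unfolding legendre_coeff_def L2_I_eq distrib_right
  by (intro Bochner_Integration.integral_add L2_mult_poly)

lemma legendre_coeff_diff:
  assumes "u \<in> L2_I" "v \<in> L2_I"
  shows "legendre_coeff (\<lambda>x. u x - v x) l = legendre_coeff u l - legendre_coeff v l"
  using assms unfolding legendre_coeff_def L2_I_eq left_diff_distrib
  by (intro Bochner_Integration.integral_diff L2_mult_poly)

lemma legendre_coeff_sum_legendre:
  assumes "finite F"
  shows "legendre_coeff (poly (\<Sum>l\<in>F. smult (b l) (legendre_poly l))) k = (if k \<in> F then b k * (2 / (2 * real k + 1)) else 0)"
proof -
  have "legendre_coeff (poly (\<Sum>l\<in>F. smult (b l) (legendre_poly l))) k =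
      (LINT x|lebesgue_I. (\<Sum>l\<in>F. b l * (poly (legendre_poly l) x * poly (legendre_poly k) x)))"
    unfolding legendre_coeff_def by (simp add: poly_sum sum_distrib_right mult.assoc)
  also have "\<dots> = (\<Sum>l\<in>F. b l * (LINT x|lebesgue_I. poly (legendre_poly l) x * poly (legendre_poly k) x))"
    by (simp add: integrable_poly_mult)
  also have "\<dots> = (\<Sum>l\<in>F. if l = k then b k * (2 / (2 * real k + 1)) else 0)"
    by (intro sum.cong) (auto simp: integral_legendre_mult)
  finally show ?thesis using assms by simp
qed

lemma legendre_coeff_partial_sum:
  "finite F \<Longrightarrow> legendre_coeff (poly (partial_sum u F)) k = (if k \<in> F then legendre_coeff u k else 0)"
  unfolding partial_sum_def by (simp add: legendre_coeff_sum_legendre)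

text \<open>Bessel's inequality for \<open>v * sqrt_weight j\<close>.\<close>
lemma summable_energy_of_weak_deriv:
  assumes u: "u \<in> L2_I" and uv: "is_weak_deriv j u v"
    and v: "integrable lebesgue_I (\<lambda>x. (v x)\<^sup>2 * (1 - x\<^sup>2) ^ j)"
  shows "finite_energy u (eigenvalue j)"
proof -
  define g where "g x = v x * sqrt_weight j x" for x
  have vm: "v \<in> borel_measurable lebesgue_I"
    using uv locally_integrable_I_measurable unfolding is_weak_deriv_def by blast
  have "integrable lebesgue_I (\<lambda>x. (g x)\<^sup>2) \<longleftrightarrow> integrable lebesgue_I (\<lambda>x. (v x)\<^sup>2 * (1 - x\<^sup>2) ^ j)"
    by (intro Bochner_Integration.integrable_cong) (auto simp: g_def power_mult_distrib sqrt_weight_power2)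
  moreover have "g \<in> borel_measurable lebesgue_I"
    unfolding g_def[abs_def] by (intro borel_measurable_times vm sqrt_weight_measurable)
  ultimately have g: "g \<in> L2 lebesgue_I"
    using v by (simp add: L2_def)
  have "integrable lebesgue_I (\<lambda>x. g x * sqrt_weight j x) \<longleftrightarrow> integrable lebesgue_I (\<lambda>x. v x * (1 - x\<^sup>2) ^ j)"
    by (intro Bochner_Integration.integrable_cong)
       (auto simp: g_def sqrt_weight_power2[symmetric] power2_eq_square[of "sqrt_weight j _"])
  then have vint: "integrable lebesgue_I (\<lambda>x. v x * (1 - x\<^sup>2) ^ j)"
    using L2_mult[OF g sqrt_weight_L2] by simp
  have coeff: "(LINT x|lebesgue_I. g x * wlegendre j l x) =
      (legendre_coeff u l * ((2 * real l + 1) / 2)) * (eigenvalue j l * (2 / (2 * real l + 1)))" for l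
  proof -
    have "(LINT x|lebesgue_I. g x * wlegendre j l x) =
        (LINT x|lebesgue_I. v x * (1 - x\<^sup>2) ^ j * poly ((pderiv ^^ j) (legendre_poly l)) x)"
      by (intro integral_lebesgue_I_cong)
         (auto simp: g_def wlegendre_def sqrt_weight_power2[symmetric] power2_eq_square[of "sqrt_weight j _"])
    also have "\<dots> = eigenvalue j l * legendre_coeff u l"
      using L2_imp_L1[OF finite_measure_lebesgue_I] u
      by (intro integral_weak_deriv_mult_legendre[OF uv _ vint]) (simp add: L2_I_eq)
    finally show ?thesis by simp
  qed
  have "summable (\<lambda>l. (legendre_coeff u l * ((2 * real l + 1) / 2))\<^sup>2 * (eigenvalue j l * (2 / (2 * real l + 1))))"
  proof (rule bessel_inequality[OF wlegendre_L2 _ _ g coeff])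
    show "(LINT x|lebesgue_I. wlegendre j i x * wlegendre j k x) = 0" if "i \<noteq> k" for i k
      using that by (simp add: integral_wlegendre_mult)
    show "(LINT x|lebesgue_I. (wlegendre j l x)\<^sup>2) = eigenvalue j l * (2 / (2 * real l + 1))" for l
      using integral_wlegendre_mult[of j l l] by (simp add: power2_eq_square)
  qed
  then show ?thesis by (simp only: energy_normalized)
qed

lemma is_weak_deriv_0:
  assumes "u \<in> L2_I" shows "is_weak_deriv 0 u u"
proof -
  have "locally_integrable_I u"
    using assms by (intro integrable_imp_locally_integrable_I L2_imp_L1 finite_measure_lebesgue_I) (simp add: L2_I_eq)
  then show ?thesis by (simp add: is_weak_deriv_def)
qed

lemma eigenvalue_0: "eigenvalue 0 l = 1"
  by (simp add: eigenvalue_def)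

lemma wlegendre_0: "wlegendre 0 l = poly (legendre_poly l)"
  by (simp add: wlegendre_def fun_eq_iff sqrt_weight_def)

lemma summable_energy:
  assumes "u \<in> L2_I" shows "summable (energy u)"
  using summable_energy_of_weak_deriv[OF assms is_weak_deriv_0[OF assms]] assms
  by (simp add: eigenvalue_0 L2_I_def)

text \<open>Riesz--Fischer for the differentiated series, whose terms are orthogonal with squared norms
  \<open>eigenvalue j l * (2 / (2 * l + 1))\<close> before multiplication by the coefficients.\<close>
lemma wlegendre_series:
  assumes "finite_energy u (eigenvalue j)"
  shows "\<exists>g\<in>L2 lebesgue_I.
    (\<lambda>N. LINT x|lebesgue_I. (sqrt_weight j x * poly ((pderiv ^^ j) (partial_sum u {..<N})) x - g x)\<^sup>2) \<longlonglongrightarrow> 0 \<and>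
    (LINT x|lebesgue_I. (g x)\<^sup>2) = energy_sum u (eigenvalue j) \<and>
    (\<forall>k. (LINT x|lebesgue_I. g x * wlegendre j k x) = eigenvalue j k * legendre_coeff u k)"
proof -
  define b where "b l = legendre_coeff u l * ((2 * real l + 1) / 2)" for l
  define h where "h l = eigenvalue j l * (2 / (2 * real l + 1))" for l
  have bh: "(b l)\<^sup>2 * h l = energy u l * eigenvalue j l" for l
    unfolding b_def h_def by (rule energy_normalized)
  have orth: "(LINT x|lebesgue_I. wlegendre j i x * wlegendre j k x) = 0" if "i \<noteq> k" for i k
    using that by (simp add: integral_wlegendre_mult)
  have norm: "(LINT x|lebesgue_I. (wlegendre j l x)\<^sup>2) = h l" for l
    using integral_wlegendre_mult[of j l l] by (simp add: power2_eq_square h_def)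
  have summ: "summable (\<lambda>l. (b l)\<^sup>2 * h l)"
    unfolding bh by (rule assms)
  have rf: "\<exists>g\<in>L2 lebesgue_I.
    (\<lambda>N. LINT x|lebesgue_I. ((\<Sum>l<N. b l * wlegendre j l x) - g x)\<^sup>2) \<longlonglongrightarrow> 0 \<and>
    (LINT x|lebesgue_I. (g x)\<^sup>2) = (\<Sum>l. (b l)\<^sup>2 * h l) \<and>
    (\<forall>k. (LINT x|lebesgue_I. g x * wlegendre j k x) = b k * h k)"
    by (intro riesz_fischer finite_measure_lebesgue_I wlegendre_L2 orth norm summ)
  have S: "(\<Sum>l<N. b l * wlegendre j l x) =
      sqrt_weight j x * poly ((pderiv ^^ j) (partial_sum u {..<N})) x" for N x
    by (simp add: partial_sum_def higher_pderiv_sum higher_pderiv_smult poly_sum sum_distrib_left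
        b_def wlegendre_def mult_ac)
  have "b k * h k = eigenvalue j k * legendre_coeff u k" for k
    by (simp add: b_def h_def)
  with rf show ?thesis
    by (simp only: S bh)
qed

text \<open>The Riesz--Fischer limit has the same coefficients as \<open>u\<close>, so it is \<open>u\<close> by completeness.\<close>
lemma legendre_expansion:
  assumes u: "u \<in> L2_I"
  shows "(\<lambda>N. LINT x|lebesgue_I. (poly (partial_sum u {..<N}) x - u x)\<^sup>2) \<longlonglongrightarrow> 0"
proof -
  have usq: "u \<in> L2 lebesgue_I" using u by (simp add: L2_I_eq)
  have "finite_energy u (eigenvalue 0)"
    using summable_energy[OF u] by (simp add: eigenvalue_0)
  from wlegendre_series[OF this] obtain g where g: "g \<in> L2 lebesgue_I"
    "(\<lambda>N. LINT x|lebesgue_I. (sqrt_weight 0 x * poly ((pderiv ^^ 0) (partial_sum u {..<N})) x - g x)\<^sup>2) \<longlonglongrightarrow> 0"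
    "\<forall>k. (LINT x|lebesgue_I. g x * wlegendre 0 k x) = eigenvalue 0 k * legendre_coeff u k"
    by (elim bexE conjE)
  have "legendre_coeff g k = legendre_coeff u k" for k
    using g(3)[rule_format, of k] by (simp add: wlegendre_0 eigenvalue_0 legendre_coeff_def[of g])
  then have "AE x in lebesgue_I. g x - u x = 0"
    using g(1) usq by (intro legendre_complete L2_diff) (simp_all add: legendre_coeff_diff L2_I_eq)
  then have AE: "AE x in lebesgue_I. g x = u x" by simp
  have "(LINT x|lebesgue_I. (poly (partial_sum u {..<N}) x - u x)\<^sup>2) =
      (LINT x|lebesgue_I. (sqrt_weight 0 x * poly ((pderiv ^^ 0) (partial_sum u {..<N})) x - g x)\<^sup>2)" for N
  proof (rule integral_cong_AE)
    show "AE x in lebesgue_I. (poly (partial_sum u {..<N}) x - u x)\<^sup>2 =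
      (sqrt_weight 0 x * poly ((pderiv ^^ 0) (partial_sum u {..<N})) x - g x)\<^sup>2"
      using AE by eventually_elim (simp add: sqrt_weight_def)
  qed (intro borel_measurable_power borel_measurable_diff borel_measurable_times sqrt_weight_measurable
       L2_measurable[OF poly_L2] L2_measurable[OF usq]
       L2_measurable[OF g(1)])+
  then show ?thesis using g(2) by simp
qed

text \<open>Away from the end points the weight is bounded below.\<close>
lemma divide_sqrt_weight_L2:
  assumes h: "h \<in> borel_measurable lebesgue_I" and ab: "-1 < a" "b < 1"
    and B: "\<And>x. \<bar>h x\<bar> \<le> B" and supp: "\<And>x. x \<notin> {a..b} \<Longrightarrow> h x = 0"
  shows "(\<lambda>x. h x / sqrt_weight j x) \<in> L2 lebesgue_I"
proof -
  have "continuous_on {a..b} (\<lambda>x. inverse (sqrt_weight j x))"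
  proof (intro continuous_intros continuous_sqrt_weight ballI)
    fix x assume "x \<in> {a..b}"
    then have "x \<in> {-1<..<1}" using ab by auto
    from sqrt_weight_pos[OF this, of j] show "sqrt_weight j x \<noteq> 0" by simp
  qed
  then have "bounded ((\<lambda>x. inverse (sqrt_weight j x)) ` {a..b})"
    by (intro compact_imp_bounded compact_continuous_image) auto
  then obtain K where K: "\<forall>x\<in>{a..b}. \<bar>inverse (sqrt_weight j x)\<bar> \<le> K"
    by (auto simp: bounded_iff)
  have B0: "0 \<le> B" using B[of 0] by (rule order_trans[OF abs_ge_zero])
  have "\<bar>h x / sqrt_weight j x\<bar> \<le> B * \<bar>K\<bar>" for x
  proof (cases "x \<in> {a..b}")
    case True
    then have "\<bar>inverse (sqrt_weight j x)\<bar> \<le> \<bar>K\<bar>" using K by fastforce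
    then show ?thesis
      using B[of x] B0 unfolding divide_inverse abs_mult by (intro mult_mono) auto
  next
    case False
    then show ?thesis using B0 supp by simp
  qed
  then show ?thesis
    by (intro L2_bounded[OF finite_measure_lebesgue_I, of _ "B * \<bar>K\<bar>"]
        borel_measurable_divide h sqrt_weight_measurable)
qed

text \<open>Both sides of the defining identity of the weak derivative of the partial sums converge: the
  partial sums by the Legendre expansion of \<open>u\<close>, their derivatives by the weighted series. The weak
  derivative of \<open>u\<close> is the weighted limit divided by the square root of the weight.\<close>
lemma weak_deriv_of_summable_energy:
  assumes u: "u \<in> L2_I" and summ: "finite_energy u (eigenvalue j)"
  obtains v where "is_weak_deriv j u v" "integrable lebesgue_I (\<lambda>x. (v x)\<^sup>2 * (1 - x\<^sup>2) ^ j)"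
    "(LINT x|lebesgue_I. (v x)\<^sup>2 * (1 - x\<^sup>2) ^ j) = energy_sum u (eigenvalue j)"
proof -
  have usq: "u \<in> L2 lebesgue_I" using u by (simp add: L2_I_eq)
  define S where "S N = partial_sum u {..<N}" for N
  define T where "T N x = sqrt_weight j x * poly ((pderiv ^^ j) (S N)) x" for N x
  obtain g where g: "g \<in> L2 lebesgue_I"
    "(\<lambda>N. LINT x|lebesgue_I. (T N x - g x)\<^sup>2) \<longlonglongrightarrow> 0"
    "(LINT x|lebesgue_I. (g x)\<^sup>2) = energy_sum u (eigenvalue j)"
    using wlegendre_series[OF summ] unfolding T_def S_def by (elim bexE conjE)
  have T: "T N \<in> L2 lebesgue_I" for N
  proof -
    have "T N = (\<lambda>x. \<Sum>l<N. (legendre_coeff u l * ((2 * real l + 1) / 2)) * wlegendre j l x)"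
      by (rule ext) (simp add: T_def S_def partial_sum_def higher_pderiv_sum higher_pderiv_smult poly_sum sum_distrib_left
          wlegendre_def mult_ac)
    then show ?thesis
      by (simp only: L2_sum L2_scale wlegendre_L2)
  qed
  \<comment> \<open>Undoes the isometric embedding by the square root of the weight.\<close>
  define v where "v x = g x / sqrt_weight j x" for x
  have loc: "locally_integrable_I v"
    unfolding locally_integrable_I_iff
  proof (intro allI impI)
    fix a b :: real assume ab: "-1 < a" "b < 1"
    have "(\<lambda>x. indicator {a..b} x / sqrt_weight j x) \<in> L2 lebesgue_I"
    proof (rule divide_sqrt_weight_L2[OF _ ab])
      show "indicator {a..b} \<in> borel_measurable lebesgue_I"
        by (rule borel_measurable_indicator) (use ab in \<open>auto simp: sets_restrict_space_iff\<close>)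
      show "\<bar>indicator {a..b} x :: real\<bar> \<le> 1" for x
        by (simp add: indicator_def)
    qed simp
    from L2_mult[OF g(1) this]
    show "integrable lebesgue_I (\<lambda>x. indicator {a..b} x * v x)"
      by (simp add: v_def mult.commute)
  qed
  have "(LINT x|lebesgue_I. u x * (deriv ^^ j) \<phi> x) = (-1) ^ j * (LINT x|lebesgue_I. v x * \<phi> x)"
    if \<phi>: "test_function_I \<phi>" for \<phi>
  proof -
    obtain a b where ab: "-1 < a" "b < 1" "\<And>k x. x \<notin> {a..b} \<Longrightarrow> (deriv ^^ k) \<phi> x = 0"
      using test_function_support[OF \<phi>] by blast
    obtain B where B: "\<And>x. \<bar>(deriv ^^ j) \<phi> x\<bar> \<le> B"
      using test_function_bounded[OF \<phi>] by blast
    obtain B0 where B0: "\<And>x. \<bar>(deriv ^^ 0) \<phi> x\<bar> \<le> B0"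
      using test_function_bounded[OF \<phi>] by blast
    have d: "(deriv ^^ j) \<phi> \<in> L2 lebesgue_I"
      by (rule L2_bounded[OF finite_measure_lebesgue_I test_function_measurable[OF \<phi>] B])
    have q: "(\<lambda>x. \<phi> x / sqrt_weight j x) \<in> L2 lebesgue_I"
      using divide_sqrt_weight_L2[of "(deriv ^^ 0) \<phi>" a b B0 j, OF test_function_measurable[OF \<phi>] ab(1,2) B0 ab(3)]
      unfolding funpow_0 .
    have lim1: "(\<lambda>N. LINT x|lebesgue_I. poly (S N) x * (deriv ^^ j) \<phi> x) \<longlonglongrightarrow> (LINT x|lebesgue_I. u x * (deriv ^^ j) \<phi> x)"
      by (rule tendsto_integral_mult_of_L2[OF poly_L2 usq d])
         (unfold S_def, rule legendre_expansion[OF u])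
    have lim2: "(\<lambda>N. LINT x|lebesgue_I. T N x * (\<phi> x / sqrt_weight j x)) \<longlonglongrightarrow> (LINT x|lebesgue_I. g x * (\<phi> x / sqrt_weight j x))"
      by (rule tendsto_integral_mult_of_L2[OF T g(1) q g(2)])
    have eq: "(LINT x|lebesgue_I. poly (S N) x * (deriv ^^ j) \<phi> x) =
        (-1) ^ j * (LINT x|lebesgue_I. T N x * (\<phi> x / sqrt_weight j x))" for N
    proof -
      have "(LINT x|lebesgue_I. T N x * (\<phi> x / sqrt_weight j x)) =
          (LINT x|lebesgue_I. poly ((pderiv ^^ j) (S N)) x * \<phi> x)"
      proof (rule integral_lebesgue_I_cong)
        fix x :: real assume "x \<in> {-1<..<1}"
        from sqrt_weight_pos[OF this, of j]
        show "T N x * (\<phi> x / sqrt_weight j x) = poly ((pderiv ^^ j) (S N)) x * \<phi> x"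
          by (simp add: T_def)
      qed
      then show ?thesis
        using is_weak_deriv_poly[of j "S N"] \<phi> unfolding is_weak_deriv_def by simp
    qed
    have "(LINT x|lebesgue_I. u x * (deriv ^^ j) \<phi> x) = (-1) ^ j * (LINT x|lebesgue_I. g x * (\<phi> x / sqrt_weight j x))"
      by (rule LIMSEQ_unique[OF lim1[unfolded eq] tendsto_mult_left[OF lim2]])
    then show ?thesis by (simp add: v_def)
  qed
  then have "is_weak_deriv j u v"
    using loc is_weak_deriv_0[OF u] unfolding is_weak_deriv_def by blast
  moreover have vg: "(v x)\<^sup>2 * (1 - x\<^sup>2) ^ j = (g x)\<^sup>2" if "x \<in> {-1<..<1}" for x
    using sqrt_weight_pos[OF that, of j] by (simp add: v_def power_divide sqrt_weight_power2[OF that, symmetric])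
  have "integrable lebesgue_I (\<lambda>x. (v x)\<^sup>2 * (1 - x\<^sup>2) ^ j) \<longleftrightarrow> integrable lebesgue_I (\<lambda>x. (g x)\<^sup>2)"
    by (intro Bochner_Integration.integrable_cong) (auto simp: vg)
  moreover have "(LINT x|lebesgue_I. (v x)\<^sup>2 * (1 - x\<^sup>2) ^ j) = (LINT x|lebesgue_I. (g x)\<^sup>2)"
    by (intro integral_lebesgue_I_cong vg)
  ultimately show ?thesis
    using g(1,3) by (intro that[of v]) (simp_all add: L2_integrable_power2)
qed

abbreviation (input) weighted_L2 :: "nat \<Rightarrow> (real \<Rightarrow> real) \<Rightarrow> bool" where
  "weighted_L2 j v \<equiv> integrable lebesgue_I (\<lambda>x. \<bar>v x\<bar>\<^sup>2 * (1 - x\<^sup>2) ^ j)"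

lemma weighted_integrable_weak_deriv_iff:
  assumes u: "u \<in> L2_I"
  shows "(\<exists>v. is_weak_deriv j u v \<and> weighted_L2 j v) \<longleftrightarrow>
           finite_energy u (eigenvalue j)"
  unfolding power2_abs
proof
  assume "\<exists>v. is_weak_deriv j u v \<and> integrable lebesgue_I (\<lambda>x. (v x)\<^sup>2 * (1 - x\<^sup>2) ^ j)"
  then show "finite_energy u (eigenvalue j)"
    using summable_energy_of_weak_deriv[OF u] by (elim exE conjE)
next
  assume "finite_energy u (eigenvalue j)"
  then obtain v where "is_weak_deriv j u v" "integrable lebesgue_I (\<lambda>x. (v x)\<^sup>2 * (1 - x\<^sup>2) ^ j)"
    by (rule weak_deriv_of_summable_energy[OF u])
  then show "\<exists>v. is_weak_deriv j u v \<and> integrable lebesgue_I (\<lambda>x. (v x)\<^sup>2 * (1 - x\<^sup>2) ^ j)"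
    by (intro exI conjI)
qed

text \<open>By uniqueness the chosen representative agrees almost everywhere with the one constructed above.\<close>
lemma weak_deriv_weighted_integral:
  assumes u: "u \<in> L2_I" and summ: "finite_energy u (eigenvalue j)"
  shows "is_weak_deriv j u (weak_deriv j u)"
    and "weighted_L2 j (weak_deriv j u)"
    and "(V_seminorm j u)\<^sup>2 = energy_sum u (eigenvalue j)"
proof -
  obtain v where v: "is_weak_deriv j u v" "integrable lebesgue_I (\<lambda>x. (v x)\<^sup>2 * (1 - x\<^sup>2) ^ j)"
    "(LINT x|lebesgue_I. (v x)\<^sup>2 * (1 - x\<^sup>2) ^ j) = energy_sum u (eigenvalue j)"
    by (rule weak_deriv_of_summable_energy[OF u summ])
  show w: "is_weak_deriv j u (weak_deriv j u)"
    by (rule is_weak_deriv_weak_deriv[OF v(1)])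
  have meas: "v \<in> borel_measurable lebesgue_I" "weak_deriv j u \<in> borel_measurable lebesgue_I"
    using v(1) w locally_integrable_I_measurable unfolding is_weak_deriv_def by blast+
  have m1: "(\<lambda>x. (v x)\<^sup>2 * (1 - x\<^sup>2) ^ j) \<in> borel_measurable lebesgue_I"
    using v(2) by (rule borel_measurable_integrable)
  have m2: "(\<lambda>x. \<bar>weak_deriv j u x\<bar>\<^sup>2 * (1 - x\<^sup>2) ^ j) \<in> borel_measurable lebesgue_I"
    by (intro borel_measurable_times borel_measurable_power borel_measurable_abs meas
        continuous_imp_borel_measurable_lebesgue_I continuous_intros)
  have AE: "AE x in lebesgue_I. (v x)\<^sup>2 * (1 - x\<^sup>2) ^ j = \<bar>weak_deriv j u x\<bar>\<^sup>2 * (1 - x\<^sup>2) ^ j"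
    using weak_deriv_unique[OF v(1) w] by eventually_elim simp
  show "weighted_L2 j (weak_deriv j u)"
    by (rule integrable_cong_AE_imp[OF v(2) m2]) (use AE in eventually_elim, simp)
  have "(V_seminorm j u)\<^sup>2 = (LINT x|lebesgue_I. \<bar>weak_deriv j u x\<bar>\<^sup>2 * (1 - x\<^sup>2) ^ j)"
    unfolding V_seminorm_def
  proof (rule real_sqrt_pow2)
    show "0 \<le> (LINT x|lebesgue_I. \<bar>weak_deriv j u x\<bar>\<^sup>2 * (1 - x\<^sup>2) ^ j)"
      using weight_pos by (intro Bochner_Integration.integral_nonneg_AE AE_I2) (simp add: less_imp_le)
  qed
  also have "\<dots> = (LINT x|lebesgue_I. (v x)\<^sup>2 * (1 - x\<^sup>2) ^ j)"
    by (rule integral_cong_AE[OF m2 m1]) (use AE in eventually_elim, rule sym)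
  finally show "(V_seminorm j u)\<^sup>2 = energy_sum u (eigenvalue j)"
    using v(3) by simp
qed

text \<open>The squared norm of order \<open>n\<close> is the energy sum with this weight.\<close>
definition V_weight :: "nat \<Rightarrow> nat \<Rightarrow> real" where
  "V_weight n l = (\<Sum>j\<le>n. eigenvalue j l)"

lemma summable_V_weight_iff:
  "finite_energy u (V_weight n) \<longleftrightarrow>
     (\<forall>j\<le>n. finite_energy u (eigenvalue j))"
proof
  assume s: "finite_energy u (V_weight n)"
  show "\<forall>j\<le>n. finite_energy u (eigenvalue j)"
  proof (intro allI impI)
    fix j assume "j \<le> n"
    show "finite_energy u (eigenvalue j)"
    proof (rule summable_comparison_test'[OF s])
      show "norm (energy u l * eigenvalue j l) \<le> energy u l * V_weight n l" for l
        using \<open>j \<le> n\<close> energy_nonneg[of u l] eigenvalue_nonneg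
        by (auto simp: abs_mult V_weight_def intro!: mult_left_mono member_le_sum)
    qed
  qed
next
  assume "\<forall>j\<le>n. finite_energy u (eigenvalue j)"
  then show "finite_energy u (V_weight n)"
    unfolding V_weight_def sum_distrib_left by (intro summable_sum) auto
qed

lemma V_ambient_iff:
  "u \<in> V_ambient n \<longleftrightarrow> u \<in> L2_I \<and> finite_energy u (V_weight n)"
  unfolding V_ambient_def summable_V_weight_iff
  using weighted_integrable_weak_deriv_iff by blast

lemma V_norm_nat_power2:
  assumes "u \<in> L2_I" "finite_energy u (V_weight n)"
  shows "(V_norm_nat n u)\<^sup>2 = energy_sum u (V_weight n)"
proof -
  have s: "finite_energy u (eigenvalue j)" if "j \<le> n" for j
    using assms(2) that unfolding summable_V_weight_iff by blast
  have "(V_norm_nat n u)\<^sup>2 = (\<Sum>j\<le>n. (V_seminorm j u)\<^sup>2)"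
    unfolding V_norm_nat_def by (intro real_sqrt_pow2 sum_nonneg) simp
  also have "\<dots> = (\<Sum>j\<le>n. \<Sum>l. energy u l * eigenvalue j l)"
    using s by (intro sum.cong) (auto simp: weak_deriv_weighted_integral(3)[OF assms(1)])
  also have "\<dots> = (\<Sum>l. \<Sum>j\<le>n. energy u l * eigenvalue j l)"
    by (rule suminf_sum[symmetric]) (use s in auto)
  finally show ?thesis
    by (simp add: V_weight_def sum_distrib_left)
qed

lemma V_norm_nat_nonneg: "0 \<le> V_norm_nat n u"
  unfolding V_norm_nat_def by (simp add: sum_nonneg)

lemma poly_in_L2_I: "poly p \<in> L2_I"
  by (simp add: L2_I_eq poly_L2)

lemma poly_in_sobolev_H: "poly p \<in> sobolev_H n"
  unfolding sobolev_H_def using poly_in_L2_I is_weak_deriv_poly by blast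

lemma L2_I_diff: "u \<in> L2_I \<Longrightarrow> v \<in> L2_I \<Longrightarrow> (\<lambda>x. u x - v x) \<in> L2_I"
  unfolding L2_I_eq by (rule L2_diff)

lemma energy_partial_sum:
  "finite F \<Longrightarrow> energy (poly (partial_sum u F)) l = (if l \<in> F then energy u l else 0)"
  by (simp add: energy_def legendre_coeff_partial_sum)

lemma energy_diff_partial_sum:
  assumes "u \<in> L2_I" "finite F"
  shows "energy (\<lambda>x. u x - poly (partial_sum u F) x) l = (if l \<in> F then 0 else energy u l)"
    and "energy (\<lambda>x. poly (partial_sum u F) x - u x) l = (if l \<in> F then 0 else energy u l)"
  using assms by (simp_all add: energy_def legendre_coeff_diff poly_in_L2_I legendre_coeff_partial_sum)

text \<open>The ambient space already equals the closure: the partial sums of the Legendre series are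
  polynomials, and their distance to \<open>u\<close> is the tail of a convergent series.\<close>
lemma V_space_nat_iff:
  "u \<in> V_space_nat n \<longleftrightarrow> u \<in> L2_I \<and> finite_energy u (V_weight n)"
proof -
  have approx: "\<exists>f. (\<forall>k. f k \<in> sobolev_H n) \<and> (\<lambda>k. V_norm_nat n (\<lambda>x. f k x - u x)) \<longlonglongrightarrow> 0"
    if u: "u \<in> L2_I" and s: "finite_energy u (V_weight n)"
  proof (intro exI conjI allI)
    let ?f = "\<lambda>k. poly (partial_sum u {..<k})"
    show "?f k \<in> sobolev_H n" for k by (rule poly_in_sobolev_H)
    have sums: "(\<lambda>l. energy (\<lambda>x. ?f k x - u x) l * V_weight n l) sums
        (energy_sum u (V_weight n) - (\<Sum>l<k. energy u l * V_weight n l))" for k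
    proof -
      have "(\<lambda>l. energy u l * V_weight n l - (if l \<in> {..<k} then energy u l * V_weight n l else 0)) sums
        (energy_sum u (V_weight n) - (\<Sum>l<k. energy u l * V_weight n l))"
        by (intro sums_diff summable_sums[OF s] sums_If_finite_set) simp
      then show ?thesis
        by (rule sums_cong[THEN iffD1, rotated]) (simp add: energy_diff_partial_sum[OF u])
    qed
    have "(V_norm_nat n (\<lambda>x. ?f k x - u x))\<^sup>2 =
        energy_sum u (V_weight n) - (\<Sum>l<k. energy u l * V_weight n l)" for k
      using V_norm_nat_power2[OF L2_I_diff[OF poly_in_L2_I u] sums_summable[OF sums]] sums_unique[OF sums] by simp
    then have "(\<lambda>k. (V_norm_nat n (\<lambda>x. ?f k x - u x))\<^sup>2) \<longlonglongrightarrow>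
        energy_sum u (V_weight n) - energy_sum u (V_weight n)"
      using summable_LIMSEQ[OF s] by (simp only:) (intro tendsto_intros)
    then have "(\<lambda>k. sqrt ((V_norm_nat n (\<lambda>x. ?f k x - u x))\<^sup>2)) \<longlonglongrightarrow> sqrt 0"
      by (intro tendsto_real_sqrt) simp
    then show "(\<lambda>k. V_norm_nat n (\<lambda>x. ?f k x - u x)) \<longlonglongrightarrow> 0"
      by (simp add: V_norm_nat_nonneg)
  qed
  show ?thesis
    unfolding V_space_nat_def mem_Collect_eq V_ambient_iff
    by (intro iffI conjI approx; elim conjE; assumption)
qed

section \<open>Growth of the weights and the K-functional\<close>

lemma summable_equivalent_weights:
  fixes e a b :: "nat \<Rightarrow> real"
  assumes e: "\<And>l. 0 \<le> e l" and a: "\<And>l. 0 \<le> a l"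
    and m: "0 < m" "\<And>l. m * a l \<le> b l" and K: "\<And>l. b l \<le> K * a l"
  shows "summable (\<lambda>l. e l * a l) \<longleftrightarrow> summable (\<lambda>l. e l * b l)"
    and "summable (\<lambda>l. e l * a l) \<Longrightarrow> m * (\<Sum>l. e l * a l) \<le> (\<Sum>l. e l * b l)"
    and "summable (\<lambda>l. e l * a l) \<Longrightarrow> (\<Sum>l. e l * b l) \<le> K * (\<Sum>l. e l * a l)"
proof -
  have b: "0 \<le> b l" for l
    using m(2)[of l] a[of l] \<open>0 < m\<close> by (meson mult_nonneg_nonneg less_imp_le order_trans)
  have lower: "m * (e l * a l) \<le> e l * b l" for l
    using mult_left_mono[OF m(2)[of l] e[of l]] by (simp only: mult.left_commute)
  have upper: "e l * b l \<le> K * (e l * a l)" for l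
    using mult_left_mono[OF K[of l] e[of l]] by (simp only: mult.left_commute)
  have ab: "summable (\<lambda>l. e l * b l)" if "summable (\<lambda>l. e l * a l)"
    by (rule summable_comparison_test'[OF summable_mult[OF that, of K]]) (use upper e b in auto)
  have ba: "summable (\<lambda>l. e l * a l)" if "summable (\<lambda>l. e l * b l)"
  proof (rule summable_comparison_test'[OF summable_mult[OF that, of "1 / m"]])
    show "norm (e l * a l) \<le> 1 / m * (e l * b l)" for l
      using lower[of l] e[of l] a[of l] m(1) by (simp add: abs_mult field_simps)
  qed
  show "summable (\<lambda>l. e l * a l) \<longleftrightarrow> summable (\<lambda>l. e l * b l)"
    using ab ba by (rule iffI)
  assume s: "summable (\<lambda>l. e l * a l)"
  show "m * (\<Sum>l. e l * a l) \<le> (\<Sum>l. e l * b l)"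
    unfolding suminf_mult[OF s, symmetric] by (intro suminf_le lower summable_mult s ab)
  show "(\<Sum>l. e l * b l) \<le> K * (\<Sum>l. e l * a l)"
    unfolding suminf_mult[OF s, symmetric] by (intro suminf_le upper summable_mult s ab)
qed

lemma eigenvalue_le: "eigenvalue j l \<le> (1 + real l) ^ (2 * j)"
proof (cases "l < j")
  case True
  then have "eigenvalue j l = 0"
    unfolding eigenvalue_def by (subst prod_zero_iff) auto
  then show ?thesis by simp
next
  case False
  have "eigenvalue j l \<le> (\<Prod>i<j. (1 + real l) ^ 2)"
    unfolding eigenvalue_def
  proof (intro prod_mono conjI)
    fix i assume "i \<in> {..<j}"
    with False have "i \<le> l" by simp
    then have "real i * (real i + 1) \<le> real l * (real l + 1)" by (intro mult_mono) auto
    then show "0 \<le> real l * (real l + 1) - real i * (real i + 1)" by simp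
    have "0 \<le> real i * (real i + 1)" by simp
    then show "real l * (real l + 1) - real i * (real i + 1) \<le> (1 + real l) ^ 2"
      by (simp add: power2_eq_square algebra_simps)
  qed
  then show ?thesis by (simp add: power_mult)
qed

text \<open>For \<open>l < n\<close> the eigenvalue vanishes, and the summand \<open>1\<close> compensates for it.\<close>
lemma power_le_eigenvalue: "(1 + real l) ^ (2 * n) \<le> (1 + real n) ^ (2 * n) * (1 + eigenvalue n l)"
proof (cases "l < n")
  case True
  then have "(1 + real l) ^ (2 * n) \<le> (1 + real n) ^ (2 * n) * 1"
    by (simp add: power_mono)
  also have "\<dots> \<le> (1 + real n) ^ (2 * n) * (1 + eigenvalue n l)"
    using eigenvalue_nonneg by (intro mult_left_mono) auto
  finally show ?thesis .
next
  case False
  have "(\<Prod>i<n. (1 + real l) ^ 2) \<le> (\<Prod>i<n. (1 + real n) * (real l * (real l + 1) - real i * (real i + 1)))"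
  proof (intro prod_mono conjI)
    fix i assume i: "i \<in> {..<n}"
    \<comment> \<open>Expanded, the next inequality says exactly this.\<close>
    have "0 \<le> (real l - real n) * real n" using False by simp
    then have "1 + real l \<le> (1 + real n) * (real l - real n + 1)"
      by (simp add: algebra_simps)
    also have "\<dots> \<le> (1 + real n) * (real l - real i)"
      using i by (intro mult_left_mono) auto
    finally have "(1 + real l) * (1 + real l) \<le> ((1 + real n) * (real l - real i)) * (real l + real i + 1)"
      using i False by (intro mult_mono) auto
    then show "(1 + real l) ^ 2 \<le> (1 + real n) * (real l * (real l + 1) - real i * (real i + 1))"
      by (simp add: power2_eq_square algebra_simps)
  qed simp
  then have "(1 + real l) ^ (2 * n) \<le> (1 + real n) ^ n * eigenvalue n l"
    by (simp add: eigenvalue_def prod.distrib power_mult)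
  also have "\<dots> \<le> (1 + real n) ^ (2 * n) * (1 + eigenvalue n l)"
    using eigenvalue_nonneg by (intro mult_mono power_increasing) auto
  finally show ?thesis .
qed

lemma V_weight_le: "V_weight n l \<le> (real n + 1) * (1 + real l) ^ (2 * n)"
proof -
  have "V_weight n l \<le> (\<Sum>j\<le>n. (1 + real l) ^ (2 * n))"
    unfolding V_weight_def
    by (intro sum_mono order_trans[OF eigenvalue_le] power_increasing) auto
  then show ?thesis by (simp add: add.commute)
qed

definition V_weight_const :: "nat \<Rightarrow> real" where
  "V_weight_const n = 1 / (2 * (1 + real n) ^ (2 * n))"

lemma V_weight_const_pos: "0 < V_weight_const n"
  by (simp add: V_weight_const_def)

lemma V_weight_ge: "V_weight_const n * (1 + real l) ^ (2 * n) \<le> V_weight n l"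
proof -
  have "eigenvalue j l \<le> V_weight n l" if "j \<le> n" for j
    unfolding V_weight_def using that eigenvalue_nonneg by (intro member_le_sum) auto
  from this[of 0] this[of n] have "1 + eigenvalue n l \<le> 2 * V_weight n l"
    by (simp add: eigenvalue_0)
  then have "(1 + real n) ^ (2 * n) * (1 + eigenvalue n l) \<le> (1 + real n) ^ (2 * n) * (2 * V_weight n l)"
    by (rule mult_left_mono) simp
  then have "(1 + real l) ^ (2 * n) \<le> (1 + real n) ^ (2 * n) * (2 * V_weight n l)"
    using power_le_eigenvalue order_trans by blast
  moreover have "(1 + real n) ^ (2 * n) > 0" by simp
  ultimately show ?thesis
    by (simp add: V_weight_const_def field_simps)
qed

lemma V_space_nat_iff_power:
  "u \<in> V_space_nat n \<longleftrightarrow> u \<in> L2_I \<and> finite_energy u (bracket_power n)"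
  unfolding V_space_nat_iff
  using summable_equivalent_weights(1)[OF energy_nonneg[of u] _ V_weight_const_pos V_weight_ge[of n] V_weight_le[of n]]
  by simp

lemma V_norm_nat_power2_bounds:
  assumes "u \<in> V_space_nat n"
  shows "V_weight_const n * energy_sum u (bracket_power n) \<le> (V_norm_nat n u)\<^sup>2"
    and "(V_norm_nat n u)\<^sup>2 \<le> (real n + 1) * energy_sum u (bracket_power n)"
proof -
  have "finite_energy u (bracket_power n)"
    using assms by (simp only: V_space_nat_iff_power)
  note * = summable_equivalent_weights(2,3)[OF energy_nonneg _ V_weight_const_pos V_weight_ge V_weight_le this]
  have **: "(V_norm_nat n u)\<^sup>2 = energy_sum u (V_weight n)"
    using assms unfolding V_space_nat_iff by (intro V_norm_nat_power2) simp_all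
  show "V_weight_const n * energy_sum u (bracket_power n) \<le> (V_norm_nat n u)\<^sup>2"
    "(V_norm_nat n u)\<^sup>2 \<le> (real n + 1) * energy_sum u (bracket_power n)"
    unfolding ** by (rule *; simp)+
qed

text \<open>For \<open>l = 0\<close> the power of \<open>l\<close> vanishes unless \<open>\<eta> = 0\<close>, and \<open>(1 + l) powr (2 * \<eta>)\<close> is bounded by the
  constant term; for larger \<open>l\<close> it is bounded by \<open>(2 * l) powr (2 * \<eta>)\<close>.\<close>
lemma legendre_weight_bounds:
  assumes "0 \<le> \<eta>"
  shows "legendre_weight \<eta> l \<le> 2 * (1 + real l) powr (2 * \<eta>)"
    and "(1 + real l) powr (2 * \<eta>) \<le> 2 powr (2 * \<eta>) * legendre_weight \<eta> l"
proof -
  have ge1: "1 \<le> (1 + real l) powr (2 * \<eta>)" using assms by (intro ge_one_powr_ge_zero) auto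
  have "real l powr (2 * \<eta>) \<le> (1 + real l) powr (2 * \<eta>)" using assms by (intro powr_mono2) auto
  with ge1 show "legendre_weight \<eta> l \<le> 2 * (1 + real l) powr (2 * \<eta>)"
    by (auto simp: legendre_weight_def)
  have two: "1 \<le> (2::real) powr (2 * \<eta>)" using assms by (intro ge_one_powr_ge_zero) auto
  show "(1 + real l) powr (2 * \<eta>) \<le> 2 powr (2 * \<eta>) * legendre_weight \<eta> l"
  proof (cases "l = 0")
    case True
    then show ?thesis using two by (auto simp: legendre_weight_def)
  next
    case False
    have "(1 + real l) powr (2 * \<eta>) \<le> (2 * real l) powr (2 * \<eta>)"
      using False assms by (intro powr_mono2) auto
    also have "\<dots> = 2 powr (2 * \<eta>) * real l powr (2 * \<eta>)" by (simp add: powr_mult)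
    also have "\<dots> \<le> 2 powr (2 * \<eta>) * legendre_weight \<eta> l"
      by (intro mult_left_mono) (auto simp: legendre_weight_def False)
    finally show ?thesis .
  qed
qed

text \<open>The smaller of \<open>(1 + l) ^ (2 * n)\<close> and \<open>t\<^sup>2 * (1 + l) ^ (2 * Suc n)\<close>: the cost of assigning the
  frequency \<open>l\<close> to the cheaper part of a decomposition.\<close>
definition K_weight :: "nat \<Rightarrow> real \<Rightarrow> nat \<Rightarrow> real" where
  "K_weight n t l = (1 + real l) ^ (2 * n) * min 1 (t\<^sup>2 * (1 + real l)\<^sup>2)"

lemma K_weight_nonneg: "0 \<le> K_weight n t l"
  by (simp add: K_weight_def)

lemma K_weight_le: "K_weight n t l \<le> (1 + real l) ^ (2 * n)"
  "K_weight n t l \<le> t\<^sup>2 * (1 + real l) ^ (2 * Suc n)"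
proof -
  show "K_weight n t l \<le> (1 + real l) ^ (2 * n)"
    unfolding K_weight_def by (rule mult_left_le) auto
  have "K_weight n t l \<le> (1 + real l) ^ (2 * n) * (t\<^sup>2 * (1 + real l)\<^sup>2)"
    unfolding K_weight_def by (intro mult_left_mono) auto
  then show "K_weight n t l \<le> t\<^sup>2 * (1 + real l) ^ (2 * Suc n)"
    by (simp add: power_add power2_eq_square mult_ac)
qed

lemma summable_K_weight:
  assumes "u \<in> V_space_nat n" shows "finite_energy u (K_weight n t)"
proof (rule summable_comparison_test')
  show "finite_energy u (bracket_power n)"
    using assms by (simp only: V_space_nat_iff_power)
  show "norm (energy u l * K_weight n t l) \<le> energy u l * (1 + real l) ^ (2 * n)" for l
    using K_weight_le(1) K_weight_nonneg energy_nonneg by (simp add: abs_mult mult_left_mono)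
qed

definition K_set :: "nat \<Rightarrow> real \<Rightarrow> (real \<Rightarrow> real) \<Rightarrow> real set" where
  "K_set n t u = {V_norm_nat n v + t * V_norm_nat (Suc n) w | v w.
     v \<in> V_space_nat n \<and> w \<in> V_space_nat (Suc n) \<and> (AE x in lebesgue_I. u x = v x + w x)}"

lemma V_K_functional_eq: "V_K_functional n t u = Inf (K_set n t u)"
  by (simp add: V_K_functional_def K_set_def)

lemma partial_sum_in_V_space:
  assumes "finite F" shows "poly (partial_sum u F) \<in> V_space_nat n"
  unfolding V_space_nat_iff_power using assms
  by (auto simp: energy_partial_sum poly_in_L2_I intro!: summable_finite[of F])

lemma V_space_nat_subset_L2_I: "u \<in> V_space_nat n \<Longrightarrow> u \<in> L2_I"
  by (simp add: V_space_nat_iff)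

lemma diff_partial_sum_in_V_space:
  assumes u: "u \<in> V_space_nat n" and F: "finite F"
  shows "(\<lambda>x. u x - poly (partial_sum u F) x) \<in> V_space_nat n"
  unfolding V_space_nat_iff_power
proof (intro conjI L2_I_diff poly_in_L2_I V_space_nat_subset_L2_I[OF u])
  have s: "finite_energy u (bracket_power n)"
    using u by (simp only: V_space_nat_iff_power)
  show "summable (\<lambda>l. energy (\<lambda>x. u x - poly (partial_sum u F) x) l * (1 + real l) ^ (2 * n))"
    by (rule summable_comparison_test'[OF s])
       (auto simp: energy_diff_partial_sum[OF V_space_nat_subset_L2_I[OF u] F] energy_nonneg)
qed

lemma K_set_nonneg:
  assumes "0 \<le> t" "x \<in> K_set n t u" shows "0 \<le> x"
  using assms V_norm_nat_nonneg unfolding K_set_def by auto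

lemma K_set_nonempty:
  assumes "u \<in> V_space_nat n" shows "K_set n t u \<noteq> {}"
proof -
  have "V_norm_nat n u + t * V_norm_nat (Suc n) (poly (partial_sum u {})) \<in> K_set n t u"
    unfolding K_set_def mem_Collect_eq
    using assms partial_sum_in_V_space[OF finite.emptyI, of u "Suc n"]
    by (intro exI[of _ u] exI[of _ "poly (partial_sum u {})"]) (simp add: partial_sum_def)
  then show ?thesis by blast
qed

lemma K_set_bdd_below: "0 \<le> t \<Longrightarrow> bdd_below (K_set n t u)"
  using K_set_nonneg by (intro bdd_belowI[of _ 0])

lemma V_K_functional_nonneg: "u \<in> V_space_nat n \<Longrightarrow> 0 \<le> t \<Longrightarrow> 0 \<le> V_K_functional n t u"
  unfolding V_K_functional_eq using K_set_nonneg K_set_nonempty by (intro cInf_greatest) blast+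

lemma V_K_functional_mono:
  assumes u: "u \<in> V_space_nat n" and t: "0 \<le> s" "s \<le> t"
  shows "V_K_functional n s u \<le> V_K_functional n t u"
  unfolding V_K_functional_eq
proof (rule cInf_mono[OF K_set_nonempty[OF u] K_set_bdd_below[OF t(1)]])
  fix b assume "b \<in> K_set n t u"
  then obtain v w where vw: "b = V_norm_nat n v + t * V_norm_nat (Suc n) w" "v \<in> V_space_nat n" "w \<in> V_space_nat (Suc n)"
     "AE x in lebesgue_I. u x = v x + w x" unfolding K_set_def by blast
  have "V_norm_nat n v + s * V_norm_nat (Suc n) w \<in> K_set n s u"
    unfolding K_set_def using vw by blast
  moreover have "V_norm_nat n v + s * V_norm_nat (Suc n) w \<le> b"
    unfolding vw using t V_norm_nat_nonneg by (intro add_left_mono mult_right_mono)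
  ultimately show "\<exists>a\<in>K_set n s u. a \<le> b" by blast
qed

lemma energy_add_le:
  assumes v: "v \<in> L2_I" and w: "w \<in> L2_I" and u: "u \<in> L2_I" and AE: "AE x in lebesgue_I. u x = v x + w x"
  shows "energy u l \<le> 2 * energy v l + 2 * energy w l"
proof -
  have "legendre_coeff u l = legendre_coeff (\<lambda>x. v x + w x) l"
    using u v w by (intro legendre_coeff_cong_AE[OF AE] borel_measurable_add) (simp_all add: L2_I_def)
  then have c: "legendre_coeff u l = legendre_coeff v l + legendre_coeff w l"
    by (simp add: legendre_coeff_add[OF v w])
  have "0 \<le> (legendre_coeff v l - legendre_coeff w l)\<^sup>2" by simp
  then have "(legendre_coeff u l)\<^sup>2 \<le> 2 * (legendre_coeff v l)\<^sup>2 + 2 * (legendre_coeff w l)\<^sup>2"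
    unfolding c by (simp add: power2_sum power2_diff)
  then have "(legendre_coeff u l)\<^sup>2 * ((2 * real l + 1) / 2) \<le>
      (2 * (legendre_coeff v l)\<^sup>2 + 2 * (legendre_coeff w l)\<^sup>2) * ((2 * real l + 1) / 2)"
    by (rule mult_right_mono) simp
  then show ?thesis
    unfolding energy_def by (simp only: distrib_right mult.assoc)
qed

definition K_lower_const :: "nat \<Rightarrow> real" where
  "K_lower_const n = min (V_weight_const n) (V_weight_const (Suc n)) / 2"

lemma K_lower_const_pos: "0 < K_lower_const n"
  using V_weight_const_pos by (simp add: K_lower_const_def)

text \<open>In every decomposition, each coefficient of \<open>u\<close> is the sum of the coefficients of the two parts,
  and either part pays at least the cheaper price for its share.\<close>
lemma V_K_functional_lower:
  assumes u: "u \<in> V_space_nat n" and t: "0 < t"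
  shows "K_lower_const n * energy_sum u (K_weight n t) \<le> (V_K_functional n t u)\<^sup>2"
proof -
  define Q where "Q = energy_sum u (K_weight n t)"
  have Q0: "0 \<le> Q"
    unfolding Q_def by (intro suminf_nonneg summable_K_weight u mult_nonneg_nonneg energy_nonneg K_weight_nonneg)
  have "sqrt (K_lower_const n * Q) \<le> x" if xK: "x \<in> K_set n t u" for x
  proof -
    obtain v w where vw: "x = V_norm_nat n v + t * V_norm_nat (Suc n) w" "v \<in> V_space_nat n" "w \<in> V_space_nat (Suc n)"
       "AE x in lebesgue_I. u x = v x + w x" using xK unfolding K_set_def by blast
    define X Y where "X = V_norm_nat n v" and "Y = V_norm_nat (Suc n) w"
    define sumX where "sumX = energy_sum v (bracket_power n)"
    define sumY where "sumY = energy_sum w (bracket_power (Suc n))"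
    have sX: "finite_energy v (bracket_power n)"
      using vw(2) by (simp only: V_space_nat_iff_power)
    have sY: "finite_energy w (bracket_power (Suc n))"
      using vw(3) by (simp only: V_space_nat_iff_power)
    have sum0: "0 \<le> sumX" "0 \<le> sumY"
      unfolding sumX_def sumY_def by (intro suminf_nonneg sX sY mult_nonneg_nonneg energy_nonneg; simp)+
    have "Q \<le> (\<Sum>l. 2 * (energy v l * (1 + real l) ^ (2 * n)) + (2 * t\<^sup>2) * (energy w l * (1 + real l) ^ (2 * Suc n)))"
      unfolding Q_def
    proof (intro suminf_le summable_K_weight u summable_add summable_mult sX sY)
      fix l
      have "energy u l * K_weight n t l \<le> (2 * energy v l + 2 * energy w l) * K_weight n t l"
        using energy_add_le[OF _ _ _ vw(4)] V_space_nat_subset_L2_I u vw(2,3)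
        by (intro mult_right_mono K_weight_nonneg) blast
      also have "\<dots> = 2 * (energy v l * K_weight n t l) + 2 * (energy w l * K_weight n t l)"
        by (simp add: algebra_simps)
      also have "\<dots> \<le> 2 * (energy v l * (1 + real l) ^ (2 * n)) + 2 * (energy w l * (t\<^sup>2 * (1 + real l) ^ (2 * Suc n)))"
        by (intro add_mono mult_left_mono K_weight_le energy_nonneg) auto
      finally show "energy u l * K_weight n t l \<le> 2 * (energy v l * (1 + real l) ^ (2 * n)) + (2 * t\<^sup>2) * (energy w l * (1 + real l) ^ (2 * Suc n))"
        by (simp only: mult.assoc mult.left_commute)
    qed
    also have "\<dots> = 2 * sumX + (2 * t\<^sup>2) * sumY"
      unfolding sumX_def sumY_def
      by (simp only: suminf_add[symmetric] suminf_mult summable_mult sX sY)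
    finally have "K_lower_const n * Q \<le> K_lower_const n * (2 * sumX + (2 * t\<^sup>2) * sumY)"
      using K_lower_const_pos[of n] by (intro mult_left_mono) auto
    also have "\<dots> = (2 * K_lower_const n) * sumX + t\<^sup>2 * ((2 * K_lower_const n) * sumY)"
      by (simp add: algebra_simps)
    also have "\<dots> \<le> V_weight_const n * sumX + t\<^sup>2 * (V_weight_const (Suc n) * sumY)"
      using sum0 by (intro add_mono mult_left_mono mult_right_mono) (auto simp: K_lower_const_def)
    also have "\<dots> \<le> X\<^sup>2 + t\<^sup>2 * Y\<^sup>2"
      unfolding sumX_def sumY_def X_def Y_def
      by (intro add_mono mult_left_mono V_norm_nat_power2_bounds vw) auto
    also have "\<dots> \<le> (X + t * Y)\<^sup>2"
      using t V_norm_nat_nonneg by (simp add: power2_sum power_mult_distrib X_def Y_def)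
    finally have "sqrt (K_lower_const n * Q) \<le> sqrt ((X + t * Y)\<^sup>2)"
      by (rule real_sqrt_le_mono)
    then have "sqrt (K_lower_const n * Q) \<le> \<bar>X + t * Y\<bar>"
      by (simp only: real_sqrt_abs)
    then show ?thesis
      using K_set_nonneg[OF _ xK] t by (simp add: vw(1) X_def Y_def)
  qed
  then have "sqrt (K_lower_const n * Q) \<le> V_K_functional n t u"
    unfolding V_K_functional_eq by (intro cInf_greatest K_set_nonempty u)
  then have "(sqrt (K_lower_const n * Q))\<^sup>2 \<le> (V_K_functional n t u)\<^sup>2"
    using Q0 K_lower_const_pos[of n] by (intro power_mono) auto
  then show ?thesis
    using Q0 K_lower_const_pos[of n] by (simp add: Q_def)
qed

text \<open>Assign the low frequencies \<open>t * (1 + l) \<le> 1\<close> to the smoother space. They are finite in number, so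
  this part is a polynomial.\<close>
lemma V_K_functional_upper:
  assumes u: "u \<in> V_space_nat n" and t: "0 < t"
  shows "(V_K_functional n t u)\<^sup>2 \<le> 2 * (real n + 2) * energy_sum u (K_weight n t)"
proof -
  \<comment> \<open>The low frequencies, for which the smoother space is the cheaper one.\<close>
  define F where "F = {l. t * (1 + real l) \<le> 1}"
  have "F \<subseteq> {.. nat \<lceil>1 / t\<rceil>}"
  proof
    fix l assume "l \<in> F"
    then have "real l \<le> 1 / t" using t by (simp add: F_def field_simps)
    also have "\<dots> \<le> real (nat \<lceil>1 / t\<rceil>)" by (rule real_nat_ceiling_ge)
    finally show "l \<in> {.. nat \<lceil>1 / t\<rceil>}" by simp
  qed
  then have F: "finite F" by (rule finite_subset) simp
  define w where "w = poly (partial_sum u F)"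
  define v where "v x = u x - w x" for x
  have v: "v \<in> V_space_nat n"
    unfolding v_def[abs_def] w_def by (rule diff_partial_sum_in_V_space[OF u F])
  have w: "w \<in> V_space_nat (Suc n)"
    unfolding w_def by (rule partial_sum_in_V_space[OF F])
  have uL: "u \<in> L2_I" by (rule V_space_nat_subset_L2_I[OF u])
  have ev: "energy v l = (if l \<in> F then 0 else energy u l)" for l
    unfolding v_def[abs_def] w_def by (rule energy_diff_partial_sum[OF uL F])
  have ew: "energy w l = (if l \<in> F then energy u l else 0)" for l
    unfolding w_def by (rule energy_partial_sum[OF F])
  have KF: "K_weight n t l = t\<^sup>2 * (1 + real l) ^ (2 * Suc n)" if "l \<in> F" for l
  proof -
    have "(t * (1 + real l))\<^sup>2 \<le> 1"
      using that t unfolding F_def by (intro power_le_one) auto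
    then have "min 1 (t\<^sup>2 * (1 + real l)\<^sup>2) = t\<^sup>2 * (1 + real l)\<^sup>2"
      by (simp add: power_mult_distrib)
    then show ?thesis
      unfolding K_weight_def by (simp add: power_add power2_eq_square mult_ac)
  qed
  have KF': "K_weight n t l = (1 + real l) ^ (2 * n)" if "l \<notin> F" for l
  proof -
    have "1 \<le> (t * (1 + real l))\<^sup>2"
      using that t unfolding F_def by (intro one_le_power) auto
    then show ?thesis
      unfolding K_weight_def by (simp add: power_mult_distrib)
  qed
  define X Y where "X = V_norm_nat n v" and "Y = V_norm_nat (Suc n) w"
  have sX: "finite_energy v (bracket_power n)"
    using v by (simp only: V_space_nat_iff_power)
  have sY: "finite_energy w (bracket_power (Suc n))"
    using w by (simp only: V_space_nat_iff_power)
  define sumX where "sumX = energy_sum v (bracket_power n)"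
  define sumY where "sumY = energy_sum w (bracket_power (Suc n))"
  have sum0: "0 \<le> sumX"
    unfolding sumX_def by (intro suminf_nonneg sX mult_nonneg_nonneg energy_nonneg) simp
  have "(X + t * Y)\<^sup>2 \<le> 2 * (X\<^sup>2 + t\<^sup>2 * Y\<^sup>2)"
    using sum_squares_ge_zero[of "X - t * Y" 0] by (simp add: power2_eq_square algebra_simps)
  also have "\<dots> \<le> 2 * ((real n + 1) * sumX + t\<^sup>2 * ((real (Suc n) + 1) * sumY))"
    unfolding sumX_def sumY_def X_def Y_def
    by (intro add_mono mult_left_mono V_norm_nat_power2_bounds v w) auto
  also have "\<dots> \<le> 2 * ((real n + 2) * sumX + t\<^sup>2 * ((real n + 2) * sumY))"
    using sum0 by (simp add: mult_right_mono add_ac)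
  also have "\<dots> = 2 * (real n + 2) * (sumX + t\<^sup>2 * sumY)"
    by (simp add: algebra_simps)
  also have "sumX + t\<^sup>2 * sumY = (\<Sum>l. energy v l * (1 + real l) ^ (2 * n) + t\<^sup>2 * (energy w l * (1 + real l) ^ (2 * Suc n)))"
    unfolding sumX_def sumY_def by (simp only: suminf_add[symmetric] suminf_mult summable_mult sX sY)
  also have "\<dots> = energy_sum u (K_weight n t)"
    by (intro suminf_cong) (simp add: ev ew KF KF')
  finally have bound: "(X + t * Y)\<^sup>2 \<le> 2 * (real n + 2) * energy_sum u (K_weight n t)" .
  have "X + t * Y \<in> K_set n t u"
    unfolding K_set_def X_def Y_def using v w by (auto simp: v_def intro!: exI)
  then have "V_K_functional n t u \<le> X + t * Y"
    unfolding V_K_functional_eq using t by (intro cInf_lower K_set_bdd_below) auto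
  then have "(V_K_functional n t u)\<^sup>2 \<le> (X + t * Y)\<^sup>2"
    using V_K_functional_nonneg[OF u] t by (intro power_mono) auto
  with bound show ?thesis by linarith
qed

text \<open>Up to scaling by \<open>\<kappa>\<close>, the sum of the integral of \<open>t powr (1 - 2 * \<theta>)\<close> over \<open>[0, 1]\<close> and that of
  \<open>t powr (- 2 * \<theta> - 1)\<close> over \<open>[1, \<infinity>)\<close>. Both converge because \<open>\<theta>\<close> is strictly between 0 and 1.\<close>
lemma nn_integral_interpolation_kernel:
  fixes \<kappa> \<theta> :: real
  assumes \<kappa>: "0 < \<kappa>" and \<theta>: "0 < \<theta>" "\<theta> < 1"
  shows "(\<integral>\<^sup>+t. ennreal (t powr (- 2 * \<theta>) * min 1 (t\<^sup>2 * \<kappa>\<^sup>2) / t) \<partial>lebesgue_on {0<..}) =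
           ennreal (\<kappa> powr (2 * \<theta>) * (1 / (2 - 2 * \<theta>) + 1 / (2 * \<theta>)))"
proof -
  define f where "f t = t powr (- 2 * \<theta>) * min 1 (t\<^sup>2 * \<kappa>\<^sup>2) / t" for t
  have small: "f t = \<kappa>\<^sup>2 * t powr (1 - 2 * \<theta>)" if "t \<in> {0..1/\<kappa>}" for t
  proof (cases "t = 0")
    case False
    with that have t: "t > 0" by simp
    have "(t * \<kappa>)\<^sup>2 \<le> 1"
      using that \<kappa> t by (intro power_le_one) (auto simp: field_simps)
    then have "f t = t powr (- 2 * \<theta>) * (t powr 2 * \<kappa>\<^sup>2) / t powr 1"
      using t by (simp add: f_def power_mult_distrib powr_numeral)
    also have "\<dots> = \<kappa>\<^sup>2 * t powr (- 2 * \<theta> + 2 - 1)"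
      by (simp only: powr_add powr_diff) simp
    finally show ?thesis by simp
  qed (simp add: f_def)
  have large: "f t = t powr (- 2 * \<theta> - 1)" if "t \<in> {1/\<kappa>..}" for t
  proof -
    have t: "t > 0" using that \<kappa> by (auto intro: less_le_trans[of 0 "1 / \<kappa>"])
    have "1 \<le> (t * \<kappa>)\<^sup>2"
      using that \<kappa> t by (intro one_le_power) (auto simp: field_simps)
    then have "f t = t powr (- 2 * \<theta>) / t powr 1"
      using t by (simp add: f_def power_mult_distrib)
    then show ?thesis by (simp only: powr_diff)
  qed
  have "((\<lambda>t. \<kappa>\<^sup>2 * t powr (1 - 2 * \<theta>)) has_integral \<kappa>\<^sup>2 * ((1/\<kappa>) powr (1 - 2 * \<theta> + 1) / (1 - 2 * \<theta> + 1))) {0..1/\<kappa>}"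
    using \<kappa> \<theta> by (intro has_integral_mult_right has_integral_powr_from_0) auto
  then have 1: "(f has_integral \<kappa>\<^sup>2 * ((1/\<kappa>) powr (1 - 2 * \<theta> + 1) / (1 - 2 * \<theta> + 1))) {0..1/\<kappa>}"
    by (rule has_integral_eq[rotated]) (simp only: small)
  have "((\<lambda>t. t powr (- 2 * \<theta> - 1)) has_integral - ((1/\<kappa>) powr (- 2 * \<theta> - 1 + 1)) / (- 2 * \<theta> - 1 + 1)) {1/\<kappa>..}"
    using \<kappa> \<theta> by (intro has_integral_powr_to_inf) auto
  then have 2: "(f has_integral - ((1/\<kappa>) powr (- 2 * \<theta> - 1 + 1)) / (- 2 * \<theta> - 1 + 1)) {1/\<kappa>..}"
    by (rule has_integral_eq[rotated]) (simp only: large)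
  have Un: "{0..1/\<kappa>} \<union> {1/\<kappa>..} = {0..}" and Int: "{0..1/\<kappa>} \<inter> {1/\<kappa>..} = {1/\<kappa>}"
    using \<kappa> by (auto intro: order_trans[of 0 "1 / \<kappa>"])
  have inv: "(1/\<kappa>) powr a = \<kappa> powr (- a)" for a
    using \<kappa> by (simp add: powr_divide powr_minus_divide)
  have eq1: "\<kappa>\<^sup>2 * ((1/\<kappa>) powr (1 - 2 * \<theta> + 1) / (1 - 2 * \<theta> + 1)) = \<kappa> powr (2 * \<theta>) / (2 - 2 * \<theta>)"
  proof -
    have "\<kappa>\<^sup>2 * (1/\<kappa>) powr (1 - 2 * \<theta> + 1) = \<kappa> powr 2 * \<kappa> powr (- (1 - 2 * \<theta> + 1))"
      using \<kappa> unfolding inv by (simp add: powr_numeral)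
    also have "\<dots> = \<kappa> powr (2 * \<theta>)" by (simp only: powr_add[symmetric]) simp
    finally have "\<kappa>\<^sup>2 * (1/\<kappa>) powr (1 - 2 * \<theta> + 1) = \<kappa> powr (2 * \<theta>)" .
    moreover have "1 - 2 * \<theta> + 1 = 2 - 2 * \<theta>" by simp
    ultimately show ?thesis by (simp only: times_divide_eq_right)
  qed
  have eq2: "- ((1/\<kappa>) powr (- 2 * \<theta> - 1 + 1)) / (- 2 * \<theta> - 1 + 1) = \<kappa> powr (2 * \<theta>) / (2 * \<theta>)"
    unfolding inv by simp
  have "(f has_integral (\<kappa>\<^sup>2 * ((1/\<kappa>) powr (1 - 2 * \<theta> + 1) / (1 - 2 * \<theta> + 1)) +
      - ((1/\<kappa>) powr (- 2 * \<theta> - 1 + 1)) / (- 2 * \<theta> - 1 + 1))) {0..}"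
    using has_integral_Un[OF 1 2] unfolding Un Int by simp
  then have "(f has_integral (\<kappa> powr (2 * \<theta>) / (2 - 2 * \<theta>) + \<kappa> powr (2 * \<theta>) / (2 * \<theta>))) {0..}"
    unfolding eq1 eq2 .
  then have "(f has_integral (\<kappa> powr (2 * \<theta>) / (2 - 2 * \<theta>) + \<kappa> powr (2 * \<theta>) / (2 * \<theta>))) {0<..}"
  proof (subst has_integral_spike_set_eq)
    show "negligible {t \<in> {0<..} - {0..}. f t \<noteq> 0}" "negligible {t \<in> {0..} - {0<..}. f t \<noteq> 0}"
      by (rule negligible_subset[OF negligible_sing[of 0]], force)+
  qed
  then have "(\<integral>\<^sup>+t. ennreal (f t) * indicator {0<..} t \<partial>lborel) =
      ennreal (\<kappa> powr (2 * \<theta>) / (2 - 2 * \<theta>) + \<kappa> powr (2 * \<theta>) / (2 * \<theta>))"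
    by (rule nn_integral_has_integral_lebesgue'[rotated]) (simp add: f_def)
  then show ?thesis
    by (subst nn_integral_restrict_space) (simp_all add: nn_integral_completion f_def distrib_left)
qed

section \<open>Interpolation spaces\<close>

text \<open>The K-functional is monotone in \<open>t\<close>.\<close>
lemma V_K_functional_measurable:
  assumes u: "u \<in> V_space_nat n"
  shows "(\<lambda>t. V_K_functional n t u) \<in> borel_measurable (lebesgue_on {0<..})"
proof -
  \<comment> \<open>Extended by a constant to the left, so that monotonicity holds on the whole line.\<close>
  define g where "g t = V_K_functional n (max t 0) u" for t
  have "mono g"
    unfolding g_def by (intro monoI V_K_functional_mono u) auto
  then have "g \<in> borel_measurable borel" by (rule borel_measurable_mono)
  then have "g \<in> borel_measurable (lebesgue_on {0<..})"
    by (intro measurable_restrict_space1 measurable_completion) simp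
  moreover have "g t = V_K_functional n t u" if "t \<in> space (lebesgue_on {0<..})" for t
    using that by (simp add: g_def)
  ultimately show ?thesis
    by (subst measurable_cong[where g = g]) simp_all
qed

lemma V_interp_integrand_measurable:
  assumes u: "u \<in> V_space_nat n"
  shows "V_interp_integrand n \<theta> u \<in> borel_measurable (lebesgue_on {0<..})"
proof -
  have "(\<lambda>t. t powr (- 2 * \<theta>)) \<in> borel_measurable borel" by measurable
  then have 1: "(\<lambda>t. t powr (- 2 * \<theta>)) \<in> borel_measurable (lebesgue_on {0<..})"
    by (intro measurable_restrict_space1 measurable_completion) simp
  have "(\<lambda>t::real. t) \<in> borel_measurable borel" by measurable
  then have 2: "(\<lambda>t::real. t) \<in> borel_measurable (lebesgue_on {0<..})"
    by (intro measurable_restrict_space1 measurable_completion) simp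
  show ?thesis
    unfolding V_interp_integrand_def[abs_def]
    by (intro borel_measurable_divide borel_measurable_times 1 2 borel_measurable_power borel_measurable_abs
        V_K_functional_measurable u)
qed

text \<open>The value at \<open>\<kappa> = 1\<close> of the preceding integral.\<close>
definition interp_const :: "real \<Rightarrow> real" where
  "interp_const \<theta> = 1 / (2 - 2 * \<theta>) + 1 / (2 * \<theta>)"

lemma interp_const_pos: "0 < \<theta> \<Longrightarrow> \<theta> < 1 \<Longrightarrow> 0 < interp_const \<theta>"
  by (simp add: interp_const_def add_pos_pos)

text \<open>Tonelli's theorem: each frequency contributes the integral of its own kernel.\<close>
lemma nn_integral_K_weight_series:
  assumes u: "u \<in> V_space_nat n" and \<theta>: "0 < \<theta>" "\<theta> < 1"
  shows "(\<integral>\<^sup>+t. ennreal (t powr (- 2 * \<theta>) / t * energy_sum u (K_weight n t)) \<partial>lebesgue_on {0<..}) =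
    (\<Sum>l. ennreal (interp_const \<theta> * (energy u l * (1 + real l) powr (2 * (real n + \<theta>)))))"
proof -
  define p where "p l t = t powr (- 2 * \<theta>) * min 1 (t\<^sup>2 * (1 + real l)\<^sup>2) / t" for l t
  have p_meas: "p l \<in> borel_measurable (lebesgue_on {0<..})" for l
  proof -
    have "p l \<in> borel_measurable borel" unfolding p_def[abs_def] by measurable
    then show ?thesis
      by (intro measurable_restrict_space1 measurable_completion) simp
  qed
  define a where "a l = energy u l * (1 + real l) ^ (2 * n)" for l
  have a: "0 \<le> a l" for l by (simp add: a_def energy_nonneg)
  have term_eq: "t powr (- 2 * \<theta>) / t * (energy u l * K_weight n t l) = a l * p l t" for l t
    by (simp add: a_def p_def K_weight_def)
  have "(\<integral>\<^sup>+t. ennreal (t powr (- 2 * \<theta>) / t * energy_sum u (K_weight n t)) \<partial>lebesgue_on {0<..}) =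
      (\<integral>\<^sup>+t. (\<Sum>l. ennreal (a l) * ennreal (p l t)) \<partial>lebesgue_on {0<..})"
  proof (rule nn_integral_cong)
    fix t :: real assume "t \<in> space (lebesgue_on {0<..})"
    then have t: "0 < t" by simp
    have s: "finite_energy u (K_weight n t)" by (rule summable_K_weight[OF u])
    have nn: "0 \<le> p l t" for l using t by (simp add: p_def)
    have "t powr (- 2 * \<theta>) / t * energy_sum u (K_weight n t) = (\<Sum>l. a l * p l t)"
      unfolding term_eq[symmetric] by (rule suminf_mult[OF s, symmetric])
    moreover have "summable (\<lambda>l. a l * p l t)"
      unfolding term_eq[symmetric] by (rule summable_mult[OF s])
    ultimately show "ennreal (t powr (- 2 * \<theta>) / t * energy_sum u (K_weight n t)) = (\<Sum>l. ennreal (a l) * ennreal (p l t))"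
      using suminf_ennreal2[of "\<lambda>l. a l * p l t"] a nn by (simp add: ennreal_mult)
  qed
  also have "\<dots> = (\<Sum>l. \<integral>\<^sup>+t. ennreal (a l) * ennreal (p l t) \<partial>lebesgue_on {0<..})"
    by (rule nn_integral_suminf) (intro borel_measurable_times_ennreal measurable_compose[OF p_meas measurable_ennreal] measurable_const, simp)
  also have "\<dots> = (\<Sum>l. ennreal (interp_const \<theta> * (energy u l * (1 + real l) powr (2 * (real n + \<theta>)))))"
  proof (rule suminf_cong)
    fix l
    have "(\<integral>\<^sup>+t. ennreal (a l) * ennreal (p l t) \<partial>lebesgue_on {0<..}) = ennreal (a l) * (\<integral>\<^sup>+t. ennreal (p l t) \<partial>lebesgue_on {0<..})"
      by (rule nn_integral_cmult) (rule measurable_compose[OF p_meas measurable_ennreal])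
    also have "(\<integral>\<^sup>+t. ennreal (p l t) \<partial>lebesgue_on {0<..}) = ennreal ((1 + real l) powr (2 * \<theta>) * interp_const \<theta>)"
      unfolding p_def interp_const_def by (rule nn_integral_interpolation_kernel) (use \<theta> in auto)
    also have "ennreal (a l) * \<dots> = ennreal (a l * ((1 + real l) powr (2 * \<theta>) * interp_const \<theta>))"
      using interp_const_pos[OF \<theta>] a by (intro ennreal_mult[symmetric]) auto
    also have "a l * ((1 + real l) powr (2 * \<theta>) * interp_const \<theta>) =
        interp_const \<theta> * (energy u l * (1 + real l) powr (2 * (real n + \<theta>)))"
    proof -
      have "(1 + real l) ^ (2 * n) = (1 + real l) powr (2 * real n)"
        using powr_realpow[of "1 + real l" "2 * n"] by simp
      then show ?thesis
        by (simp add: a_def distrib_left powr_add)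
    qed
    finally show "(\<integral>\<^sup>+t. ennreal (a l) * ennreal (p l t) \<partial>lebesgue_on {0<..}) =
        ennreal (interp_const \<theta> * (energy u l * (1 + real l) powr (2 * (real n + \<theta>))))" .
  qed
  finally show ?thesis .
qed

text \<open>The integrand lies between two constant multiples of the series integrated in the previous lemma.
  The comparison is made for integrals with values in the extended nonnegative reals and gives both
  the equivalence and the two bounds.\<close>
lemma V_interp_integral:
  assumes u: "u \<in> V_space_nat n" and \<theta>: "0 < \<theta>" "\<theta> < 1"
  defines "\<Sigma> \<equiv> energy_sum u (bracket (real n + \<theta>))"
  shows "integrable (lebesgue_on {0<..}) (V_interp_integrand n \<theta> u) \<longleftrightarrow>
           finite_energy u (bracket (real n + \<theta>))"
    and "finite_energy u (bracket (real n + \<theta>)) \<Longrightarrow> K_lower_const n * interp_const \<theta> * \<Sigma> \<le> (LINT t|lebesgue_on {0<..}. V_interp_integrand n \<theta> u t)"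
    and "finite_energy u (bracket (real n + \<theta>)) \<Longrightarrow> (LINT t|lebesgue_on {0<..}. V_interp_integrand n \<theta> u t) \<le> 2 * (real n + 2) * interp_const \<theta> * \<Sigma>"
proof -
  let ?M = "lebesgue_on {0<..} :: real measure"
  let ?I = "V_interp_integrand n \<theta> u"
  let ?int = "integrable ?M ?I"
  let ?summ = "finite_energy u (bracket (real n + \<theta>))"
  define G where "G t = t powr (- 2 * \<theta>) / t * energy_sum u (K_weight n t)" for t
  define e where "e l = energy u l * (1 + real l) powr (2 * (real n + \<theta>))" for l
  define N where "N = (\<Sum>l. ennreal (interp_const \<theta> * e l))"
  have e: "0 \<le> e l" for l by (simp add: e_def energy_nonneg)
  have Cpos: "0 < interp_const \<theta>" by (rule interp_const_pos[OF \<theta>])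
  have NG: "(\<integral>\<^sup>+t. ennreal (G t) \<partial>?M) = N"
    unfolding G_def N_def e_def by (rule nn_integral_K_weight_series[OF u \<theta>])
  have I_nonneg: "0 \<le> ?I t" if "t \<in> space ?M" for t
    using that by (simp add: V_interp_integrand_def)
  have I_eq: "?I t = t powr (- 2 * \<theta>) / t * (V_K_functional n t u)\<^sup>2" for t
    by (simp add: V_interp_integrand_def)
  have lower: "K_lower_const n * G t \<le> ?I t" if "t \<in> space ?M" for t
  proof -
    have "t powr (- 2 * \<theta>) / t * (K_lower_const n * energy_sum u (K_weight n t))
        \<le> t powr (- 2 * \<theta>) / t * (V_K_functional n t u)\<^sup>2"
      using that by (intro mult_left_mono V_K_functional_lower u) auto
    then show ?thesis unfolding G_def I_eq by (simp only: mult.left_commute)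
  qed
  have upper: "?I t \<le> 2 * (real n + 2) * G t" if "t \<in> space ?M" for t
  proof -
    have "t powr (- 2 * \<theta>) / t * (V_K_functional n t u)\<^sup>2
        \<le> t powr (- 2 * \<theta>) / t * (2 * (real n + 2) * energy_sum u (K_weight n t))"
      using that by (intro mult_left_mono V_K_functional_upper u) auto
    then show ?thesis unfolding G_def I_eq by (simp only: mult.left_commute)
  qed
  have G_nonneg: "0 \<le> G t" if "t \<in> space ?M" for t
    using order_trans[OF I_nonneg upper, OF that that] by (simp add: zero_le_mult_iff)
  have G_meas: "(\<lambda>t. ennreal (G t)) \<in> borel_measurable ?M"
  proof -
    have "(\<lambda>t. \<Sum>l. energy u l * K_weight n t l) \<in> borel_measurable borel"
      unfolding K_weight_def by measurable
    then have "G \<in> borel_measurable borel"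
      unfolding G_def[abs_def] by measurable
    then have "G \<in> borel_measurable ?M"
      by (intro measurable_restrict_space1 measurable_completion) simp
    then show ?thesis by (rule measurable_compose[OF _ measurable_ennreal])
  qed
  have scale: "(\<integral>\<^sup>+t. ennreal (c * G t) \<partial>?M) = ennreal c * N" if "0 \<le> c" for c
  proof -
    have "(\<integral>\<^sup>+t. ennreal (c * G t) \<partial>?M) = (\<integral>\<^sup>+t. ennreal c * ennreal (G t) \<partial>?M)"
      using that G_nonneg by (intro nn_integral_cong ennreal_mult) auto
    also have "\<dots> = ennreal c * N"
      unfolding NG[symmetric] by (rule nn_integral_cmult[OF G_meas])
    finally show ?thesis .
  qed
  have cpos: "0 < K_lower_const n" by (rule K_lower_const_pos)
  have nn_lower: "ennreal (K_lower_const n) * N \<le> (\<integral>\<^sup>+t. ennreal (?I t) \<partial>?M)"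
    using cpos unfolding scale[OF less_imp_le[OF cpos], symmetric] by (intro nn_integral_mono ennreal_leI lower)
  have nn_upper: "(\<integral>\<^sup>+t. ennreal (?I t) \<partial>?M) \<le> ennreal (2 * (real n + 2)) * N"
    by (subst scale[symmetric], simp) (intro nn_integral_mono ennreal_leI upper)
  have N_finite: "N = ennreal (interp_const \<theta> * \<Sigma>)" if "?summ"
  proof -
    have s: "summable e" using that unfolding e_def .
    then have "N = ennreal (\<Sum>l. interp_const \<theta> * e l)"
      unfolding N_def using e Cpos by (intro suminf_ennreal2 summable_mult) auto
    then show ?thesis
      unfolding suminf_mult[OF s] by (simp only: \<Sigma>_def e_def[abs_def])
  qed
  have int: "?int" if "?summ"
  proof (rule integrableI_nonneg)
    show "?I \<in> borel_measurable ?M" by (rule V_interp_integrand_measurable[OF u])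
    show "AE t in ?M. 0 \<le> ?I t" using I_nonneg by (rule AE_I2)
    have "(\<integral>\<^sup>+t. ennreal (?I t) \<partial>?M) \<le> ennreal (2 * (real n + 2)) * ennreal (interp_const \<theta> * \<Sigma>)"
      using nn_upper unfolding N_finite[OF that] .
    also have "\<dots> < \<infinity>" by (simp add: ennreal_mult_less_top)
    finally show "(\<integral>\<^sup>+t. ennreal (?I t) \<partial>?M) < \<infinity>" .
  qed
  show "?int \<longleftrightarrow> ?summ"
  proof
    assume "?int"
    then have "(\<integral>\<^sup>+t. ennreal (?I t) \<partial>?M) = ennreal (LINT t|?M. ?I t)"
      by (rule nn_integral_eq_integral) (rule AE_I2[OF I_nonneg])
    with nn_lower have "ennreal (K_lower_const n) * N < \<infinity>"
      by (metis ennreal_less_top infinity_ennreal_def le_less_trans)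
    then have "N \<noteq> top"
      using cpos by (auto simp: ennreal_mult_less_top)
    then have "summable (\<lambda>l. interp_const \<theta> * e l)"
      unfolding N_def using e Cpos by (intro summable_suminf_not_top) auto
    then show "?summ" using Cpos unfolding e_def by (subst (asm) summable_cmult_iff) auto
  qed (rule int)
  assume s: "?summ"
  have eq: "(\<integral>\<^sup>+t. ennreal (?I t) \<partial>?M) = ennreal (LINT t|?M. ?I t)"
    by (rule nn_integral_eq_integral[OF int[OF s]]) (rule AE_I2[OF I_nonneg])
  have S0: "0 \<le> \<Sigma>"
    unfolding \<Sigma>_def using s e by (intro suminf_nonneg) (simp_all add: e_def)
  have I0: "0 \<le> (LINT t|?M. ?I t)"
    by (rule Bochner_Integration.integral_nonneg_AE) (rule AE_I2[OF I_nonneg])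
  have "ennreal (K_lower_const n * (interp_const \<theta> * \<Sigma>)) \<le> ennreal (LINT t|?M. ?I t)"
    using nn_lower cpos Cpos S0 unfolding eq N_finite[OF s] by (subst ennreal_mult) auto
  then show "K_lower_const n * interp_const \<theta> * \<Sigma> \<le> (LINT t|?M. ?I t)"
    using I0 by (simp add: ennreal_le_iff mult.assoc)
  have "ennreal (LINT t|?M. ?I t) \<le> ennreal (2 * (real n + 2) * (interp_const \<theta> * \<Sigma>))"
    using nn_upper Cpos S0 unfolding eq N_finite[OF s] by (subst ennreal_mult) auto
  then show "(LINT t|?M. ?I t) \<le> 2 * (real n + 2) * interp_const \<theta> * \<Sigma>"
    using Cpos S0 by (subst (asm) ennreal_le_iff) (auto simp: mult.assoc)
qed

definition V_characterized_by :: "real \<Rightarrow> (nat \<Rightarrow> real) \<Rightarrow> bool" where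
  "V_characterized_by \<eta> a \<longleftrightarrow> (\<exists>c>0. \<exists>C>0. \<forall>u\<in>L2_I. (u \<in> V_space \<eta> \<longleftrightarrow> finite_energy u a) \<and>
    (u \<in> V_space \<eta> \<longrightarrow> c * energy_sum u a \<le> (V_norm \<eta> u)\<^sup>2 \<and> (V_norm \<eta> u)\<^sup>2 \<le> C * energy_sum u a))"

lemma V_characterized_by_equivalent_weight:
  assumes V: "V_characterized_by \<eta> a" and a: "\<And>l. 0 \<le> a l"
    and m: "0 < m" "\<And>l. m * a l \<le> b l" and K: "0 < K" "\<And>l. b l \<le> K * a l"
  shows "V_characterized_by \<eta> b"
proof -
  obtain c C where cC: "c > 0" "C > 0" and V': "\<forall>u\<in>L2_I. (u \<in> V_space \<eta> \<longleftrightarrow> finite_energy u a) \<and>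
    (u \<in> V_space \<eta> \<longrightarrow> c * energy_sum u a \<le> (V_norm \<eta> u)\<^sup>2 \<and> (V_norm \<eta> u)\<^sup>2 \<le> C * energy_sum u a)"
    using V unfolding V_characterized_by_def by (elim exE conjE)
  note equiv = summable_equivalent_weights[OF energy_nonneg a m K(2)]
  show ?thesis
    unfolding V_characterized_by_def
  proof (rule exI[of _ "c / K"], rule conjI, simp add: cC K, rule exI[of _ "C / m"], intro conjI ballI impI)
    fix u assume u: "u \<in> L2_I"
    show "u \<in> V_space \<eta> \<longleftrightarrow> finite_energy u b"
      unfolding equiv(1)[symmetric] by (rule V'[rule_format, OF u, THEN conjunct1])
    assume "u \<in> V_space \<eta>"
    with V' u have s: "finite_energy u a" and
      N: "c * energy_sum u a \<le> (V_norm \<eta> u)\<^sup>2" "(V_norm \<eta> u)\<^sup>2 \<le> C * energy_sum u a"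
      by simp_all
    have "c / K * energy_sum u b \<le> c / K * (K * energy_sum u a)"
      using equiv(3)[OF s] cC K(1) by (intro mult_left_mono) auto
    with N(1) K(1) show "c / K * energy_sum u b \<le> (V_norm \<eta> u)\<^sup>2" by simp
    have "C / m * (m * energy_sum u a) \<le> C / m * energy_sum u b"
      using equiv(2)[OF s] cC m(1) by (intro mult_left_mono) auto
    with N(2) m(1) show "(V_norm \<eta> u)\<^sup>2 \<le> C / m * energy_sum u b" by simp
  qed (simp add: cC m)
qed

text \<open>The integer case is the comparison of the two norms, the other case the integral over \<open>t\<close>. In the
  latter, membership in the space of order \<open>n\<close> follows from finiteness of the larger sum of order \<open>\<eta>\<close>.\<close>
lemma V_characterized_by_bracket:
  assumes \<eta>: "0 \<le> \<eta>"
  shows "V_characterized_by \<eta> (bracket \<eta>)"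
proof -
  define n where "n = nat \<lfloor>\<eta>\<rfloor>"
  have pow: "(1 + real l) ^ (2 * n) = (1 + real l) powr (2 * real n)" for l
    using powr_realpow[of "1 + real l" "2 * n"] by simp
  show ?thesis
  proof (cases "\<eta> = real n")
    case True
    have V: "V_space \<eta> = V_space_nat n" "V_norm \<eta> u = V_norm_nat n u" for u
      using True by (simp_all add: V_space_def V_norm_def n_def[symmetric] Let_def)
    show ?thesis
      unfolding V_characterized_by_def V unfolding True pow[symmetric]
    proof (rule exI[of _ "V_weight_const n"], rule conjI[OF V_weight_const_pos],
        rule exI[of _ "real n + 1"], intro conjI ballI impI)
      fix u assume u: "u \<in> L2_I"
      then show "u \<in> V_space_nat n \<longleftrightarrow> finite_energy u (bracket_power n)"
        by (simp only: V_space_nat_iff_power simp_thms)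
    qed (simp, (rule V_norm_nat_power2_bounds, assumption)+)
  next
    case False
    define \<theta> where "\<theta> = \<eta> - real n"
    have "real n \<le> \<eta>" "\<eta> < real n + 1"
      unfolding n_def using \<eta> by (simp_all add: of_nat_floor)
    with False have \<theta>: "0 < \<theta>" "\<theta> < 1" by (auto simp: \<theta>_def)
    have \<eta>_eq: "\<eta> = real n + \<theta>" by (simp add: \<theta>_def)
    have V: "V_space \<eta> = {u \<in> V_space_nat n. integrable (lebesgue_on {0<..}) (V_interp_integrand n \<theta> u)}"
      using False by (simp add: V_space_def n_def[symmetric] Let_def \<theta>_def)
    have norm: "(V_norm \<eta> u)\<^sup>2 = (LINT t|lebesgue_on {0<..}. V_interp_integrand n \<theta> u t)" for u
    proof -
      have "V_norm \<eta> u = sqrt (LINT t|lebesgue_on {0<..}. V_interp_integrand n \<theta> u t)"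
        using False by (simp add: V_norm_def n_def[symmetric] Let_def \<theta>_def)
      moreover have "0 \<le> (LINT t|lebesgue_on {0<..}. V_interp_integrand n \<theta> u t)"
        by (intro Bochner_Integration.integral_nonneg_AE AE_I2) (simp add: V_interp_integrand_def)
      ultimately show ?thesis by simp
    qed
    have nat: "u \<in> V_space_nat n" if u: "u \<in> L2_I" and s: "finite_energy u (bracket \<eta>)" for u
      unfolding V_space_nat_iff_power
    proof (intro conjI u summable_comparison_test'[OF s])
      show "norm (energy u l * (1 + real l) ^ (2 * n)) \<le> energy u l * (1 + real l) powr (2 * \<eta>)" for l
        unfolding pow using energy_nonneg[of u l] \<open>real n \<le> \<eta>\<close>
        by (simp add: abs_mult mult_left_mono powr_mono)
    qed
    have iff: "u \<in> V_space \<eta> \<longleftrightarrow> finite_energy u (bracket \<eta>)" if "u \<in> L2_I" for u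
      using V_interp_integral(1)[OF _ \<theta>, of u n] nat[OF that] unfolding V \<eta>_eq[symmetric] by blast
    have bounds: "K_lower_const n * interp_const \<theta> * energy_sum u (bracket \<eta>) \<le> (V_norm \<eta> u)\<^sup>2"
      "(V_norm \<eta> u)\<^sup>2 \<le> 2 * (real n + 2) * interp_const \<theta> * energy_sum u (bracket \<eta>)"
      if "u \<in> V_space \<eta>" for u
    proof -
      have un: "u \<in> V_space_nat n" using that unfolding V by simp
      have "finite_energy u (bracket \<eta>)"
        using iff[OF V_space_nat_subset_L2_I[OF un]] that by simp
      then show "K_lower_const n * interp_const \<theta> * energy_sum u (bracket \<eta>) \<le> (V_norm \<eta> u)\<^sup>2"
        "(V_norm \<eta> u)\<^sup>2 \<le> 2 * (real n + 2) * interp_const \<theta> * energy_sum u (bracket \<eta>)"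
        unfolding norm using V_interp_integral(2,3)[OF un \<theta>] unfolding \<eta>_eq[symmetric] by blast+
    qed
    show ?thesis
      unfolding V_characterized_by_def
    proof (rule exI[of _ "K_lower_const n * interp_const \<theta>"],
        rule conjI[OF mult_pos_pos[OF K_lower_const_pos interp_const_pos[OF \<theta>]]],
        rule exI[of _ "2 * (real n + 2) * interp_const \<theta>"], intro conjI ballI impI)
      show "0 < 2 * (real n + 2) * interp_const \<theta>"
        using interp_const_pos[OF \<theta>] by simp
    qed (rule iff, assumption, (rule bounds, assumption)+)
  qed
qed

lemma V_characterized_by_legendre_weight:
  assumes "0 \<le> \<eta>"
  shows "V_characterized_by \<eta> (legendre_weight \<eta>)"
proof (rule V_characterized_by_equivalent_weight[OF V_characterized_by_bracket[OF assms]])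
  show "1 / 2 powr (2 * \<eta>) * bracket \<eta> l \<le> legendre_weight \<eta> l" for l
    using legendre_weight_bounds(2)[OF assms, of l] by (simp add: divide_le_eq mult.commute)
  show "legendre_weight \<eta> l \<le> 2 * bracket \<eta> l" for l
    by (rule legendre_weight_bounds(1)[OF assms])
qed simp_all

lemma V_space_subset_L2_I: "u \<in> V_space \<eta> \<Longrightarrow> u \<in> L2_I"
  using V_space_nat_subset_L2_I by (auto simp: V_space_def Let_def split: if_splits)

lemma V_space_characterization:
  assumes "0 \<le> \<eta>"
  shows "\<forall>u\<in>L2_I. u \<in> V_space \<eta> \<longleftrightarrow> finite_energy u (legendre_weight \<eta>)"
    and "\<exists>c>0. \<exists>C>0. \<forall>u\<in>V_space \<eta>. c * energy_sum u (legendre_weight \<eta>) \<le> (V_norm \<eta> u)\<^sup>2 \<and>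
      (V_norm \<eta> u)\<^sup>2 \<le> C * energy_sum u (legendre_weight \<eta>)"
proof -
  obtain c C where cC: "c > 0" "C > 0" and V: "\<forall>u\<in>L2_I. (u \<in> V_space \<eta> \<longleftrightarrow> finite_energy u (legendre_weight \<eta>)) \<and>
    (u \<in> V_space \<eta> \<longrightarrow> c * energy_sum u (legendre_weight \<eta>) \<le> (V_norm \<eta> u)\<^sup>2 \<and>
      (V_norm \<eta> u)\<^sup>2 \<le> C * energy_sum u (legendre_weight \<eta>))"
    using V_characterized_by_legendre_weight[OF assms] unfolding V_characterized_by_def by (elim exE conjE)
  show "\<forall>u\<in>L2_I. u \<in> V_space \<eta> \<longleftrightarrow> finite_energy u (legendre_weight \<eta>)"
    using V by simp
  have "\<forall>u\<in>V_space \<eta>. c * energy_sum u (legendre_weight \<eta>) \<le> (V_norm \<eta> u)\<^sup>2 \<and>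
      (V_norm \<eta> u)\<^sup>2 \<le> C * energy_sum u (legendre_weight \<eta>)"
    using V V_space_subset_L2_I by simp
  with cC show "\<exists>c>0. \<exists>C>0. \<forall>u\<in>V_space \<eta>. c * energy_sum u (legendre_weight \<eta>) \<le> (V_norm \<eta> u)\<^sup>2 \<and>
      (V_norm \<eta> u)\<^sup>2 \<le> C * energy_sum u (legendre_weight \<eta>)"
    by (intro exI conjI)
qed

section \<open>Covariance kernels\<close>

lemma summable_power2_of_nonneg:
  fixes s :: "nat \<Rightarrow> real"
  assumes s: "summable s" and nonneg: "\<And>l. 0 \<le> s l"
  shows "summable (\<lambda>l. (s l)\<^sup>2)"
proof (rule summable_comparison_test_ev[OF _ s])
  have "\<forall>\<^sub>F l in sequentially. s l < 1"
    using summable_LIMSEQ_zero[OF s] by (rule order_tendstoD) simp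
  then show "\<forall>\<^sub>F l in sequentially. norm ((s l)\<^sup>2) \<le> s l"
  proof eventually_elim
    case (elim l)
    then show ?case using nonneg[of l] by (simp add: power2_eq_square mult_left_le)
  qed
qed

text \<open>Evaluate the expansion at two equal points, where all Legendre polynomials are one.\<close>
lemma angular_power_spectrum_summable:
  assumes "angular_power_spectrum M T A"
  shows "0 \<le> A l" and "summable (\<lambda>l. A l * ((2 * real l + 1) / (4 * pi)))"
proof -
  show "0 \<le> A l" using assms unfolding angular_power_spectrum_def by blast
  define e :: "real^3" where "e = axis 1 1"
  have e: "e \<in> sphere 0 1" "e \<bullet> e = 1"
    by (simp_all add: e_def inner_axis_axis)
  have "(\<lambda>l. A l * ((2 * real l + 1) / (4 * pi)) * poly (legendre_poly l) (e \<bullet> e)) sums (LINT \<omega>|M. T e \<omega> * T e \<omega>)"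
    using assms e(1) unfolding angular_power_spectrum_def by blast
  then show "summable (\<lambda>l. A l * ((2 * real l + 1) / (4 * pi)))"
    unfolding e(2) legendre_poly_1 mult_1_right by (rule sums_summable)
qed

lemma inner_product_of_sphere_points:
  assumes "\<mu> \<in> {-1..1}"
  shows "\<exists>x\<in>sphere (0::real^3) 1. \<exists>y\<in>sphere 0 1. x \<bullet> y = \<mu>"
proof -
  define x y :: "real^3" where "x = vector [1, 0, 0]" and "y = vector [\<mu>, sqrt (1 - \<mu>\<^sup>2), 0]"
  have "\<mu>\<^sup>2 \<le> 1" using assms by (simp add: abs_square_le_1 abs_le_iff)
  then have "y \<bullet> y = 1" by (simp add: y_def inner_vec_def sum_3 vector_3 power2_eq_square[symmetric])
  moreover have "x \<bullet> x = 1" by (simp add: x_def inner_vec_def sum_3 vector_3)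
  ultimately have "x \<in> sphere 0 1" "y \<in> sphere 0 1" by (simp_all add: norm_eq_1)
  moreover have "x \<bullet> y = \<mu>" by (simp add: x_def y_def inner_vec_def sum_3 vector_3)
  ultimately show ?thesis by (intro bexI[of _ x] bexI[of _ y])
qed

lemma cov_kernel_sums:
  assumes "angular_power_spectrum M T A" "\<mu> \<in> {-1..1}"
  shows "(\<lambda>l. A l * ((2 * real l + 1) / (4 * pi)) * poly (legendre_poly l) \<mu>) sums cov_kernel A \<mu>"
proof -
  obtain x y :: "real^3" where xy: "x \<in> sphere 0 1" "y \<in> sphere 0 1" "x \<bullet> y = \<mu>"
    using inner_product_of_sphere_points[OF assms(2)] by blast
  have "(\<lambda>l. A l * ((2 * real l + 1) / (4 * pi)) * poly (legendre_poly l) (x \<bullet> y)) sums (LINT \<omega>|M. T x \<omega> * T y \<omega>)"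
    using assms(1) xy(1,2) unfolding angular_power_spectrum_def by blast
  then show ?thesis
    unfolding xy(3) cov_kernel_def by (rule summable_sums[OF sums_summable])
qed

text \<open>The series converges pointwise by hypothesis and in \<open>L\<^sup>2\<close> by Riesz--Fischer, so the kernel is the
  \<open>L\<^sup>2\<close> limit.\<close>
lemma cov_kernel_legendre_coeff:
  assumes aps: "angular_power_spectrum M T A"
  shows "cov_kernel A \<in> L2_I" and "legendre_coeff (cov_kernel A) l = A l / (2 * pi)"
proof -
  define b where "b l = A l * ((2 * real l + 1) / (4 * pi))" for l
  define h where "h l = 2 / (2 * real l + 1)" for l :: nat
  note A = angular_power_spectrum_summable[OF aps]
  have b: "summable b" "0 \<le> b l" for l
    using A by (simp_all add: b_def[abs_def])
  have "summable (\<lambda>l. (b l)\<^sup>2 * h l)"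
  proof (rule summable_comparison_test')
    show "summable (\<lambda>l. 2 * (b l)\<^sup>2)"
      by (intro summable_mult summable_power2_of_nonneg b)
    show "norm ((b l)\<^sup>2 * h l) \<le> 2 * (b l)\<^sup>2" for l
    proof -
      have "h l \<le> 2" by (simp add: h_def divide_le_eq)
      then have "(b l)\<^sup>2 * h l \<le> (b l)\<^sup>2 * 2" by (rule mult_left_mono) simp
      then show ?thesis by (simp add: abs_mult h_def mult.commute)
    qed
  qed
  then have "\<exists>g\<in>L2 lebesgue_I.
    (\<lambda>N. LINT x|lebesgue_I. ((\<Sum>l<N. b l * poly (legendre_poly l) x) - g x)\<^sup>2) \<longlonglongrightarrow> 0 \<and>
    (LINT x|lebesgue_I. (g x)\<^sup>2) = (\<Sum>l. (b l)\<^sup>2 * h l) \<and>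
    (\<forall>k. (LINT x|lebesgue_I. g x * poly (legendre_poly k) x) = b k * h k)"
    by (intro riesz_fischer finite_measure_lebesgue_I poly_L2 legendre_orthogonal)
       (simp_all add: h_def integral_legendre_poly_power2)
  then obtain g where g: "g \<in> L2 lebesgue_I"
    "(\<lambda>N. LINT x|lebesgue_I. ((\<Sum>l<N. b l * poly (legendre_poly l) x) - g x)\<^sup>2) \<longlonglongrightarrow> 0"
    "\<forall>k. (LINT x|lebesgue_I. g x * poly (legendre_poly k) x) = b k * h k"
    by (elim bexE conjE)
  have S: "(\<lambda>x. \<Sum>l<N. b l * poly (legendre_poly l) x) \<in> L2 lebesgue_I" for N
    by (intro L2_sum L2_scale poly_L2)
  have pw: "(\<lambda>N. \<Sum>l<N. b l * poly (legendre_poly l) x) \<longlonglongrightarrow> cov_kernel A x" if "x \<in> {-1<..<1}" for x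
    using cov_kernel_sums[OF aps, of x] that unfolding b_def sums_def by simp
  have AE: "AE x in lebesgue_I. g x = cov_kernel A x"
    by (rule L2_limit_AE_eq_pointwise_limit[OF S g(1,2)]) (rule AE_I2, rule pw, simp)
  have meas: "cov_kernel A \<in> borel_measurable lebesgue_I"
    by (rule borel_measurable_LIMSEQ_real[OF pw L2_measurable[OF S]]) simp
  have "integrable lebesgue_I (\<lambda>x. (cov_kernel A x)\<^sup>2)"
    by (rule integrable_cong_AE_imp[OF L2_integrable_power2[OF g(1)]])
       (use meas AE in \<open>auto elim: eventually_mono\<close>)
  with meas show "cov_kernel A \<in> L2_I" by (simp add: L2_I_def)
  have "legendre_coeff (cov_kernel A) l = legendre_coeff g l"
    by (rule legendre_coeff_cong_AE[OF AE L2_measurable[OF g(1)] meas, symmetric])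
  also have "\<dots> = A l / (2 * pi)"
    using g(3) by (simp add: legendre_coeff_def b_def h_def)
  finally show "legendre_coeff (cov_kernel A) l = A l / (2 * pi)" .
qed

lemma cov_kernel_energy:
  assumes "angular_power_spectrum M T A"
  shows "energy (cov_kernel A) l = (A l)\<^sup>2 * ((2 * real l + 1) / 2) / (4 * pi\<^sup>2)"
  unfolding energy_def cov_kernel_legendre_coeff(2)[OF assms]
  by (simp add: power_divide power_mult_distrib)

text \<open>The finitely many degrees \<open>l < n\<close>, on which the eigenvalue vanishes, are absorbed by the \<open>L\<^sup>2\<close> norm.\<close>
lemma summable_energy_power_iff:
  assumes u: "u \<in> L2_I"
  shows "summable (\<lambda>l. energy u l * real l ^ (2 * n)) \<longleftrightarrow>
         finite_energy u (eigenvalue n)"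
proof
  assume s: "summable (\<lambda>l. energy u l * real l ^ (2 * n))"
  show "finite_energy u (eigenvalue n)"
  proof (rule summable_comparison_test'[where N = 1])
    show "summable (\<lambda>l. 2 ^ (2 * n) * (energy u l * real l ^ (2 * n)))"
      by (rule summable_mult[OF s])
    fix l :: nat assume "1 \<le> l"
    then have "(1 + real l) ^ (2 * n) \<le> (2 * real l) ^ (2 * n)"
      by (intro power_mono) auto
    then have "eigenvalue n l \<le> 2 ^ (2 * n) * real l ^ (2 * n)"
      using eigenvalue_le[of n l] by (simp add: power_mult_distrib)
    then have "energy u l * eigenvalue n l \<le> energy u l * (2 ^ (2 * n) * real l ^ (2 * n))"
      by (rule mult_left_mono) (rule energy_nonneg)
    then show "norm (energy u l * eigenvalue n l) \<le> 2 ^ (2 * n) * (energy u l * real l ^ (2 * n))"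
      using energy_nonneg[of u l] eigenvalue_nonneg[of n l]
      by (simp add: abs_mult mult.left_commute)
  qed
next
  assume s: "finite_energy u (eigenvalue n)"
  show "summable (\<lambda>l. energy u l * real l ^ (2 * n))"
  proof (rule summable_comparison_test')
    show "summable (\<lambda>l. (1 + real n) ^ (2 * n) * (energy u l + energy u l * eigenvalue n l))"
      by (intro summable_mult summable_add summable_energy u s)
    fix l :: nat
    have "real l ^ (2 * n) \<le> (1 + real l) ^ (2 * n)" by (intro power_mono) auto
    also have "\<dots> \<le> (1 + real n) ^ (2 * n) * (1 + eigenvalue n l)"
      by (rule power_le_eigenvalue)
    finally have "energy u l * real l ^ (2 * n) \<le>
        energy u l * ((1 + real n) ^ (2 * n) * (1 + eigenvalue n l))"
      by (rule mult_left_mono) (rule energy_nonneg)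
    then show "norm (energy u l * real l ^ (2 * n)) \<le>
       (1 + real n) ^ (2 * n) * (energy u l + energy u l * eigenvalue n l)"
      using energy_nonneg[of u l] by (simp add: abs_mult algebra_simps)
  qed
qed

lemma summable_on_atLeast_iff:
  fixes f :: "nat \<Rightarrow> real"
  assumes "\<And>l. 0 \<le> f l"
  shows "f summable_on {n..} \<longleftrightarrow> summable f"
proof -
  have "f summable_on {n..} \<longleftrightarrow> f summable_on UNIV"
  proof
    assume "f summable_on {n..}"
    then have "f summable_on ({..<n} \<union> {n..})"
      by (intro summable_on_Un_disjoint) auto
    moreover have "{..<n} \<union> {n..} = UNIV" by auto
    ultimately show "f summable_on UNIV" by simp
  qed (rule summable_on_subset_banach, auto)
  then show ?thesis
    using assms by (simp add: summable_on_UNIV_nonneg_real_iff)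
qed

abbreviation (input) powr_weighted_L2 :: "nat \<Rightarrow> (real \<Rightarrow> real) \<Rightarrow> bool" where
  "powr_weighted_L2 n v \<equiv> (\<lambda>\<mu>. (1 - \<mu>\<^sup>2) powr (real n / 2) * v \<mu>) \<in> L2_I"

abbreviation (input) nn_weighted_L2 :: "nat \<Rightarrow> (real \<Rightarrow> real) \<Rightarrow> bool" where
  "nn_weighted_L2 n v \<equiv> (\<integral>\<^sup>+\<mu>. ennreal (\<bar>v \<mu>\<bar>\<^sup>2 * (1 - \<mu>\<^sup>2) ^ n) \<partial>lebesgue_I) < \<infinity>"

lemma weighted_L2_iff:
  assumes v: "v \<in> borel_measurable lebesgue_I"
  shows "powr_weighted_L2 n v \<longleftrightarrow> weighted_L2 n v"
    and "nn_weighted_L2 n v \<longleftrightarrow> weighted_L2 n v"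
proof -
  have "(\<lambda>x::real. (1 - x\<^sup>2) powr (real n / 2)) \<in> borel_measurable borel" by measurable
  then have w: "(\<lambda>x::real. (1 - x\<^sup>2) powr (real n / 2)) \<in> borel_measurable lebesgue_I"
    by (rule borel_measurable_lebesgue_I)
  have "integrable lebesgue_I (\<lambda>x. ((1 - x\<^sup>2) powr (real n / 2) * v x)\<^sup>2) \<longleftrightarrow> weighted_L2 n v"
  proof (intro Bochner_Integration.integrable_cong refl)
    fix x :: real assume "x \<in> space lebesgue_I"
    then have pos: "0 < 1 - x\<^sup>2" by (intro weight_pos) simp
    have "((1 - x\<^sup>2) powr (real n / 2))\<^sup>2 = (1 - x\<^sup>2) powr real n"
      by (simp add: power2_eq_square powr_add[symmetric])
    also have "\<dots> = (1 - x\<^sup>2) ^ n" by (rule powr_realpow[OF pos])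
    finally show "((1 - x\<^sup>2) powr (real n / 2) * v x)\<^sup>2 = \<bar>v x\<bar>\<^sup>2 * (1 - x\<^sup>2) ^ n"
      by (simp add: power_mult_distrib mult.commute)
  qed
  moreover have "(\<lambda>x. (1 - x\<^sup>2) powr (real n / 2) * v x) \<in> borel_measurable lebesgue_I"
    by (rule borel_measurable_times[OF w v])
  ultimately show "powr_weighted_L2 n v \<longleftrightarrow> weighted_L2 n v"
    by (simp add: L2_I_def)
  have m: "(\<lambda>x. \<bar>v x\<bar>\<^sup>2 * (1 - x\<^sup>2) ^ n) \<in> borel_measurable lebesgue_I"
    by (intro borel_measurable_times borel_measurable_power borel_measurable_abs v
        continuous_imp_borel_measurable_lebesgue_I continuous_intros)
  have nn: "AE x in lebesgue_I. 0 \<le> \<bar>v x\<bar>\<^sup>2 * (1 - x\<^sup>2) ^ n"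
    using weight_pos by (intro AE_I2) (simp add: less_imp_le)
  show "nn_weighted_L2 n v \<longleftrightarrow> weighted_L2 n v"
  proof
    assume "nn_weighted_L2 n v"
    then show "weighted_L2 n v"
      by (rule integrableI_nonneg[OF m nn])
  next
    assume "weighted_L2 n v"
    from nn_integral_eq_integral[OF this nn]
    show "nn_weighted_L2 n v"
      by (simp only: ennreal_less_top infinity_ennreal_def)
  qed
qed

text \<open>Both sequences are comparable to \<open>energy l * l ^ (2 * n)\<close>, since \<open>(2 * l + 1) / 2\<close> is comparable to
  \<open>l\<close> for \<open>l \<ge> 1\<close>; at \<open>l = 0\<close> the first sequence is always zero, whereas for \<open>n = 0\<close> the second need
  not be.\<close>
lemma spectrum_summable_iff:
  assumes aps: "angular_power_spectrum M T A"
  shows "((\<lambda>l. (real l powr (real n + 1/2) * A l)\<^sup>2) summable_on {n..}) \<longleftrightarrow>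
           finite_energy (cov_kernel A) (eigenvalue n)"
    and "((\<lambda>l. 1 / (4 * pi)\<^sup>2 * ((A l)\<^sup>2 * ((2 * real l + 1) / 2) * real l ^ (2 * n))) summable_on {n..}) \<longleftrightarrow>
           finite_energy (cov_kernel A) (eigenvalue n)"
proof -
  define E where "E l = energy (cov_kernel A) l * real l ^ (2 * n)" for l
  have E: "E l = (A l)\<^sup>2 * ((2 * real l + 1) / 2) / (4 * pi\<^sup>2) * real l ^ (2 * n)" for l
    by (simp add: E_def cov_kernel_energy[OF aps])
  have E_iff: "summable E \<longleftrightarrow> finite_energy (cov_kernel A) (eigenvalue n)"
    unfolding E_def[abs_def] by (rule summable_energy_power_iff[OF cov_kernel_legendre_coeff(1)[OF aps]])
  have "1 / (4 * pi)\<^sup>2 * ((A l)\<^sup>2 * ((2 * real l + 1) / 2) * real l ^ (2 * n)) = 1 / 4 * E l" for l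
    by (simp add: E power_mult_distrib)
  then have "((\<lambda>l. 1 / (4 * pi)\<^sup>2 * ((A l)\<^sup>2 * ((2 * real l + 1) / 2) * real l ^ (2 * n))) summable_on {n..}) \<longleftrightarrow> summable (\<lambda>l. 1 / 4 * E l)"
    by (simp only:) (rule summable_on_atLeast_iff, simp add: E_def energy_nonneg)
  then show "((\<lambda>l. 1 / (4 * pi)\<^sup>2 * ((A l)\<^sup>2 * ((2 * real l + 1) / 2) * real l ^ (2 * n))) summable_on {n..}) \<longleftrightarrow>
      finite_energy (cov_kernel A) (eigenvalue n)"
    unfolding E_iff[symmetric] by (simp only: summable_cmult_iff) simp
  define F where "F l = (real l powr (real n + 1/2) * A l)\<^sup>2" for l
  have F: "F l = real l * real l ^ (2 * n) * (A l)\<^sup>2" for l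
  proof (cases "l = 0")
    case False
    have "(real l powr (real n + 1/2))\<^sup>2 = real l powr (real (2 * n + 1))"
      by (simp add: power2_eq_square powr_add[symmetric] add.commute)
    also have "\<dots> = real l ^ (2 * n + 1)" using False by (intro powr_realpow) simp
    finally show ?thesis by (simp add: F_def power_mult_distrib)
  qed (simp add: F_def)
  have "summable F \<longleftrightarrow> summable E"
  proof
    assume s: "summable F"
    show "summable E"
    proof (rule summable_comparison_test'[where N = 1, OF s])
      fix l :: nat assume l: "1 \<le> l"
      have "1 ^ 2 \<le> pi\<^sup>2" using pi_ge_two by (intro power_mono) auto
      then have "(2 * real l + 1) / 2 / (4 * pi\<^sup>2) \<le> (2 * real l + 1) / 2 / 2"
        by (intro divide_left_mono) auto
      also have "\<dots> \<le> real l" using l by simp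
      finally have "((A l)\<^sup>2 * real l ^ (2 * n)) * ((2 * real l + 1) / 2 / (4 * pi\<^sup>2)) \<le> ((A l)\<^sup>2 * real l ^ (2 * n)) * real l"
        by (rule mult_left_mono) simp
      moreover have "0 \<le> E l" by (simp add: E_def energy_nonneg)
      ultimately show "norm (E l) \<le> F l"
        by (simp add: E F mult_ac)
    qed
  next
    assume s: "summable E"
    show "summable F"
    proof (rule summable_comparison_test'[OF summable_mult[OF s, of "4 * pi\<^sup>2"]])
      fix l
      have "((A l)\<^sup>2 * real l ^ (2 * n)) * real l \<le> ((A l)\<^sup>2 * real l ^ (2 * n)) * ((2 * real l + 1) / 2)"
        by (rule mult_left_mono) simp_all
      moreover have "4 * pi\<^sup>2 * E l = ((A l)\<^sup>2 * real l ^ (2 * n)) * ((2 * real l + 1) / 2)"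
        by (simp add: E)
      moreover have "0 \<le> F l" by (simp add: F_def)
      ultimately show "norm (F l) \<le> 4 * pi\<^sup>2 * E l"
        by (simp add: F mult_ac)
    qed
  qed
  moreover have "F summable_on {n..} \<longleftrightarrow> summable F"
    by (rule summable_on_atLeast_iff) (simp add: F_def)
  ultimately show "((\<lambda>l. (real l powr (real n + 1/2) * A l)\<^sup>2) summable_on {n..}) \<longleftrightarrow>
           finite_energy (cov_kernel A) (eigenvalue n)"
    unfolding E_iff[symmetric] F_def[abs_def] by simp
qed

lemma weak_deriv_exists_iff:
  assumes u: "u \<in> L2_I"
  shows "(\<exists>v. is_weak_deriv n u v \<and> powr_weighted_L2 n v) \<longleftrightarrow>
           finite_energy u (eigenvalue n)"
    and "(\<exists>v. is_weak_deriv n u v \<and> nn_weighted_L2 n v) \<longleftrightarrow>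
           finite_energy u (eigenvalue n)"
proof -
  have meas: "v \<in> borel_measurable lebesgue_I" if "is_weak_deriv n u v" for v
    using that locally_integrable_I_measurable unfolding is_weak_deriv_def by blast
  have "is_weak_deriv n u v \<and> powr_weighted_L2 n v \<longleftrightarrow>
      is_weak_deriv n u v \<and> weighted_L2 n v"
    "is_weak_deriv n u v \<and> nn_weighted_L2 n v \<longleftrightarrow>
      is_weak_deriv n u v \<and> weighted_L2 n v" for v
    using weighted_L2_iff[OF meas] by (intro conj_cong refl; simp only:)+
  then show "(\<exists>v. is_weak_deriv n u v \<and> powr_weighted_L2 n v) \<longleftrightarrow>
           finite_energy u (eigenvalue n)"
    "(\<exists>v. is_weak_deriv n u v \<and> nn_weighted_L2 n v) \<longleftrightarrow>
           finite_energy u (eigenvalue n)"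
    by (simp_all only: weighted_integrable_weak_deriv_iff[OF u])
qed

lemma weak_deriv_of_V_space:
  assumes "u \<in> V_space (real n)"
  shows "finite_energy u (eigenvalue n)"
    and "powr_weighted_L2 n (weak_deriv n u)"
    and "nn_weighted_L2 n (weak_deriv n u)"
proof -
  have u: "u \<in> L2_I" and s: "finite_energy u (V_weight n)"
    using assms by (simp_all add: V_space_def V_space_nat_iff)
  show sn: "finite_energy u (eigenvalue n)"
    using s summable_V_weight_iff by blast
  have meas: "weak_deriv n u \<in> borel_measurable lebesgue_I"
    using weak_deriv_weighted_integral(1)[OF u sn] locally_integrable_I_measurable unfolding is_weak_deriv_def by blast
  show "powr_weighted_L2 n (weak_deriv n u)"
    "nn_weighted_L2 n (weak_deriv n u)"
    unfolding weighted_L2_iff[OF meas] by (rule weak_deriv_weighted_integral(2)[OF u sn])+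
qed

lemma spectrum_summable_iff_weak_deriv:
  assumes aps: "angular_power_spectrum M T A"
  shows "((\<lambda>l. (real l powr (real n + 1/2) * A l)\<^sup>2) summable_on {n..}) \<longleftrightarrow>
      (\<exists>v. is_weak_deriv n (cov_kernel A) v \<and> powr_weighted_L2 n v)"
    and "((\<lambda>l. 1 / (4 * pi)\<^sup>2 * ((A l)\<^sup>2 * ((2 * real l + 1) / 2) * real l ^ (2 * n))) summable_on {n..}) \<longleftrightarrow>
      (\<exists>v. is_weak_deriv n (cov_kernel A) v \<and> nn_weighted_L2 n v)"
    and "cov_kernel A \<in> V_space (real n) \<Longrightarrow>
      ((\<lambda>l. (real l powr (real n + 1/2) * A l)\<^sup>2) summable_on {n..}) \<longleftrightarrow>
      powr_weighted_L2 n (weak_deriv n (cov_kernel A))"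
    and "cov_kernel A \<in> V_space (real n) \<Longrightarrow>
      ((\<lambda>l. 1 / (4 * pi)\<^sup>2 * ((A l)\<^sup>2 * ((2 * real l + 1) / 2) * real l ^ (2 * n))) summable_on {n..}) \<longleftrightarrow>
      nn_weighted_L2 n (weak_deriv n (cov_kernel A))"
  using weak_deriv_of_V_space[of "cov_kernel A" n]
  by (simp_all only: spectrum_summable_iff[OF aps] weak_deriv_exists_iff[OF cov_kernel_legendre_coeff(1)[OF aps]])

theorem theorem3p1:
  shows
    "(\<forall>\<eta>\<ge>0::real.
        (\<forall>u\<in>L2_I. u \<in> V_space \<eta> \<longleftrightarrow>
           summable (\<lambda>l. (legendre_coeff u l)\<^sup>2 * ((2 * real l + 1) / 2) * legendre_weight \<eta> l)) \<and>
        (\<exists>c>0. \<exists>C>0. \<forall>u\<in>V_space \<eta>.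
           c * (\<Sum>l. (legendre_coeff u l)\<^sup>2 * ((2 * real l + 1) / 2) * legendre_weight \<eta> l)
             \<le> (V_norm \<eta> u)\<^sup>2 \<and>
           (V_norm \<eta> u)\<^sup>2
             \<le> C * (\<Sum>l. (legendre_coeff u l)\<^sup>2 * ((2 * real l + 1) / 2) * legendre_weight \<eta> l))) \<and>
     (\<forall>(M :: 'w measure) T A (n :: nat).
        centered_isotropic_gaussian_field M T \<longrightarrow> angular_power_spectrum M T A \<longrightarrow>
        (cov_kernel A \<in> V_space (real n) \<longrightarrow>
           ((\<lambda>l. (real l powr (real n + 1/2) * A l)\<^sup>2) summable_on {n..} \<longleftrightarrow>
              (\<lambda>\<mu>. (1 - \<mu>\<^sup>2) powr (real n / 2) * weak_deriv n (cov_kernel A) \<mu>) \<in> L2_I) \<and>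
           ((\<lambda>l. 1 / (4 * pi)\<^sup>2 * ((A l)\<^sup>2 * ((2 * real l + 1) / 2) * real l ^ (2 * n))) summable_on {n..} \<longleftrightarrow>
              (\<integral>\<^sup>+\<mu>. ennreal (\<bar>weak_deriv n (cov_kernel A) \<mu>\<bar>\<^sup>2 * (1 - \<mu>\<^sup>2) ^ n) \<partial>lebesgue_I) < \<infinity>)) \<and>
        ((\<lambda>l. (real l powr (real n + 1/2) * A l)\<^sup>2) summable_on {n..} \<longleftrightarrow>
           (\<exists>v. is_weak_deriv n (cov_kernel A) v \<and>
              (\<lambda>\<mu>. (1 - \<mu>\<^sup>2) powr (real n / 2) * v \<mu>) \<in> L2_I)) \<and>
        ((\<lambda>l. 1 / (4 * pi)\<^sup>2 * ((A l)\<^sup>2 * ((2 * real l + 1) / 2) * real l ^ (2 * n))) summable_on {n..} \<longleftrightarrow>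
           (\<exists>v. is_weak_deriv n (cov_kernel A) v \<and>
              (\<integral>\<^sup>+\<mu>. ennreal (\<bar>v \<mu>\<bar>\<^sup>2 * (1 - \<mu>\<^sup>2) ^ n) \<partial>lebesgue_I) < \<infinity>)))"
  by (intro conjI allI impI)
     (rule V_space_characterization[unfolded energy_def] spectrum_summable_iff_weak_deriv; assumption)+

end
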